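(* Let $\Omega$ be simply connected and let $\mathcal{T}_h$ be any triangulation of $\Omega$ satisfying $E_0+3V_0+\sigma\ge E-E_0$. Then $\operatorname{div}{\bf V}_h^3=Q_h^2$ if and only if $\dim S_h^4=2E_0-E+3V_0+\sigma$. More generally, for an integer $K$, $\dim(\operatorname{div}{\bf V}_h^3)=\dim Q_h^2-K$ if and only if $\dim S_h^4=2E_0-E+3V_0+\sigma+K$.
   Context: $\Omega\subset\mathbb{R}^2$ is a simply connected polygonal domain with conforming triangulation $\mathcal{T}_h$. $E$ = number of edges, $E_0$ = number of interior edges, $V_0$ = number of interior vertices, $\sigma$ = number of singular vertices (interior and boundary). A vertex $z$ with triangles $T_1,\dots,T_N$ (enumerated so consecutive ones share an edge, $T_N,T_1$ too if $z$ is interior, and $T_1,T_N$ having an edge on $\partial\Omega$ if $z$ is a boundary vertex) and angles $\theta_j$ of $T_j$ at $z$ is singular if $\max_j|\sin(\theta_j+\theta_{j+1})|=0$, the max over $1\le j\le N$ with $\theta_{N+1}=\theta_1$ for interior $z$ and over $1\le j\le N-1$ for boundary $z$. ${\bf V}_h^3$: continuous piecewise cubic vector fields vanishing on $\partial\Omega$. $Q_h^2=\{q\in L^2(\Omega):\int_\Omega q=0,\ q|_T\in P^2(T)\ \forall T,\ \sum_j(-1)^{j-1}q|_{T_j}(z)=0 \text{ for every singular vertex } z\}$. $S_h^4$ is the space of $C^1(\overline\Omega)$ functions that are quartic polynomials on each triangle and vanish to second order on $\partial\Omega$ (the function and its gradient vanish on $\partial\Omega$). *)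

theory Defs
  imports "HOL-Analysis.Analysis" "HOL-Library.Function_Algebras"
begin

type_synonym pt = "real \<times> real"

text \<open>A triangle is given by its set of three non-collinear vertices; the closed
  triangle is the convex hull of that set.\<close>

definition is_triangle :: "pt set \<Rightarrow> bool" where
  "is_triangle V \<longleftrightarrow> card V = 3 \<and> \<not> collinear V"

definition conforming :: "pt set set \<Rightarrow> bool" where
  "conforming Th \<longleftrightarrow> finite Th \<and> Th \<noteq> {} \<and> (\<forall>V\<in>Th. is_triangle V) \<and>
     (\<forall>V\<in>Th. \<forall>W\<in>Th. V \<noteq> W \<longrightarrow> convex hull V \<inter> convex hull W = convex hull (V \<inter> W))"

definition dom_of :: "pt set set \<Rightarrow> pt set" where
  "dom_of Th = interior (\<Union>V\<in>Th. convex hull V)"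

definition vertices :: "pt set set \<Rightarrow> pt set" where
  "vertices Th = \<Union>Th"

definition edges :: "pt set set \<Rightarrow> pt set set" where
  "edges Th = {e. card e = 2 \<and> (\<exists>V\<in>Th. e \<subseteq> V)}"

definition interior_edges :: "pt set set \<Rightarrow> pt set set" where
  "interior_edges Th = {e \<in> edges Th. \<not> convex hull e \<subseteq> frontier (dom_of Th)}"

definition interior_vertices :: "pt set set \<Rightarrow> pt set" where
  "interior_vertices Th = {z \<in> vertices Th. z \<in> dom_of Th}"

definition vangle :: "pt \<Rightarrow> pt \<Rightarrow> real" where
  "vangle u v = arccos ((u \<bullet> v) / (norm u * norm v))"

definition angle_at :: "pt set \<Rightarrow> pt \<Rightarrow> real" where
  "angle_at V z = (THE t. \<exists>a b. V = {z, a, b} \<and> a \<noteq> b \<and> z \<noteq> a \<and> z \<noteq> b \<and>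
                              t = vangle (a - z) (b - z))"

definition vertex_enum :: "pt set set \<Rightarrow> pt \<Rightarrow> pt set list \<Rightarrow> bool" where
  "vertex_enum Th z Ts \<longleftrightarrow>
     distinct Ts \<and> set Ts = {V\<in>Th. z \<in> V} \<and> Ts \<noteq> [] \<and>
     (\<forall>j. j + 1 < length Ts \<longrightarrow> card (Ts ! j \<inter> Ts ! (j + 1)) = 2) \<and>
     (if z \<in> dom_of Th
      then card (last Ts \<inter> hd Ts) = 2
      else (\<exists>e. card e = 2 \<and> z \<in> e \<and> e \<subseteq> hd Ts \<and> convex hull e \<subseteq> frontier (dom_of Th)) \<and>
           (\<exists>e. card e = 2 \<and> z \<in> e \<and> e \<subseteq> last Ts \<and> convex hull e \<subseteq> frontier (dom_of Th)))"

text \<open>Singular vertex: max_j |sin(theta_j + theta_(j+1))| = 0, i.e. all these sines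
  vanish (the max over an empty index range, N = 1 at a boundary vertex, is 0).\<close>
definition singular_vertex :: "pt set set \<Rightarrow> pt \<Rightarrow> bool" where
  "singular_vertex Th z \<longleftrightarrow> z \<in> vertices Th \<and>
     (\<exists>Ts. vertex_enum Th z Ts \<and>
        (let N = length Ts; th = (\<lambda>j. angle_at (Ts ! j) z) in
         if z \<in> dom_of Th
         then (\<forall>j<N. sin (th j + th ((j + 1) mod N)) = 0)
         else (\<forall>j. j + 1 < N \<longrightarrow> sin (th j + th (j + 1)) = 0)))"

definition num_singular :: "pt set set \<Rightarrow> nat" where
  "num_singular Th = card {z. singular_vertex Th z}"

definition poly2 :: "nat \<Rightarrow> (pt \<Rightarrow> real) \<Rightarrow> bool" where
  "poly2 k p \<longleftrightarrow> (\<exists>c :: nat \<Rightarrow> nat \<Rightarrow> real. \<forall>x y.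
      p (x, y) = (\<Sum>i\<le>k. \<Sum>j\<le>k - i. c i j * x ^ i * y ^ j))"

definition dx :: "(pt \<Rightarrow> real) \<Rightarrow> pt \<Rightarrow> real" where
  "dx f x = frechet_derivative f (at x) (1, 0)"

definition dy :: "(pt \<Rightarrow> real) \<Rightarrow> pt \<Rightarrow> real" where
  "dy f x = frechet_derivative f (at x) (0, 1)"

text \<open>V_h^3: continuous piecewise cubic vector fields vanishing on the boundary
  (extended by zero outside the domain).\<close>
definition Vh3 :: "pt set set \<Rightarrow> (pt \<Rightarrow> pt) set" where
  "Vh3 Th = {u. continuous_on UNIV u \<and> (\<forall>x. x \<notin> dom_of Th \<longrightarrow> u x = 0) \<and>
      (\<forall>V\<in>Th. \<exists>p1 p2. poly2 3 p1 \<and> poly2 3 p2 \<and>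
                  (\<forall>x\<in>convex hull V. u x = (p1 x, p2 x)))}"

text \<open>Piecewise polynomials are represented by the family of their polynomial pieces,
  q T being the polynomial q|_T (and 0 for non-triangles).\<close>
definition div_Vh3 :: "pt set set \<Rightarrow> (pt set \<Rightarrow> pt \<Rightarrow> real) set" where
  "div_Vh3 Th = {q. (\<forall>T. T \<notin> Th \<longrightarrow> q T = (\<lambda>x. 0)) \<and>
     (\<exists>u\<in>Vh3 Th. \<forall>T\<in>Th. \<exists>p1 p2. poly2 3 p1 \<and> poly2 3 p2 \<and>
          (\<forall>x\<in>convex hull T. u x = (p1 x, p2 x)) \<and>
          q T = (\<lambda>x. dx p1 x + dy p2 x))}"

definition Qh2 :: "pt set set \<Rightarrow> (pt set \<Rightarrow> pt \<Rightarrow> real) set" where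
  "Qh2 Th = {q. (\<forall>T. T \<notin> Th \<longrightarrow> q T = (\<lambda>x. 0)) \<and> (\<forall>T\<in>Th. poly2 2 (q T)) \<and>
     (\<Sum>T\<in>Th. integral (convex hull T) (q T)) = 0 \<and>
     (\<forall>z. singular_vertex Th z \<longrightarrow>
        (\<forall>Ts. vertex_enum Th z Ts \<longrightarrow>
           (\<Sum>j<length Ts. (-1) ^ j * q (Ts ! j) z) = 0))}"

text \<open>S_h^4: C^1 piecewise quartics vanishing to second order on the boundary
  (extended by zero outside the domain).\<close>
definition Sh4 :: "pt set set \<Rightarrow> (pt \<Rightarrow> real) set" where
  "Sh4 Th = {f. (\<forall>x. f differentiable (at x)) \<and>
      continuous_on UNIV (dx f) \<and> continuous_on UNIV (dy f) \<and>
      (\<forall>x. x \<notin> dom_of Th \<longrightarrow> f x = 0) \<and>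
      (\<forall>x\<in>frontier (dom_of Th). dx f x = 0 \<and> dy f x = 0) \<and>
      (\<forall>V\<in>Th. \<exists>p. poly2 4 p \<and> (\<forall>x\<in>convex hull V. f x = p x))}"

definition dimF :: "(pt \<Rightarrow> real) set \<Rightarrow> nat" where
  "dimF S = vector_space.dim (\<lambda>c f x. c * f x) S"

definition dimPW :: "(pt set \<Rightarrow> pt \<Rightarrow> real) set \<Rightarrow> nat" where
  "dimPW S = vector_space.dim (\<lambda>c q T x. c * q T x) S"

end

theory Submission
  imports Defs "HOL-Complex_Analysis.Riemann_Mapping"
begin

text \<open>Write \<open>V\<^sub>0\<close>, \<open>E\<^sub>0\<close>, \<open>T\<close> for the numbers of interior vertices, interior edges and triangles.
  The velocity fields have dimension \<open>2 (V\<^sub>0 + 2 E\<^sub>0 + T)\<close> (two nodes on each interior edge and one in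
  each triangle), and the pressures have dimension \<open>6 T - 1 - \<sigma>\<close>, since the mean value and the
  alternating sums at the singular vertices are independent functionals.  A divergence-free field in
  the velocity space is the curl of a unique function in \<open>S\<^sub>h\<^sup>4\<close>, because the complement of
  the domain is connected; hence \<open>dim (div V) = dim V - dim S\<close>.  As every divergence is an
  admissible pressure, it remains to compare the numbers by means of \<open>E + E\<^sub>0 = 3 T\<close> and the
  Euler relation \<open>V\<^sub>0 - E\<^sub>0 + T = 1\<close>.  The latter is a dimension count in the complex of
  functions on interior vertices, interior edges and triangles, whose exactness in the middle is shown
  by lifting a map from the plane to the circle.\<close>

section \<open>Dimensions of function spaces\<close>

text \<open>The obstacle is topological: the domain is only the interior of a union of triangles,
  and no boundary curve comes with it. Simple connectivity enters through two consequences,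
  connectedness of \<open>\<Omega>\<close> and of its complement. The first links all triangles
  through common edges. The second forces a lift that is locally constant off
  \<open>\<Omega>\<close> to have a single value there, so that one potential vanishes at all
  boundary vertices at once. The resulting \<open>closed_imp_exact\<close> serves twice: for the
  Euler relation, and for matching the local stream functions of a divergence-free field. A map to
  the circle sees integer periods only, hence the detour over integral and rational edge functions.

  At a singular vertex the factors \<open>(-1) ^ j\<close> are replaced by signs of the four
  quadrants cut out by the two lines that carry its edges. These need no enumeration, and they make
  both the vanishing of the sums for a divergence and the independence of the constraints
  computations with single triangles and edges.\<close>

context vector_space_pair
begin

text \<open>Divergence and curl are additive only on the subspace in question, whereas
  \<open>linear\<close> concerns total maps. A linear extension from the basis \<open>B\<close>
  agrees with \<open>f\<close> on a subspace that contains \<open>B\<close>, hence on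
  \<open>V\<close>.\<close>

lemma additive_on_imp_linear:
  assumes V: "vs1.subspace V"
    and add: "\<And>x y. x \<in> V \<Longrightarrow> y \<in> V \<Longrightarrow> f (x + y) = f x + f y"
    and scale: "\<And>c x. x \<in> V \<Longrightarrow> f (s1 c x) = s2 c (f x)"
    and B: "B \<subseteq> V" "vs1.independent B" "V \<subseteq> vs1.span B"
  obtains g where "Vector_Spaces.linear s1 s2 g" "\<And>x. x \<in> V \<Longrightarrow> g x = f x"
proof -
  obtain g where g: "Vector_Spaces.linear s1 s2 g" "\<forall>x\<in>B. g x = f x"
    using linear_independent_extend[OF B(2)] by blast
  interpret g: Vector_Spaces.linear s1 s2 g by fact
  have f0: "f 0 = 0"
    using scale[OF vs1.subspace_0[OF V], of 0] by (simp add: vs2.scale_zero_left)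
  have "vs1.subspace {x\<in>V. g x = f x}"
    unfolding vs1.subspace_def
    using vs1.subspace_0[OF V] vs1.subspace_add[OF V] vs1.subspace_scale[OF V]
    by (auto simp: f0 add scale g.add g.scale g.zero)
  then have "vs1.span B \<subseteq> {x\<in>V. g x = f x}"
    using B(1) g(2) by (intro vs1.span_minimal) auto
  then show ?thesis
    using that g(1) B(3) by blast
qed

lemma dim_image_inj_on:
  assumes V: "vs1.subspace V"
    and add: "\<And>x y. x \<in> V \<Longrightarrow> y \<in> V \<Longrightarrow> f (x + y) = f x + f y"
    and scale: "\<And>c x. x \<in> V \<Longrightarrow> f (s1 c x) = s2 c (f x)"
    and inj: "inj_on f V"
  shows "vs2.dim (f ` V) = vs1.dim V"
proof -
  obtain B where B: "B \<subseteq> V" "vs1.independent B" "V \<subseteq> vs1.span B" "card B = vs1.dim V"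
    using vs1.basis_exists .
  obtain g where g: "Vector_Spaces.linear s1 s2 g" "\<And>x. x \<in> V \<Longrightarrow> g x = f x"
    using additive_on_imp_linear[OF V add scale B(1-3)] by blast
  interpret g: Vector_Spaces.linear s1 s2 g by fact
  have sp: "vs1.span B = V"
    using B V vs1.span_minimal by blast
  have inj': "inj_on g (vs1.span B)"
    using inj g(2) unfolding sp inj_on_def by auto
  have "vs2.independent (g ` B)"
    using B(2) inj' by (rule g.independent_injective_image)
  then have "vs2.dim (vs2.span (g ` B)) = card (g ` B)"
    by (rule vs2.dim_span_eq_card_independent)
  also have "vs2.span (g ` B) = f ` V"
    using g.span_image[of B] sp g(2) by auto
  also have "card (g ` B) = card B"
    using inj' sp B(1) by (intro card_image) (auto intro: inj_on_subset)
  finally show ?thesis using B(4) by simp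
qed

text \<open>A basis \<open>B0\<close> of the kernel is extended to a basis \<open>B\<close> of
  \<open>V\<close>; the added vectors \<open>C\<close> map injectively to a basis of the image.
  Finiteness is asked of the source alone.\<close>

lemma rank_nullity_on:
  assumes V: "vs1.subspace V" and fin: "finite A" "V \<subseteq> vs1.span A"
    and add: "\<And>x y. x \<in> V \<Longrightarrow> y \<in> V \<Longrightarrow> f (x + y) = f x + f y"
    and scale: "\<And>c x. x \<in> V \<Longrightarrow> f (s1 c x) = s2 c (f x)"
  shows "vs1.dim V = vs1.dim {x\<in>V. f x = 0} + vs2.dim (f ` V)"
proof -
  let ?K = "{x\<in>V. f x = 0}"
  have f0: "f 0 = 0"
    using scale[OF vs1.subspace_0[OF V], of 0] by (simp add: vs2.scale_zero_left)
  have K: "vs1.subspace ?K"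
    unfolding vs1.subspace_def
    using vs1.subspace_0[OF V] vs1.subspace_add[OF V] vs1.subspace_scale[OF V]
    by (auto simp: f0 add scale)
  obtain B0 where B0: "B0 \<subseteq> ?K" "vs1.independent B0" "?K \<subseteq> vs1.span B0" "card B0 = vs1.dim ?K"
    using vs1.basis_exists .
  obtain B where B: "B0 \<subseteq> B" "B \<subseteq> V" "vs1.independent B" "V \<subseteq> vs1.span B"
    using vs1.maximal_independent_subset_extend[of B0 V] B0 by auto
  have finB: "finite B"
    using vs1.independent_span_bound[OF fin(1) B(3)] B(2) fin(2) by auto
  have dimV: "vs1.dim V = card B"
    using vs1.basis_card_eq_dim[OF B(2,4,3)] by simp
  obtain g where g: "Vector_Spaces.linear s1 s2 g" "\<And>x. x \<in> V \<Longrightarrow> g x = f x"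
    using additive_on_imp_linear[OF V add scale B(2-4)] by blast
  interpret g: Vector_Spaces.linear s1 s2 g by fact
  have sp: "vs1.span B = V"
    using B V vs1.span_minimal by blast
  define C where "C = B - B0"
  have C: "vs1.independent C" "C \<subseteq> B" "C \<subseteq> V"
    using B vs1.independent_mono[OF B(3)] by (auto simp: C_def)
  have CV: "vs1.span C \<subseteq> V"
    using C(3) V vs1.span_minimal by blast
  have inj: "inj_on g (vs1.span C)"
  proof (subst g.inj_on_iff_eq_0)
    show "vs1.subspace (vs1.span C)" by simp
    show "\<forall>x\<in>vs1.span C. g x = 0 \<longrightarrow> x = 0"
    proof (intro ballI impI)
      fix x assume x: "x \<in> vs1.span C" "g x = 0"
      then have "x \<in> ?K" using CV g(2) by auto
      then have xB0: "x \<in> vs1.span B0" using B0 by auto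
      \<comment> \<open>The coordinates of \<open>x\<close> in \<open>B\<close> are supported in
        \<open>C\<close> and also in \<open>B0\<close>; these are disjoint, so all coordinates
        vanish.\<close>
      have "vs1.representation B x = vs1.representation C x"
        by (rule vs1.representation_extend[OF B(3) x(1) C(2)])
      moreover have "vs1.representation B x = vs1.representation B0 x"
        by (rule vs1.representation_extend[OF B(3) xB0 B(1)])
      ultimately have "vs1.representation C x b = 0" for b
        using vs1.representation_ne_zero[of C x b] vs1.representation_ne_zero[of B0 x b]
        by (auto simp: C_def)
      then show "x = 0"
        using vs1.sum_nonzero_representation_eq[OF C(1) x(1)] by simp
    qed
  qed
  have "vs2.independent (g ` C)"
    using C(1) inj by (rule g.independent_injective_image)
  then have "vs2.dim (vs2.span (g ` C)) = card (g ` C)"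
    by (rule vs2.dim_span_eq_card_independent)
  also have "card (g ` C) = card C"
    using inj vs1.span_superset by (intro card_image) (auto intro: inj_on_subset)
  also have "vs2.span (g ` C) = f ` V"
  proof -
    have "f ` V = g ` vs1.span B" using sp g(2) by auto
    also have "\<dots> = vs2.span (g ` B)" by (simp add: g.span_image)
    also have "g ` B \<subseteq> insert 0 (g ` C)"
      using B0(1) g(2) by (auto simp: C_def)
    then have "vs2.span (g ` B) \<subseteq> vs2.span (g ` C)"
      by (metis vs2.span_insert_0 vs2.span_mono)
    moreover have "vs2.span (g ` C) \<subseteq> vs2.span (g ` B)"
      using C(2) by (intro vs2.span_mono) auto
    ultimately show ?thesis using \<open>f ` V = _\<close> \<open>_ = vs2.span (g ` B)\<close> by auto
  qed
  finally have "vs2.dim (f ` V) = card C" .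
  moreover have "card B = card B0 + card C"
    using finB B(1) card_mono[OF finB B(1)] by (simp add: C_def card_Diff_subset finite_subset)
  ultimately show ?thesis using dimV B0(4) by simp
qed

end

section \<open>Real functions as a vector space, and coordinate spaces\<close>

abbreviation (input) fscale :: "real \<Rightarrow> ('a \<Rightarrow> real) \<Rightarrow> 'a \<Rightarrow> real" where
  "fscale \<equiv> \<lambda>c f x. c * f x"

lemma vector_space_fscale: "vector_space fscale"
  by unfold_locales (auto simp: algebra_simps fun_eq_iff plus_fun_def)

interpretation fs: vector_space fscale
  by (rule vector_space_fscale)

text \<open>The coordinate space of \<open>A\<close> inside the functions on a whole type. The
  dimension counts below end in the cardinality of such an \<open>A\<close>: nodes, edges, triangles
  or constraints.\<close>

definition supported :: "'a set \<Rightarrow> ('a \<Rightarrow> real) set" where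
  "supported A = {f. \<forall>x. x \<notin> A \<longrightarrow> f x = 0}"

lemma subspace_supported: "fs.subspace (supported A)"
  by (auto simp: fs.subspace_def supported_def)

lemma sum_fun_apply: "(\<Sum>a\<in>A. g a) x = (\<Sum>a\<in>A. g a x)"
  by (induction A rule: infinite_finite_induct) auto

lemma supported_eq_sum:
  assumes "finite A" "f \<in> supported A"
  shows "f = (\<Sum>a\<in>A. fscale (f a) (indicator {a}))"
proof
  fix x
  have "(\<Sum>a\<in>A. fscale (f a) (indicator {a})) x = (\<Sum>a\<in>A. f a * indicator {a} x)"
    by (simp only: sum_fun_apply)
  also have "\<dots> = (\<Sum>a\<in>A. if a = x then f a else 0)"
    by (rule sum.cong) (auto simp: indicator_def)
  also have "\<dots> = f x"
    using assms by (auto simp: supported_def)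
  finally show "f x = (\<Sum>a\<in>A. fscale (f a) (indicator {a})) x" by simp
qed

lemma supported_subset_span:
  assumes "finite A"
  shows "supported A \<subseteq> fs.span ((\<lambda>a. indicator {a}) ` A)"
proof
  fix f :: "'a \<Rightarrow> real" assume f: "f \<in> supported A"
  show "f \<in> fs.span ((\<lambda>a. indicator {a}) ` A)"
    by (subst supported_eq_sum[OF assms f]) (intro fs.span_sum fs.span_scale fs.span_base, auto)
qed

lemma inj_indicator_singleton: "inj (\<lambda>a. indicator {a} :: 'a \<Rightarrow> real)"
proof (rule injI)
  fix a b :: 'a assume "indicator {a} = (indicator {b} :: 'a \<Rightarrow> real)"
  from fun_cong[OF this, of a] show "a = b" by (auto simp: indicator_def split: if_splits)
qed

lemma dim_supported:
  assumes "finite A"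
  shows "fs.dim (supported A) = card A"
proof -
  let ?e = "\<lambda>a. indicator {a} :: 'a \<Rightarrow> real"
  have "fs.independent (?e ` A)"
  proof (rule fs.independent_if_scalars_zero)
    show "finite (?e ` A)" using assms by simp
    fix f x assume 0: "(\<Sum>x\<in>?e ` A. fscale (f x) x) = 0" and x: "x \<in> ?e ` A"
    then obtain b where b: "b \<in> A" "x = ?e b" by auto
    have "(\<Sum>x\<in>?e ` A. fscale (f x) x) = (\<Sum>a\<in>A. fscale (f (?e a)) (?e a))"
      by (subst sum.reindex) (auto intro: inj_on_subset[OF inj_indicator_singleton])
    then have "(\<Sum>a\<in>A. fscale (f (?e a)) (?e a)) b = 0" using 0 by simp
    moreover have "(\<Sum>a\<in>A'. fscale (f (?e a)) (?e a)) b = (\<Sum>a\<in>A'. f (?e a) * indicator {a} b)" for A'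
      by (simp only: sum_fun_apply)
    moreover have "(\<Sum>a\<in>A. f (?e a) * indicator {a} b) = (\<Sum>a\<in>A. if a = b then f (?e a) else 0)"
      by (rule sum.cong) (auto simp: indicator_def)
    ultimately show "f x = 0" using assms b by simp
  qed
  moreover have "?e ` A \<subseteq> supported A" by (auto simp: supported_def indicator_def)
  ultimately have "card (?e ` A) = fs.dim (supported A)"
    using supported_subset_span[OF assms] by (intro fs.basis_card_eq_dim)
  then show ?thesis
    by (simp add: card_image inj_on_subset[OF inj_indicator_singleton])
qed

section \<open>Bivariate polynomials\<close>

abbreviation (input) monom2 :: "nat \<Rightarrow> nat \<Rightarrow> pt \<Rightarrow> real" where
  "monom2 i j \<equiv> \<lambda>z. fst z ^ i * snd z ^ j"

lemma poly2_iff: "poly2 k p \<longleftrightarrow> (\<exists>c. p = (\<lambda>z. \<Sum>i\<le>k. \<Sum>j\<le>k - i. c i j * monom2 i j z))"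
  unfolding poly2_def fun_eq_iff by (simp add: mult.assoc)

lemma poly2_zero [simp]: "poly2 k (\<lambda>z. 0)"
  unfolding poly2_def by (rule exI[of _ "\<lambda>i j. 0"]) simp

lemma poly2_add: "poly2 k p \<Longrightarrow> poly2 k q \<Longrightarrow> poly2 k (\<lambda>z. p z + q z)"
  unfolding poly2_def
proof (elim exE)
  fix c d :: "nat \<Rightarrow> nat \<Rightarrow> real"
  assume "\<forall>x y. p (x, y) = (\<Sum>i\<le>k. \<Sum>j\<le>k - i. c i j * x ^ i * y ^ j)"
    "\<forall>x y. q (x, y) = (\<Sum>i\<le>k. \<Sum>j\<le>k - i. d i j * x ^ i * y ^ j)"
  then show "\<exists>c. \<forall>x y. p (x, y) + q (x, y) = (\<Sum>i\<le>k. \<Sum>j\<le>k - i. c i j * x ^ i * y ^ j)"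
    by (intro exI[of _ "\<lambda>i j. c i j + d i j"]) (simp add: sum.distrib algebra_simps)
qed

lemma poly2_cmult: "poly2 k p \<Longrightarrow> poly2 k (\<lambda>z. a * p z)"
  unfolding poly2_def
proof (elim exE)
  fix c :: "nat \<Rightarrow> nat \<Rightarrow> real"
  assume "\<forall>x y. p (x, y) = (\<Sum>i\<le>k. \<Sum>j\<le>k - i. c i j * x ^ i * y ^ j)"
  then show "\<exists>c. \<forall>x y. a * p (x, y) = (\<Sum>i\<le>k. \<Sum>j\<le>k - i. c i j * x ^ i * y ^ j)"
    by (intro exI[of _ "\<lambda>i j. a * c i j"]) (simp add: sum_distrib_left algebra_simps)
qed

lemma poly2_diff: "poly2 k p \<Longrightarrow> poly2 k q \<Longrightarrow> poly2 k (\<lambda>z. p z - q z)"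
  using poly2_add[of k p "\<lambda>z. (-1) * q z"] poly2_cmult[of k q "-1"] by simp

lemma poly2_uminus: "poly2 k p \<Longrightarrow> poly2 k (\<lambda>z. - p z)"
  using poly2_cmult[of k p "-1"] by simp

lemma poly2_sum: "(\<And>i. i \<in> I \<Longrightarrow> poly2 k (f i)) \<Longrightarrow> poly2 k (\<lambda>z. \<Sum>i\<in>I. f i z)"
  by (induction I rule: infinite_finite_induct) (auto intro: poly2_add)

lemma poly2_monom2: "i + j \<le> k \<Longrightarrow> poly2 k (monom2 i j)"
proof -
  assume ij: "i + j \<le> k"
  have "(\<Sum>i'\<le>k. \<Sum>j'\<le>k - i'. (if i' = i \<and> j' = j then 1 else 0) * x ^ i' * y ^ j') = x ^ i * y ^ j"
    for x y :: real
  proof -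
    have "(\<Sum>j'\<le>k - i'. (if i' = i \<and> j' = j then 1 else 0) * x ^ i' * y ^ j')
      = (if i' = i then x ^ i * y ^ j else 0)" for i'
    proof (cases "i' = i")
      case True
      have "(\<Sum>j'\<le>k - i'. (if i' = i \<and> j' = j then 1 else 0) * x ^ i' * y ^ j')
        = (\<Sum>j'\<le>k - i. if j' = j then x ^ i * y ^ j else 0)"
        using True by (intro sum.cong) auto
      then show ?thesis using True ij by simp
    qed simp
    then have "(\<Sum>i'\<le>k. \<Sum>j'\<le>k - i'. (if i' = i \<and> j' = j then 1 else 0) * x ^ i' * y ^ j')
      = (\<Sum>i'\<le>k. if i' = i then x ^ i * y ^ j else 0)" by simp
    also have "\<dots> = x ^ i * y ^ j" using ij by simp
    finally show ?thesis .
  qed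
  then show ?thesis unfolding poly2_def
    by (intro exI[of _ "\<lambda>i' j'. if i' = i \<and> j' = j then 1 else 0"]) simp
qed

text \<open>Closure properties and derivative rules then need checking only for scaled monomials and
  sums, without handling coefficient arrays.\<close>

lemma poly2_induct [consumes 1, case_names zero monom add]:
  assumes p: "poly2 k p" and z: "P (\<lambda>z. 0)"
    and m: "\<And>c i j. i + j \<le> k \<Longrightarrow> P (\<lambda>z. c * monom2 i j z)"
    and a: "\<And>p q. poly2 k p \<Longrightarrow> poly2 k q \<Longrightarrow> P p \<Longrightarrow> P q \<Longrightarrow> P (\<lambda>z. p z + q z)"
  shows "P p"
proof -
  obtain c where c: "p = (\<lambda>z. \<Sum>i\<le>k. \<Sum>j\<le>k - i. c i j * monom2 i j z)"
    using p unfolding poly2_iff by blast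
  have S: "P (\<lambda>z. \<Sum>i\<in>I. f i z) \<and> poly2 k (\<lambda>z. \<Sum>i\<in>I. f i z)"
    if "\<And>i. i \<in> I \<Longrightarrow> P (f i) \<and> poly2 k (f i)" for I :: "nat set" and f
    using that by (induction I rule: infinite_finite_induct) (auto intro: z a poly2_add)
  show ?thesis
    unfolding c by (intro conjunct1[OF S] S conjI m poly2_cmult poly2_monom2) auto
qed

lemma poly2_mono: "poly2 k p \<Longrightarrow> k \<le> l \<Longrightarrow> poly2 l p"
proof (induction rule: poly2_induct)
  case (monom c i j)
  then show ?case by (intro poly2_cmult poly2_monom2) simp
qed (auto intro: poly2_add)

lemma poly2_const: "poly2 k (\<lambda>z. c)"
  using poly2_cmult[OF poly2_monom2[of 0 0 k], of c] by simp

lemma poly2_mult: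
  assumes "poly2 k p" "poly2 l q"
  shows "poly2 (k + l) (\<lambda>z. p z * q z)"
  using assms(1)
proof (induction rule: poly2_induct)
  case (monom c i j)
  from assms(2) show ?case
  proof (induction rule: poly2_induct)
    case (monom d i' j')
    have "poly2 (k + l) (\<lambda>z. (c * d) * monom2 (i + i') (j + j') z)"
      using \<open>i + j \<le> k\<close> \<open>i' + j' \<le> l\<close> by (intro poly2_cmult poly2_monom2) auto
    moreover have "(\<lambda>z. (c * d) * monom2 (i + i') (j + j') z) = (\<lambda>z. c * monom2 i j z * (d * monom2 i' j' z))"
      by (rule ext) (simp only: power_add mult_ac)
    ultimately show ?case by (simp only:)
  qed (auto simp: distrib_left intro: poly2_add)
qed (auto simp: distrib_right intro: poly2_add)

lemma poly2_power: "poly2 k p \<Longrightarrow> poly2 (k * n) (\<lambda>z. p z ^ n)"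
proof (induction n)
  case (Suc n)
  then show ?case using poly2_mult[of k p "k * n" "\<lambda>z. p z ^ n"] by simp
qed (simp add: poly2_const)

lemma poly2_comp_affine:
  assumes "poly2 k p" "poly2 1 a" "poly2 1 b"
  shows "poly2 k (\<lambda>z. p (a z, b z))"
  using assms(1)
proof (induction rule: poly2_induct)
  case (monom c i j)
  have "poly2 (1 * i + 1 * j) (\<lambda>z. a z ^ i * b z ^ j)"
    by (intro poly2_mult poly2_power assms)
  then show ?case using monom by (auto intro!: poly2_cmult elim: poly2_mono)
qed (auto intro: poly2_add)

lemma poly2_1_fst: "poly2 1 fst" and poly2_1_snd: "poly2 1 snd"
  using poly2_monom2[of 1 0 1] poly2_monom2[of 0 1 1] by simp_all

lemma poly2_1I: "poly2 1 (\<lambda>z. a + b * fst z + c * snd z)"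
  using poly2_add[OF poly2_add[OF poly2_const poly2_cmult[OF poly2_1_fst]] poly2_cmult[OF poly2_1_snd]]
  by simp

lemma poly2_1E:
  assumes "poly2 1 p"
  obtains a b c where "\<And>z. p z = a + b * fst z + c * snd z"
proof -
  have "\<exists>a b c. \<forall>z. p z = a + b * fst z + c * snd z"
    using assms
  proof (induction rule: poly2_induct)
    case (monom c i j)
    then consider "i = 0" "j = 0" | "i = 1" "j = 0" | "i = 0" "j = 1" by linarith
    then show ?case
    proof cases
      case 1 then show ?thesis by (intro exI[of _ c] exI[of _ 0]) simp
    next
      case 2 then show ?thesis by (intro exI[of _ 0] exI[of _ c]) simp
    next
      case 3 then show ?thesis by (intro exI[of _ 0] exI[of _ 0] exI[of _ c]) simp
    qed
  next
    case (add p q)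
    then obtain a b c a' b' c' where "\<forall>z. p z = a + b * fst z + c * snd z"
      "\<forall>z. q z = a' + b' * fst z + c' * snd z" by blast
    then show ?case
      by (intro exI[of _ "a + a'"] exI[of _ "b + b'"] exI[of _ "c + c'"]) (simp add: algebra_simps)
  next
    case zero
    show ?case by (intro exI[of _ 0]) simp
  qed
  then show ?thesis using that by blast
qed

lemma poly2_on_line:
  assumes "poly2 k p"
  obtains q :: "real poly" where "\<And>t. p (a + t *\<^sub>R d) = poly q t"
proof -
  have "\<exists>q :: real poly. \<forall>t. p (a + t *\<^sub>R d) = poly q t"
    using assms
  proof (induction rule: poly2_induct)
    case (monom c i j)
    show ?case
      by (rule exI[of _ "smult c ([:fst a, fst d:] ^ i * [:snd a, snd d:] ^ j)"]) (simp add: algebra_simps)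
  next
    case (add p q)
    then obtain p' q' where "\<forall>t. p (a + t *\<^sub>R d) = poly p' t" "\<forall>t. q (a + t *\<^sub>R d) = poly q' t" by blast
    then show ?case by (intro exI[of _ "p' + q'"]) simp
  next
    case zero
    show ?case by (intro exI[of _ 0]) simp
  qed
  then show ?thesis using that by blast
qed

text \<open>On the line from a point of \<open>U\<close> through \<open>x\<close> the polynomial is
  univariate and has infinitely many roots near its start.\<close>

lemma poly2_eq_zero_if_open:
  assumes p: "poly2 k p" and U: "open U" "U \<noteq> {}" and z: "\<And>x. x \<in> U \<Longrightarrow> p x = 0"
  shows "p x = 0"
proof -
  obtain a e where a: "a \<in> U" "e > 0" "ball a e \<subseteq> U"
    using U by (meson ex_in_conv openE)
  obtain q where q: "\<And>t. p (a + t *\<^sub>R (x - a)) = poly q t"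
    using poly2_on_line[OF p] by blast
  have "q = 0"
  proof (rule ccontr)
    assume "q \<noteq> 0"
    then have fin: "finite {t. poly q t = 0}" by (rule poly_roots_finite)
    \<comment> \<open>The summand 1 keeps the denominator positive when
      \<open>x = a\<close>.\<close>
    define d where "d = e / (norm (x - a) + 1)"
    have d: "d > 0" using a(2) by (simp add: d_def add_nonneg_pos)
    have "{0<..<d} \<subseteq> {t. poly q t = 0}"
    proof
      fix t assume t: "t \<in> {0<..<d}"
      have "norm (t *\<^sub>R (x - a)) = t * norm (x - a)" using t by simp
      also have "\<dots> \<le> t * (norm (x - a) + 1)" using t by (simp add: mult_left_mono)
      also have "\<dots> < d * (norm (x - a) + 1)" using t by (intro mult_strict_right_mono) (auto simp: add_nonneg_pos)
      also have "\<dots> = e" using norm_ge_zero[of "x - a"] by (simp add: d_def add_nonneg_eq_0_iff)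
      finally have "a + t *\<^sub>R (x - a) \<in> U" using a(3) by (auto simp: dist_norm)
      then show "t \<in> {t. poly q t = 0}" using z q by (metis mem_Collect_eq)
    qed
    then have "finite {0<..<d}" using fin finite_subset by blast
    then show False using d infinite_Ioo by blast
  qed
  then show ?thesis using q[of 1] by simp
qed

lemma poly2_eq_if_open:
  assumes "poly2 k p" "poly2 k q" "open U" "U \<noteq> {}" "\<And>x. x \<in> U \<Longrightarrow> p x = q x"
  shows "p = q"
proof
  fix x show "p x = q x"
    using poly2_eq_zero_if_open[OF poly2_diff[OF assms(1,2)] assms(3,4), of x] assms(5) by simp
qed

section \<open>Partial derivatives and antiderivatives of polynomials\<close>

lemma dx_eqI: "(f has_derivative f') (at x) \<Longrightarrow> dx f x = f' (1, 0)"
  and dy_eqI: "(f has_derivative f') (at x) \<Longrightarrow> dy f x = f' (0, 1)"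
  unfolding dx_def dy_def by (simp_all flip: frechet_derivative_at)

lemma has_derivative_dx_dy:
  assumes "f differentiable (at x)"
  shows "(f has_derivative (\<lambda>h. dx f x * fst h + dy f x * snd h)) (at x)"
proof -
  let ?D = "frechet_derivative f (at x)"
  have D: "(f has_derivative ?D) (at x)"
    using assms frechet_derivative_works by blast
  then interpret linear ?D using has_derivative_linear by blast
  have "?D h = dx f x * fst h + dy f x * snd h" for h
  proof -
    have "h = fst h *\<^sub>R (1, 0) + snd h *\<^sub>R (0, 1)" by (cases h) simp
    then have "?D h = fst h *\<^sub>R ?D (1, 0) + snd h *\<^sub>R ?D (0, 1)" by (metis add scaleR)
    then show ?thesis by (simp add: dx_def dy_def)
  qed
  then show ?thesis using D by presburger
qed

lemma monom2_has_derivative: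
  "((\<lambda>z. c * monom2 i j z) has_derivative
    (\<lambda>h. c * (real i * monom2 (i - 1) j z) * fst h + c * (real j * monom2 i (j - 1) z) * snd h)) (at z)"
  by (auto intro!: derivative_eq_intros simp: algebra_simps)

lemma poly2_differentiable: "poly2 k p \<Longrightarrow> p differentiable (at x)"
proof (induction rule: poly2_induct)
  case (monom c i j)
  show ?case by (rule differentiableI[OF monom2_has_derivative])
qed auto

lemma poly2_has_derivative:
  "poly2 k p \<Longrightarrow> (p has_derivative (\<lambda>h. dx p x * fst h + dy p x * snd h)) (at x)"
  by (simp add: has_derivative_dx_dy poly2_differentiable)

lemma poly2_continuous_on: "poly2 k p \<Longrightarrow> continuous_on S p"
  by (meson continuous_at_imp_continuous_on differentiable_imp_continuous_within poly2_differentiable)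

lemma
  assumes "poly2 k p" "poly2 l q"
  shows dx_add: "dx (\<lambda>z. p z + q z) = (\<lambda>z. dx p z + dx q z)"
    and dy_add: "dy (\<lambda>z. p z + q z) = (\<lambda>z. dy p z + dy q z)"
proof -
  have D: "((\<lambda>z. p z + q z) has_derivative (\<lambda>h. (dx p z * fst h + dy p z * snd h) +
      (dx q z * fst h + dy q z * snd h))) (at z)" for z
    by (intro has_derivative_add poly2_has_derivative[OF assms(1)] poly2_has_derivative[OF assms(2)])
  show "dx (\<lambda>z. p z + q z) = (\<lambda>z. dx p z + dx q z)"
    using dx_eqI[OF D] by (simp add: fun_eq_iff)
  show "dy (\<lambda>z. p z + q z) = (\<lambda>z. dy p z + dy q z)"
    using dy_eqI[OF D] by (simp add: fun_eq_iff)
qed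

lemma
  assumes "poly2 k p"
  shows dx_cmult: "dx (\<lambda>z. c * p z) = (\<lambda>z. c * dx p z)"
    and dy_cmult: "dy (\<lambda>z. c * p z) = (\<lambda>z. c * dy p z)"
proof -
  have D: "((\<lambda>z. c * p z) has_derivative (\<lambda>h. c * (dx p z * fst h + dy p z * snd h))) (at z)" for z
    by (intro has_derivative_mult_right poly2_has_derivative[OF assms])
  show "dx (\<lambda>z. c * p z) = (\<lambda>z. c * dx p z)"
    using dx_eqI[OF D] by (simp add: fun_eq_iff)
  show "dy (\<lambda>z. c * p z) = (\<lambda>z. c * dy p z)"
    using dy_eqI[OF D] by (simp add: fun_eq_iff)
qed

lemma dx_const [simp]: "dx (\<lambda>z. c) = (\<lambda>z. 0)" and dy_const [simp]: "dy (\<lambda>z. c) = (\<lambda>z. 0)"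
  by (simp_all add: fun_eq_iff dx_def dy_def)

lemma dx_monom2: "dx (\<lambda>z. c * monom2 i j z) = (\<lambda>z. c * real i * monom2 (i - 1) j z)"
  and dy_monom2: "dy (\<lambda>z. c * monom2 i j z) = (\<lambda>z. c * real j * monom2 i (j - 1) z)"
  using dx_eqI[OF monom2_has_derivative] dy_eqI[OF monom2_has_derivative]
  by (simp_all add: fun_eq_iff)

lemma dx_uminus: "poly2 k p \<Longrightarrow> dx (\<lambda>z. - p z) = (\<lambda>z. - dx p z)"
  and dy_uminus: "poly2 k p \<Longrightarrow> dy (\<lambda>z. - p z) = (\<lambda>z. - dy p z)"
  using dx_cmult[of k p "-1"] dy_cmult[of k p "-1"] by simp_all

lemma dx_diff: "poly2 k p \<Longrightarrow> poly2 l q \<Longrightarrow> dx (\<lambda>z. p z - q z) = (\<lambda>z. dx p z - dx q z)"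
  and dy_diff: "poly2 k p \<Longrightarrow> poly2 l q \<Longrightarrow> dy (\<lambda>z. p z - q z) = (\<lambda>z. dy p z - dy q z)"
  using dx_add[of k p l "\<lambda>z. - q z"] dy_add[of k p l "\<lambda>z. - q z"]
  by (simp_all add: dx_uminus dy_uminus poly2_uminus)

lemma poly2_dx: "poly2 k p \<Longrightarrow> poly2 (k - 1) (dx p)"
proof (induction rule: poly2_induct)
  case (monom c i j)
  show ?case
  proof (cases "i = 0")
    case False
    then have "poly2 (k - 1) (monom2 (i - 1) j)" using monom by (intro poly2_monom2) simp
    then show ?thesis unfolding dx_monom2 by (rule poly2_cmult)
  qed (simp only: dx_monom2 of_nat_0 mult_zero_right mult_zero_left poly2_zero)
qed (auto simp: dx_add intro: poly2_add)

lemma poly2_dy: "poly2 k p \<Longrightarrow> poly2 (k - 1) (dy p)"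
proof (induction rule: poly2_induct)
  case (monom c i j)
  show ?case
  proof (cases "j = 0")
    case False
    then have "poly2 (k - 1) (monom2 i (j - 1))" using monom by (intro poly2_monom2) simp
    then show ?thesis unfolding dy_monom2 by (rule poly2_cmult)
  qed (simp only: dy_monom2 of_nat_0 mult_zero_right mult_zero_left poly2_zero)
qed (auto simp: dy_add intro: poly2_add)

lemma dx_dy_commute: "poly2 k p \<Longrightarrow> dx (dy p) = dy (dx p)"
proof (induction rule: poly2_induct)
  case (monom c i j)
  show ?case unfolding dx_monom2 dy_monom2 by (rule ext) (simp only: mult_ac)
next
  case (add p q)
  then show ?case by (simp add: dx_add dy_add poly2_dx poly2_dy dx_add[OF poly2_dy poly2_dy] dy_add[OF poly2_dx poly2_dx])
qed simp

lemma ex_dx_antiderivative: "poly2 k p \<Longrightarrow> \<exists>m. poly2 (Suc k) m \<and> dx m = p"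
proof (induction rule: poly2_induct)
  case (monom c i j)
  have "dx (\<lambda>z. c / real (Suc i) * monom2 (Suc i) j z) = (\<lambda>z. c * monom2 i j z)"
    by (subst dx_monom2) (simp add: field_simps del: of_nat_Suc)
  moreover have "poly2 (Suc k) (\<lambda>z. c / real (Suc i) * monom2 (Suc i) j z)"
    using monom by (intro poly2_cmult poly2_monom2) auto
  ultimately show ?case by blast
next
  case (add p q)
  then obtain m n where "poly2 (Suc k) m" "dx m = p" "poly2 (Suc k) n" "dx n = q" by blast
  then show ?case
    by (intro exI[of _ "\<lambda>z. m z + n z"]) (auto simp: dx_add intro: poly2_add)
qed (auto intro!: exI[of _ "\<lambda>z. 0"])

lemma ex_dy_antiderivative: "poly2 k p \<Longrightarrow> \<exists>m. poly2 (Suc k) m \<and> dy m = p"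
proof (induction rule: poly2_induct)
  case (monom c i j)
  have "dy (\<lambda>z. c / real (Suc j) * monom2 i (Suc j) z) = (\<lambda>z. c * monom2 i j z)"
    by (subst dy_monom2) (simp add: field_simps del: of_nat_Suc)
  moreover have "poly2 (Suc k) (\<lambda>z. c / real (Suc j) * monom2 i (Suc j) z)"
    using monom by (intro poly2_cmult poly2_monom2) auto
  ultimately show ?case by blast
next
  case (add p q)
  then obtain m n where "poly2 (Suc k) m" "dy m = p" "poly2 (Suc k) n" "dy n = q" by blast
  then show ?case
    by (intro exI[of _ "\<lambda>z. m z + n z"]) (auto simp: dy_add intro: poly2_add)
qed (auto intro!: exI[of _ "\<lambda>z. 0"])

lemma dy_eq_zero_imp_const:
  assumes p: "poly2 k p" and z: "\<And>z. dy p z = 0"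
  shows "p (x, y) = p (x, 0)"
proof -
  have "DERIV (\<lambda>y. p (x, y)) t :> 0" for t
  proof -
    have "((\<lambda>y. (x, y)) has_derivative (\<lambda>h. (0, h))) (at t)"
      by (auto intro!: derivative_eq_intros)
    from has_derivative_compose[OF this poly2_has_derivative[OF p]]
    have "((\<lambda>y. p (x, y)) has_derivative (\<lambda>h. 0)) (at t)"
      by (simp add: z)
    then show ?thesis by (simp add: has_field_derivative_def zero_fun_def)
  qed
  then show ?thesis using DERIV_isconst_all by blast
qed

text \<open>Poincare lemma with degree control. Integrating \<open>p1\<close> in y gives
  \<open>m\<close>; the defect \<open>r = p2 + dx m\<close> has zero y-derivative because the
  divergence vanishes, so it is removed by subtracting \<open>n'\<close>, a polynomial in x
  alone.\<close>

lemma divergence_free_potential: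
  assumes p1: "poly2 k p1" and p2: "poly2 k p2" and div: "\<And>z. dx p1 z + dy p2 z = 0"
  obtains f where "poly2 (Suc k) f" "dy f = p1" "dx f = (\<lambda>z. - p2 z)"
proof -
  obtain m where m: "poly2 (Suc k) m" "dy m = p1"
    using ex_dy_antiderivative[OF p1] by blast
  define r where "r = (\<lambda>z. p2 z + dx m z)"
  have r: "poly2 k r" using poly2_dx[OF m(1)] p2 unfolding r_def by (intro poly2_add) auto
  have "dy r z = 0" for z
    unfolding r_def using div[of z] dx_dy_commute[OF m(1)]
    by (simp add: dy_add[OF p2 poly2_dx[OF m(1)]] m(2) add.commute)
  then have r0: "r (x, y) = r (x, 0)" for x y
    using dy_eq_zero_imp_const[OF r] by blast
  obtain n where n: "poly2 (Suc k) n" "dx n = r"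
    using ex_dx_antiderivative[OF r] by blast
  define n' where "n' = (\<lambda>z :: pt. n (fst z, 0))"
  have n': "poly2 (Suc k) n'"
    unfolding n'_def by (rule poly2_comp_affine[OF n(1) poly2_1_fst poly2_const])
  have D: "(n' has_derivative (\<lambda>h. r z * fst h)) (at z)" for z
  proof -
    have "((\<lambda>z. (fst z, 0::real)) has_derivative (\<lambda>h. (fst h, 0))) (at z)"
      by (auto intro!: derivative_eq_intros)
    from has_derivative_compose[OF this poly2_has_derivative[OF n(1)]]
    moreover have "r z = r (fst z, 0)" using r0[of "fst z" "snd z"] by simp
    ultimately show ?thesis unfolding n'_def by (simp add: n(2))
  qed
  have "dx n' = r" "dy n' = (\<lambda>z. 0)"
    using dx_eqI[OF D] dy_eqI[OF D] by (auto simp: fun_eq_iff)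
  then have "dy (\<lambda>z. m z - n' z) = p1" "dx (\<lambda>z. m z - n' z) = (\<lambda>z. - p2 z)"
    unfolding dx_diff[OF m(1) n'] dy_diff[OF m(1) n'] by (simp_all add: m(2) r_def)
  then show ?thesis using that poly2_diff[OF m(1) n'] by blast
qed

section \<open>Triangles and barycentric coordinates\<close>

text \<open>The determinant of two plane vectors: zero for parallel vectors, and otherwise its sign
  is the sense of the turn from \<open>u\<close> to \<open>v\<close>.\<close>

definition cr :: "pt \<Rightarrow> pt \<Rightarrow> real" where
  "cr u v = fst u * snd v - snd u * fst v"

lemma collinear_iff_cr: "collinear {a, b, c} \<longleftrightarrow> cr (b - a) (c - a) = 0"
proof -
  have "collinear {a, b, c} \<longleftrightarrow> collinear {b, a, c}"
    by (simp add: insert_commute)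
  also have "\<dots> \<longleftrightarrow> collinear {0, b - a, c - a}"
    by (rule collinear_3) (simp add: NO_MATCH_def)
  also have "\<dots> \<longleftrightarrow> cr (b - a) (c - a) = 0"
  proof
    assume "collinear {0, b - a, c - a}"
    then show "cr (b - a) (c - a) = 0"
      unfolding collinear_lemma
    proof (elim disjE exE)
      fix k assume "c - a = k *\<^sub>R (b - a)"
      then show ?thesis by (simp only: cr_def) simp
    qed (auto simp: cr_def)
  next
    assume *: "cr (b - a) (c - a) = 0"
    show "collinear {0, b - a, c - a}"
    proof (cases "b = a")
      case False
      define u v where "u = b - a" and "v = c - a"
      have uv: "fst u * snd v = snd u * fst v" and u: "fst u \<noteq> 0 \<or> snd u \<noteq> 0"
        using * False by (auto simp: u_def v_def cr_def prod_eq_iff)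
      have "\<exists>k. v = k *\<^sub>R u"
      proof (cases "fst u = 0")
        case True
        then show ?thesis using u uv by (intro exI[of _ "snd v / snd u"]) (auto simp: prod_eq_iff field_simps)
      next
        case False
        then show ?thesis using u uv by (intro exI[of _ "fst v / fst u"]) (auto simp: prod_eq_iff field_simps)
      qed
      then show ?thesis unfolding collinear_lemma u_def v_def by blast
    qed simp
  qed
  finally show ?thesis .
qed

lemma is_triangleE:
  assumes "is_triangle T" "v \<in> T"
  obtains b c where "T = {v, b, c}" "v \<noteq> b" "v \<noteq> c" "b \<noteq> c" "cr (b - v) (c - v) \<noteq> 0"
proof -
  have T: "card T = 3" "\<not> collinear T" using assms(1) by (auto simp: is_triangle_def)
  then have "card (T - {v}) = 2" using assms(2) by simp
  then obtain b c where bc: "T - {v} = {b, c}" "b \<noteq> c" by (auto simp: card_2_iff)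
  then have "T = {v, b, c}" "v \<noteq> b" "v \<noteq> c" using assms(2) by auto
  then show ?thesis using that bc(2) T(2) collinear_iff_cr by blast
qed

lemma is_triangle_card: "is_triangle T \<Longrightarrow> card T = 3"
  and is_triangle_finite: "is_triangle T \<Longrightarrow> finite T"
  by (auto simp: is_triangle_def intro: card_ge_0_finite)

lemma is_triangle_vertices:
  assumes "is_triangle T"
  obtains a b c where "T = {a, b, c}" "a \<noteq> b" "a \<noteq> c" "b \<noteq> c" "cr (b - a) (c - a) \<noteq> 0"
proof -
  obtain a where "a \<in> T" using is_triangle_card[OF assms] by (metis card.empty ex_in_conv zero_neq_numeral)
  then show ?thesis using is_triangleE[OF assms] that by metis
qed

lemma is_triangle_cr:
  assumes "is_triangle {a, b, c}"
  shows "a \<noteq> b" "a \<noteq> c" "b \<noteq> c" "cr (b - a) (c - a) \<noteq> 0"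
  using assms unfolding is_triangle_def
  by (auto simp: collinear_iff_cr card_insert_if split: if_splits)

text \<open>The barycentric coordinate of \<open>x\<close> at the vertex \<open>v\<close>, a
  quotient of signed areas. As \<open>T\<close> is a set, the two other vertices come in an
  arbitrary order; exchanging them negates numerator and denominator.\<close>

definition bary :: "pt set \<Rightarrow> pt \<Rightarrow> pt \<Rightarrow> real" where
  "bary T v x = (case (SOME bc. T = {v, fst bc, snd bc}) of (b, c) \<Rightarrow>
     cr (b - x) (c - x) / cr (b - v) (c - v))"

lemma bary_eq:
  assumes T: "is_triangle {a, b, c}"
  shows "bary {a, b, c} a x = cr (b - x) (c - x) / cr (b - a) (c - a)"
proof -
  define P where "P = (\<lambda>bc. {a, b, c} = {a, fst bc, snd bc})"
  have "P (b, c)" by (simp add: P_def)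
  then have "P (Eps P)" by (rule someI)
  moreover obtain b' c' where e: "Eps P = (b', c')" by (cases "Eps P")
  ultimately have eq: "{a, b, c} = {a, b', c'}" by (simp add: P_def)
  note d = is_triangle_cr[OF T]
  have "b \<in> {a, b', c'}" "c \<in> {a, b', c'}" using eq by blast+
  then have "b = b' \<or> b = c'" "c = b' \<or> c = c'" using d by auto
  then have "(b', c') = (b, c) \<or> (b', c') = (c, b)"
    using d by auto
  moreover have "cr (c - x) (b - x) / cr (c - a) (b - a) = cr (b - x) (c - x) / cr (b - a) (c - a)" for x
  proof -
    have "cr (c - y) (b - y) = - cr (b - y) (c - y)" for y by (simp add: cr_def)
    then show ?thesis by (metis minus_divide_divide)
  qed
  ultimately show ?thesis unfolding bary_def P_def[symmetric] e by (elim disjE) simp_all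
qed

lemma bary_eqs:
  assumes T: "is_triangle {a, b, c}"
  shows "bary {a, b, c} a x = cr (b - x) (c - x) / cr (b - a) (c - a)"
    "bary {a, b, c} b x = cr (c - x) (a - x) / cr (b - a) (c - a)"
    "bary {a, b, c} c x = cr (a - x) (b - x) / cr (b - a) (c - a)"
proof -
  have r: "{a, b, c} = {b, c, a}" "{a, b, c} = {c, a, b}" by auto
  have "cr (c - b) (a - b) = cr (b - a) (c - a)" "cr (a - c) (b - c) = cr (b - a) (c - a)"
    by (auto simp: cr_def algebra_simps)
  then show "bary {a, b, c} a x = cr (b - x) (c - x) / cr (b - a) (c - a)"
    "bary {a, b, c} b x = cr (c - x) (a - x) / cr (b - a) (c - a)"
    "bary {a, b, c} c x = cr (a - x) (b - x) / cr (b - a) (c - a)"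
    using bary_eq[of a b c x] bary_eq[of b c a x] bary_eq[of c a b x] T r by auto
qed

context
  fixes T assumes T: "is_triangle T"
begin

lemma poly2_bary: "v \<in> T \<Longrightarrow> poly2 1 (bary T v)"
proof -
  assume "v \<in> T"
  then obtain b c where bc: "T = {v, b, c}" by (rule is_triangleE[OF T])
  define D where "D = cr (b - v) (c - v)"
  have e: "bary T v z = cr (b - z) (c - z) / D" for z
    using bary_eq[of v b c] T unfolding bc(1) D_def[symmetric] by simp
  have "bary T v z = cr b c / D + (snd b - snd c) / D * fst z + (fst c - fst b) / D * snd z" for z
  proof -
    have "cr (b - z) (c - z) = cr b c + (snd b - snd c) * fst z + (fst c - fst b) * snd z"
      by (simp add: cr_def algebra_simps)
    then show ?thesis unfolding e by (simp add: add_divide_distrib)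
  qed
  then have "bary T v = (\<lambda>z. cr b c / D + (snd b - snd c) / D * fst z + (fst c - fst b) / D * snd z)"
    by (rule ext)
  then show ?thesis using poly2_1I by metis
qed

lemma bary_line:
  assumes "v \<in> T"
  shows "bary T v (x + t *\<^sub>R (y - x)) = (1 - t) * bary T v x + t * bary T v y"
proof -
  obtain a b c where "\<And>z. bary T v z = a + b * fst z + c * snd z"
    using poly2_1E[OF poly2_bary[OF assms]] by blast
  then show ?thesis by (simp add: algebra_simps)
qed

lemma bary_comb:
  assumes "v \<in> T"
  shows "bary T v ((1 - t) *\<^sub>R x + t *\<^sub>R y) = (1 - t) * bary T v x + t * bary T v y"
  using bary_line[OF assms, of x t y] by (simp add: algebra_simps)

lemma bary_vertex: "v \<in> T \<Longrightarrow> w \<in> T \<Longrightarrow> bary T v w = (if v = w then 1 else 0)"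
proof -
  assume vw: "v \<in> T" "w \<in> T"
  obtain b c where bc: "T = {v, b, c}" "cr (b - v) (c - v) \<noteq> 0" by (rule is_triangleE[OF T vw(1)])
  have "bary T v x = cr (b - x) (c - x) / cr (b - v) (c - v)" for x
    using bary_eq[of v b c] T bc by auto
  then show ?thesis using bc vw(2) by (auto simp: cr_def)
qed

lemma bary_sum: "(\<Sum>v\<in>T. bary T v x) = 1" and bary_sum_scale: "(\<Sum>v\<in>T. bary T v x *\<^sub>R v) = x"
proof -
  obtain a b c where bc: "T = {a, b, c}" "a \<noteq> b" "a \<noteq> c" "b \<noteq> c" "cr (b - a) (c - a) \<noteq> 0"
    by (rule is_triangle_vertices[OF T])
  define D where "D = cr (b - a) (c - a)"
  have D: "D \<noteq> 0" using bc D_def by simp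
  have e: "bary T a x = cr (b - x) (c - x) / D" "bary T b x = cr (c - x) (a - x) / D"
    "bary T c x = cr (a - x) (b - x) / D"
    using bary_eqs[of a b c x] T unfolding bc(1) D_def by auto
  have s: "(\<Sum>v\<in>T. f v) = f a + f b + f c" for f :: "pt \<Rightarrow> 'b::comm_monoid_add"
    using bc by (simp add: add.assoc)
  show "(\<Sum>v\<in>T. bary T v x) = 1"
  proof -
    have "cr (b - x) (c - x) + cr (c - x) (a - x) + cr (a - x) (b - x) = D"
      unfolding D_def cr_def by (simp add: algebra_simps)
    then show ?thesis unfolding s e using D by (simp add: add_divide_distrib[symmetric])
  qed
  show "(\<Sum>v\<in>T. bary T v x *\<^sub>R v) = x"
  proof -
    have "cr (b - x) (c - x) * fst a + cr (c - x) (a - x) * fst b + cr (a - x) (b - x) * fst c = D * fst x"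
      "cr (b - x) (c - x) * snd a + cr (c - x) (a - x) * snd b + cr (a - x) (b - x) * snd c = D * snd x"
      unfolding D_def cr_def by (simp_all add: algebra_simps)
    then show ?thesis unfolding s e using D by (simp add: prod_eq_iff add_divide_distrib[symmetric])
  qed
qed

lemma convex_hull_bary: "x \<in> convex hull T \<longleftrightarrow> (\<forall>v\<in>T. 0 \<le> bary T v x)"
proof
  assume x: "x \<in> convex hull T"
  have "convex {x. \<forall>v\<in>T. 0 \<le> bary T v x}"
    unfolding convex_alt by (auto simp: bary_comb)
  moreover have "T \<subseteq> {x. \<forall>v\<in>T. 0 \<le> bary T v x}" by (auto simp: bary_vertex)
  ultimately have "convex hull T \<subseteq> {x. \<forall>v\<in>T. 0 \<le> bary T v x}"
    by (rule hull_minimal[rotated])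
  then show "\<forall>v\<in>T. 0 \<le> bary T v x" using x by auto
next
  assume "\<forall>v\<in>T. 0 \<le> bary T v x"
  then show "x \<in> convex hull T"
    unfolding convex_hull_finite[OF is_triangle_finite[OF T]]
    by (auto intro!: exI[of _ "\<lambda>v. bary T v x"] simp: bary_sum bary_sum_scale)
qed

lemma convex_hull_sub_bary:
  assumes e: "e \<subseteq> T"
  shows "x \<in> convex hull e \<longleftrightarrow> x \<in> convex hull T \<and> (\<forall>v\<in>T - e. bary T v x = 0)"
proof
  assume x: "x \<in> convex hull e"
  have "convex {x. \<forall>v\<in>T - e. bary T v x = 0}"
    unfolding convex_alt by (auto simp: bary_comb)
  moreover have "e \<subseteq> {x. \<forall>v\<in>T - e. bary T v x = 0}" using e by (auto simp: bary_vertex)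
  ultimately have "convex hull e \<subseteq> {x. \<forall>v\<in>T - e. bary T v x = 0}"
    by (rule hull_minimal[rotated])
  then show "x \<in> convex hull T \<and> (\<forall>v\<in>T - e. bary T v x = 0)"
    using x hull_mono[OF e, of convex] by auto
next
  assume x: "x \<in> convex hull T \<and> (\<forall>v\<in>T - e. bary T v x = 0)"
  have fin: "finite T" by (rule is_triangle_finite[OF T])
  then have fe: "finite e" using e finite_subset by blast
  have "(\<Sum>v\<in>e. bary T v x) = (\<Sum>v\<in>T. bary T v x)" "(\<Sum>v\<in>e. bary T v x *\<^sub>R v) = (\<Sum>v\<in>T. bary T v x *\<^sub>R v)"
    using x fin e by (auto intro!: sum.mono_neutral_left simp: zero_prod_def)
  then show "x \<in> convex hull e"
    unfolding convex_hull_finite[OF fe] using x e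
    by (auto intro!: exI[of _ "\<lambda>v. bary T v x"] simp: bary_sum bary_sum_scale convex_hull_bary subset_iff)
qed

lemma open_bary_pos: "open {x. \<forall>v\<in>e. 0 < bary T v x}" if "e \<subseteq> T"
proof -
  have fe: "finite e" using that is_triangle_finite[OF T] finite_subset by blast
  have "open {x. 0 < bary T v x}" if "v \<in> T" for v
    by (intro open_Collect_less continuous_on_const poly2_continuous_on[OF poly2_bary[OF that]])
  then have "open (\<Inter>v\<in>e. {x. 0 < bary T v x})"
    using that fe by (intro open_INT ballI) auto
  moreover have "{x. \<forall>v\<in>e. 0 < bary T v x} = (\<Inter>v\<in>e. {x. 0 < bary T v x})" by auto
  ultimately show ?thesis by simp
qed

lemma bary_pos_interior: "(\<And>v. v \<in> T \<Longrightarrow> 0 < bary T v x) \<Longrightarrow> x \<in> interior (convex hull T)"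
  by (rule interiorI[OF open_bary_pos[OF subset_refl]]) (auto simp: convex_hull_bary less_imp_le)

lemma interior_convex_hull_nonempty: "interior (convex hull T) \<noteq> {}"
proof -
  obtain a b c where bc: "T = {a, b, c}" "a \<noteq> b" "a \<noteq> c" "b \<noteq> c" "cr (b - a) (c - a) \<noteq> 0"
    by (rule is_triangle_vertices[OF T])
  \<comment> \<open>The centroid, written as nested two-point combinations so that
    \<open>bary_comb\<close> evaluates its coordinates.\<close>
  define x where "x = (1 - 1/3) *\<^sub>R ((1 - 1/2) *\<^sub>R a + (1/2) *\<^sub>R b) + (1/3) *\<^sub>R c"
  have "bary T v x > 0" if v: "v \<in> T" for v
  proof -
    have "bary T v x = (1 - 1/3) * ((1 - 1/2) * bary T v a + (1/2) * bary T v b) + (1/3) * bary T v c"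
      unfolding x_def bary_comb[OF v] ..
    moreover have "a \<in> T" "b \<in> T" "c \<in> T" "v = a \<or> v = b \<or> v = c" using bc v by auto
    ultimately show ?thesis using v bc(2-4) by (auto simp: bary_vertex)
  qed
  then show ?thesis using bary_pos_interior by blast
qed

lemma closure_interior_convex_hull: "closure (interior (convex hull T)) = convex hull T"
  using convex_closure_interior[OF convex_convex_hull interior_convex_hull_nonempty]
    closure_closed[OF compact_imp_closed[OF finite_imp_compact_convex_hull[OF is_triangle_finite[OF T]]]]
  by simp

lemma poly2_eq_on_hull:
  "poly2 k p \<Longrightarrow> poly2 k q \<Longrightarrow> (\<And>x. x \<in> convex hull T \<Longrightarrow> p x = q x) \<Longrightarrow> p = q"
  using interior_subset[of "convex hull T"]
  by (intro poly2_eq_if_open[OF _ _ open_interior interior_convex_hull_nonempty]) auto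

lemma convex_hull_not_interior:
  assumes "x \<in> convex hull T" "x \<notin> interior (convex hull T)"
  obtains a b where "a \<in> T" "b \<in> T" "a \<noteq> b" "x \<in> closed_segment a b"
proof -
  obtain v where v: "v \<in> T" "bary T v x = 0"
    using bary_pos_interior[of x] assms convex_hull_bary by (metis order_le_less)
  obtain b c where bc: "T = {v, b, c}" "v \<noteq> b" "v \<noteq> c" "b \<noteq> c" by (rule is_triangleE[OF T v(1)])
  have "x \<in> convex hull {b, c}"
    using convex_hull_sub_bary[of "{b, c}" x] assms(1) bc v by auto
  then show ?thesis using that[of b c] bc by (simp add: segment_convex_hull)
qed

end

section \<open>Local structure of a conforming triangulation\<close>

locale triangulation =
  fixes Th :: "pt set set"
  assumes conforming: "conforming Th"
begin

abbreviation "\<Omega> \<equiv> dom_of Th"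
abbreviation "hullunion \<equiv> (\<Union>T\<in>Th. convex hull T)"

lemma finite_Th: "finite Th" and Th_nonempty: "Th \<noteq> {}" and tri: "T \<in> Th \<Longrightarrow> is_triangle T"
  and hull_Int: "T \<in> Th \<Longrightarrow> T' \<in> Th \<Longrightarrow> T \<noteq> T' \<Longrightarrow> convex hull T \<inter> convex hull T' = convex hull (T \<inter> T')"
  using conforming by (auto simp: conforming_def)

lemma finite_T: "T \<in> Th \<Longrightarrow> finite T" and card_T: "T \<in> Th \<Longrightarrow> card T = 3"
  using tri is_triangle_finite is_triangle_card by auto

lemma compact_hull: "T \<in> Th \<Longrightarrow> compact (convex hull T)"
  by (simp add: finite_T finite_imp_compact_convex_hull)

lemma closed_hull: "T \<in> Th \<Longrightarrow> closed (convex hull T)"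
  by (simp add: compact_hull compact_imp_closed)

lemma compact_hullunion: "compact hullunion" and closed_hullunion: "closed hullunion"
  by (auto intro!: compact_UN closed_UN finite_Th compact_hull closed_hull)

lemma open_dom: "open \<Omega>" and dom_subset: "\<Omega> \<subseteq> hullunion"
  by (auto simp: dom_of_def interior_subset)

lemma interior_hull_subset_dom: "T \<in> Th \<Longrightarrow> interior (convex hull T) \<subseteq> \<Omega>"
  unfolding dom_of_def by (intro interior_mono) auto

lemma hull_subset_closure_dom: "T \<in> Th \<Longrightarrow> convex hull T \<subseteq> closure \<Omega>"
  using closure_mono[OF interior_hull_subset_dom] closure_interior_convex_hull[OF tri] by auto

lemma frontier_dom: "frontier \<Omega> = closure \<Omega> - \<Omega>"
  by (simp add: frontier_def open_dom interior_open)

lemma bounded_dom: "bounded \<Omega>"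
  using bounded_subset[OF compact_imp_bounded[OF compact_hullunion] dom_subset] .

lemma finite_vertices: "finite (vertices Th)"
  by (auto simp: vertices_def intro: finite_Th finite_T)

lemma finite_edges: "finite (edges Th)"
  by (rule finite_subset[of _ "Pow (vertices Th)"]) (auto simp: edges_def vertices_def finite_Th finite_T)

lemma finite_interior_edges: "finite (interior_edges Th)"
  using finite_edges by (simp add: interior_edges_def)

text \<open>Conformity in coordinate form: a common point lies on the face spanned by the common
  vertices.\<close>

lemma hull_Int_bary:
  assumes "T \<in> Th" "T' \<in> Th" "T \<noteq> T'" "x \<in> convex hull T" "x \<in> convex hull T'" "v \<in> T" "v \<notin> T'"
  shows "bary T v x = 0"
  using hull_Int[OF assms(1-3)] convex_hull_sub_bary[OF tri[OF assms(1)], of "T \<inter> T'" x] assms by auto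

lemma third_vertex:
  assumes "T \<in> Th" "{a, b} \<subseteq> T" "a \<noteq> b"
  obtains c where "T = {a, b, c}" "c \<noteq> a" "c \<noteq> b" "cr (b - a) (c - a) \<noteq> 0"
proof -
  obtain b' c' where bc: "T = {a, b', c'}" "a \<noteq> b'" "a \<noteq> c'" "b' \<noteq> c'" "cr (b' - a) (c' - a) \<noteq> 0"
    by (rule is_triangleE[OF tri[OF assms(1)], of a]) (use assms(2) in auto)
  show ?thesis
  proof (cases "b = b'")
    case True then show ?thesis using that[of c'] bc by auto
  next
    case False
    then have "b = c'" using assms bc by auto
    moreover have "cr (c' - a) (b' - a) \<noteq> 0" using bc(5) by (simp add: cr_def algebra_simps)
    ultimately show ?thesis using that[of b'] bc by (auto simp: insert_commute)
  qed
qed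

text \<open>If \<open>c'\<close> were not strictly beyond the line through \<open>a\<close> and
  \<open>b\<close>, a point near the midpoint of this edge in the direction of \<open>c'\<close>
  would lie in both triangles although its coordinate at \<open>c'\<close> is positive.\<close>

lemma opposite_sides:
  assumes T: "{a, b, c} \<in> Th" "{a, b, c'} \<in> Th" and ne: "c \<noteq> c'"
  shows "cr (b - a) (c - a) * cr (b - a) (c' - a) < 0"
proof -
  note t = tri[OF T(1)] tri[OF T(2)]
  note d = is_triangle_cr[OF t(1)] is_triangle_cr[OF t(2)]
  let ?T = "{a, b, c}" and ?T' = "{a, b, c'}"
  have c': "c' \<notin> ?T" and neT: "?T' \<noteq> ?T" using d ne by auto
  have in_T: "a \<in> ?T" "b \<in> ?T" "c \<in> ?T" "a \<in> ?T'" "b \<in> ?T'" "c' \<in> ?T'" by auto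
  have "bary ?T c c' < 0"
  proof (rule ccontr)
    assume "\<not> bary ?T c c' < 0"
    then have nn: "0 \<le> bary ?T c c'" by simp
    define m where "m = (1 - 1/2) *\<^sub>R a + (1/2) *\<^sub>R b"
    \<comment> \<open>\<open>M\<close> bounds the coordinates of \<open>c'\<close> at
      \<open>a\<close> and \<open>b\<close>, and \<open>s\<close> is so small that
      \<open>s * M \<le> (1 - s) / 2\<close>; thus the step from the midpoint keeps these two
      coordinates nonnegative.\<close>
    define M where "M = \<bar>bary ?T a c'\<bar> + \<bar>bary ?T b c'\<bar> + 1"
    have M: "M > 0" by (simp add: M_def add_nonneg_pos)
    define s where "s = 1 / (4 * M + 1)"
    have s: "0 < s" "s < 1" using M by (auto simp: s_def)
    define x where "x = (1 - s) *\<^sub>R m + s *\<^sub>R c'"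
    have b': "bary ?T' v x = (1 - s) * ((1 - 1/2) * bary ?T' v a + (1/2) * bary ?T' v b) + s * bary ?T' v c'"
      if "v \<in> ?T'" for v
      unfolding x_def m_def bary_comb[OF t(2) that] ..
    have "bary ?T' a x = (1 - s) / 2" "bary ?T' b x = (1 - s) / 2" "bary ?T' c' x = s"
      using b'[OF in_T(4)] b'[OF in_T(5)] b'[OF in_T(6)] d in_T
      by (simp_all add: bary_vertex[OF t(2)])
    then have "x \<in> convex hull ?T'" and c'x: "bary ?T' c' x = s"
      unfolding convex_hull_bary[OF t(2)] using s by auto
    moreover have pos: "0 \<le> (1 - s) / 2 + s * y" if "\<bar>y\<bar> \<le> M" for y
    proof -
      have "- M \<le> y" using that by linarith
      then have "s * (- M) \<le> s * y" using s by (intro mult_left_mono) auto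
      moreover have "(1 - s) / 2 \<ge> s * M" using M by (simp add: s_def field_simps)
      ultimately show ?thesis by linarith
    qed
    have bT: "bary ?T v x = (1 - s) * ((1 - 1/2) * bary ?T v a + (1/2) * bary ?T v b) + s * bary ?T v c'"
      if "v \<in> ?T" for v
      unfolding x_def m_def bary_comb[OF t(1) that] ..
    have "\<bar>bary ?T a c'\<bar> \<le> M" "\<bar>bary ?T b c'\<bar> \<le> M" by (auto simp: M_def)
    then have "0 \<le> bary ?T a x" "0 \<le> bary ?T b x"
      using pos[of "bary ?T a c'"] pos[of "bary ?T b c'"] bT[OF in_T(1)] bT[OF in_T(2)] d in_T
      by (simp_all add: bary_vertex[OF t(1)])
    moreover have "0 \<le> bary ?T c x"
      using bT[OF in_T(3)] nn s d in_T by (simp add: bary_vertex[OF t(1)])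
    ultimately have "x \<in> convex hull ?T"
      unfolding convex_hull_bary[OF t(1)] by auto
    then have "bary ?T' c' x = 0"
      using hull_Int_bary[OF T(2,1) neT \<open>x \<in> convex hull ?T'\<close> _ in_T(6) c'] by blast
    then show False using s c'x by simp
  qed
  then have "cr (a - c') (b - c') / cr (b - a) (c - a) < 0"
    by (simp add: bary_eqs[OF t(1)])
  moreover have "cr (a - c') (b - c') = cr (b - a) (c' - a)" by (simp add: cr_def algebra_simps)
  ultimately show ?thesis by (auto simp: divide_less_0_iff mult_less_0_iff)
qed

text \<open>Three triangles on one edge would give three nonzero numbers with pairwise opposite
  signs.\<close>

lemma edge_two_triangles:
  assumes "T1 \<in> Th" "T2 \<in> Th" "T3 \<in> Th" "a \<noteq> b" "{a, b} \<subseteq> T1" "{a, b} \<subseteq> T2" "{a, b} \<subseteq> T3" "T1 \<noteq> T2" "T1 \<noteq> T3"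
  shows "T2 = T3"
proof (rule ccontr)
  assume ne: "T2 \<noteq> T3"
  obtain c1 where c1: "T1 = {a, b, c1}" by (rule third_vertex[OF assms(1,5,4)])
  obtain c2 where c2: "T2 = {a, b, c2}" by (rule third_vertex[OF assms(2,6,4)])
  obtain c3 where c3: "T3 = {a, b, c3}" by (rule third_vertex[OF assms(3,7,4)])
  have "cr (b - a) (c1 - a) * cr (b - a) (c2 - a) < 0" "cr (b - a) (c1 - a) * cr (b - a) (c3 - a) < 0"
    "cr (b - a) (c2 - a) * cr (b - a) (c3 - a) < 0"
    using c1 c2 c3 assms ne by (auto intro!: opposite_sides)
  then show False by (auto simp: mult_less_0_iff)
qed

text \<open>Near \<open>x\<close> the coordinates at \<open>a\<close> and \<open>b\<close> stay
  positive in both triangles. The coordinates at \<open>c\<close> and \<open>c'\<close> have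
  opposite signs there, so one of the triangles contains each nearby point.\<close>

lemma inner_open_segment:
  assumes T: "T \<in> Th" "T' \<in> Th" "T \<noteq> T'" "a \<noteq> b" "{a, b} \<subseteq> T" "{a, b} \<subseteq> T'" and x: "x \<in> open_segment a b"
  shows "x \<in> \<Omega>"
proof -
  note t = tri[OF T(1)] tri[OF T(2)]
  obtain c where c: "T = {a, b, c}" "cr (b - a) (c - a) \<noteq> 0" by (rule third_vertex[OF T(1,5,4)])
  obtain c' where c': "T' = {a, b, c'}" "cr (b - a) (c' - a) \<noteq> 0" by (rule third_vertex[OF T(2,6,4)])
  have opp: "cr (b - a) (c - a) * cr (b - a) (c' - a) < 0"
    using T c c' by (intro opposite_sides) auto
  obtain s where s: "x = (1 - s) *\<^sub>R a + s *\<^sub>R b" "0 < s" "s < 1"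
    using x by (auto simp: in_segment)
  let ?U = "{y. \<forall>v\<in>{a, b}. 0 < bary T v y} \<inter> {y. \<forall>v\<in>{a, b}. 0 < bary T' v y}"
  have "open ?U" using T by (intro open_Int open_bary_pos t) auto
  moreover have "x \<in> ?U" using s T by (auto simp: bary_comb[OF t(1)] bary_comb[OF t(2)] bary_vertex[OF t(1)] bary_vertex[OF t(2)])
  moreover have "?U \<subseteq> hullunion"
  proof
    fix y assume y: "y \<in> ?U"
    have "cr (a - y) (b - y) = cr (b - a) (y - a)" by (simp add: cr_def algebra_simps)
    then have 1: "bary T c y = cr (b - a) (y - a) / cr (b - a) (c - a)"
      and 2: "bary T' c' y = cr (b - a) (y - a) / cr (b - a) (c' - a)"
      using bary_eqs(3)[of a b c y] bary_eqs(3)[of a b c' y] t unfolding c(1) c'(1) by auto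
    have "0 \<le> bary T c y \<or> 0 \<le> bary T' c' y"
      using opp unfolding 1 2 by (auto simp: mult_less_0_iff zero_le_divide_iff)
    moreover have "0 \<le> bary T a y" "0 \<le> bary T b y" "0 \<le> bary T' a y" "0 \<le> bary T' b y"
      using y by auto
    ultimately have "(\<forall>v\<in>{a, b, c}. 0 \<le> bary T v y) \<or> (\<forall>v\<in>{a, b, c'}. 0 \<le> bary T' v y)" by auto
    then have "y \<in> convex hull T \<or> y \<in> convex hull T'"
      unfolding convex_hull_bary[OF t(1)] convex_hull_bary[OF t(2)] using c(1) c'(1) by metis
    then show "y \<in> hullunion" using T by auto
  qed
  ultimately show ?thesis unfolding dom_of_def by (rule interiorI)
qed

text \<open>Any other triangle through \<open>x\<close> would contain \<open>a\<close> and
  \<open>b\<close> by conformity, so \<open>T\<close> is the only triangle near \<open>x\<close>. A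
  small step from \<open>x\<close> away from the third vertex leaves \<open>T\<close> as
  well.\<close>

lemma outer_open_segment:
  assumes T: "T \<in> Th" "a \<noteq> b" "{a, b} \<subseteq> T" and only: "\<And>T'. T' \<in> Th \<Longrightarrow> {a, b} \<subseteq> T' \<Longrightarrow> T' = T"
    and x: "x \<in> open_segment a b"
  shows "x \<notin> \<Omega>"
proof
  assume "x \<in> \<Omega>"
  note t = tri[OF T(1)]
  obtain c where c: "T = {a, b, c}" "c \<noteq> a" "c \<noteq> b" "cr (b - a) (c - a) \<noteq> 0" by (rule third_vertex[OF T(1,3,2)])
  obtain s where s: "x = (1 - s) *\<^sub>R a + s *\<^sub>R b" "0 < s" "s < 1"
    using x by (auto simp: in_segment)
  have e: "bary T v x = (1 - s) * bary T v a + s * bary T v b" if "v \<in> T" for v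
    unfolding s(1) by (rule bary_comb[OF t that])
  have abc: "a \<in> T" "b \<in> T" "c \<in> T" using c(1) by auto
  have bx: "bary T a x > 0" "bary T b x > 0" "bary T c x = 0"
    using e[OF abc(1)] e[OF abc(2)] e[OF abc(3)] s(2,3) c(2,3) T(2) abc
    by (simp_all add: bary_vertex[OF t])
  have xT: "x \<in> convex hull T" unfolding convex_hull_bary[OF t] using bx c(1) by auto
  let ?K = "\<Union>T'\<in>Th - {T}. convex hull T'"
  have "x \<notin> ?K"
  proof
    assume "x \<in> ?K"
    then obtain T' where T': "T' \<in> Th" "T' \<noteq> T" "x \<in> convex hull T'" by auto
    then have "v \<in> T'" if "v \<in> T" "bary T v x > 0" for v
      using hull_Int_bary[OF T(1) T'(1) T'(2)[symmetric] xT T'(3) that(1)] that(2) by force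
    then have "{a, b} \<subseteq> T'" using T bx by auto
    then show False using only T' by auto
  qed
  moreover have "closed ?K" using finite_Th closed_hull by auto
  ultimately have "x \<in> \<Omega> - ?K" "open (\<Omega> - ?K)" using \<open>x \<in> \<Omega>\<close> open_dom by auto
  then obtain e where e: "e > 0" "ball x e \<subseteq> \<Omega> - ?K" by (meson openE)
  define n where "n = norm (c - x) + 1"
  have n: "n > 0" by (simp add: n_def add_nonneg_pos)
  define d where "d = e / (2 * n)"
  have d: "d > 0" using e n by (simp add: d_def)
  define y where "y = x + (- d) *\<^sub>R (c - x)"
  have "dist x y < e"
  proof -
    have "dist x y = d * norm (c - x)" using d by (simp add: y_def dist_norm)
    also have "\<dots> \<le> d * n" using d by (simp add: n_def)
    also have "\<dots> = e / 2" using n by (simp add: d_def)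
    finally show ?thesis using e by simp
  qed
  then have "y \<in> ball x e" by simp
  then have "y \<in> \<Omega> - ?K" using e(2) by blast
  then have "y \<in> convex hull T" using dom_subset by auto
  moreover have "bary T c y = - d"
    unfolding y_def bary_line[OF t abc(3)] by (simp add: bary_vertex[OF t abc(3) abc(3)] bx)
  ultimately show False using d c(1) unfolding convex_hull_bary[OF t] by auto
qed

lemma closed_segment_frontier:
  assumes "T \<in> Th" "{a, b} \<subseteq> T" and "\<And>x. x \<in> open_segment a b \<Longrightarrow> x \<notin> \<Omega>" "a \<noteq> b"
  shows "closed_segment a b \<subseteq> frontier \<Omega>"
proof -
  have "open_segment a b \<subseteq> convex hull T"
    using segment_open_subset_closed[of a b] hull_mono[OF assms(2), of convex] by (auto simp: segment_convex_hull)
  then have "open_segment a b \<subseteq> frontier \<Omega>"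
    using assms(3) hull_subset_closure_dom[OF assms(1)] by (auto simp: frontier_dom)
  then have "closure (open_segment a b) \<subseteq> frontier \<Omega>"
    by (rule closure_minimal) simp
  then show ?thesis using assms(4) closure_open_segment[of a b] by metis
qed

section \<open>Interior and boundary edges\<close>

lemma edgesI: "T \<in> Th \<Longrightarrow> {a, b} \<subseteq> T \<Longrightarrow> a \<noteq> b \<Longrightarrow> {a, b} \<in> edges Th"
  by (auto simp: edges_def)

lemma edgesE:
  assumes "e \<in> edges Th"
  obtains a b T where "e = {a, b}" "a \<noteq> b" "T \<in> Th" "{a, b} \<subseteq> T"
  using assms by (auto simp: edges_def card_2_iff)

text \<open>Translates the topological definition of an interior edge into the combinatorial one on
  which all counting rests.\<close>

lemma interior_edge_iff:
  assumes "T \<in> Th" "{a, b} \<subseteq> T" "a \<noteq> b"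
  shows "{a, b} \<in> interior_edges Th \<longleftrightarrow> (\<exists>T'\<in>Th. T' \<noteq> T \<and> {a, b} \<subseteq> T')"
proof
  assume "{a, b} \<in> interior_edges Th"
  then have "\<not> closed_segment a b \<subseteq> frontier \<Omega>"
    by (simp add: interior_edges_def segment_convex_hull)
  then obtain x where "x \<in> open_segment a b" "x \<in> \<Omega>" using closed_segment_frontier assms by blast
  then show "\<exists>T'\<in>Th. T' \<noteq> T \<and> {a, b} \<subseteq> T'" using outer_open_segment[of T a b x] assms by blast
next
  assume "\<exists>T'\<in>Th. T' \<noteq> T \<and> {a, b} \<subseteq> T'"
  then obtain T' where T': "T' \<in> Th" "T' \<noteq> T" "{a, b} \<subseteq> T'" by auto
  have m: "midpoint a b \<in> open_segment a b" using assms by simp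
  have "midpoint a b \<in> \<Omega>" by (rule inner_open_segment[OF assms(1) T'(1) T'(2)[symmetric] assms(3,2) T'(3) m])
  moreover have "midpoint a b \<in> closed_segment a b" by simp
  ultimately have "\<not> closed_segment a b \<subseteq> frontier \<Omega>" unfolding frontier_dom by blast
  then show "{a, b} \<in> interior_edges Th"
    using assms edgesI by (auto simp: interior_edges_def segment_convex_hull)
qed

lemma interior_edge_open_segment:
  assumes "{a, b} \<in> interior_edges Th" "a \<noteq> b"
  shows "open_segment a b \<subseteq> \<Omega>"
proof
  fix x assume x: "x \<in> open_segment a b"
  obtain T where T: "T \<in> Th" "{a, b} \<subseteq> T" using assms by (auto simp: interior_edges_def edges_def)
  then obtain T' where "T' \<in> Th" "T' \<noteq> T" "{a, b} \<subseteq> T'" using interior_edge_iff assms by blast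
  then show "x \<in> \<Omega>" using inner_open_segment[of T T' a b x] T assms x by metis
qed

lemma boundary_edge_closed_segment:
  assumes "{a, b} \<in> edges Th" "{a, b} \<notin> interior_edges Th"
  shows "closed_segment a b \<inter> \<Omega> = {}"
  using assms by (auto simp: interior_edges_def segment_convex_hull frontier_dom)

lemma boundary_point_cases:
  assumes "T \<in> Th" "x \<in> convex hull T" "x \<notin> \<Omega>"
  obtains "x \<in> T" | a b where "a \<noteq> b" "{a, b} \<subseteq> T" "{a, b} \<notin> interior_edges Th" "x \<in> open_segment a b"
proof -
  have "x \<notin> interior (convex hull T)" using interior_hull_subset_dom[OF assms(1)] assms(3) by blast
  then obtain a b where ab: "a \<in> T" "b \<in> T" "a \<noteq> b" "x \<in> closed_segment a b"
    by (rule convex_hull_not_interior[OF tri[OF assms(1)] assms(2)])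
  show ?thesis
  proof (cases "x = a \<or> x = b")
    case True then show ?thesis using that(1) ab by auto
  next
    case False
    then have "x \<in> open_segment a b" using ab by (simp add: open_segment_def)
    then show ?thesis using that(2)[of a b] interior_edge_open_segment ab assms by blast
  qed
qed

text \<open>Distinct triangles share at most two vertices, so their intersection is empty, a vertex
  or an edge.\<close>

lemma common_point_cases:
  assumes "T \<in> Th" "T' \<in> Th" "T \<noteq> T'" "x \<in> convex hull T" "x \<in> convex hull T'"
  obtains "x \<in> T" "x \<in> T'" | a b where "a \<noteq> b" "{a, b} \<subseteq> T" "{a, b} \<subseteq> T'" "x \<in> open_segment a b"
proof -
  have x: "x \<in> convex hull (T \<inter> T')" using hull_Int assms by blast
  have "\<not> T \<subseteq> T'" using card_subset_eq[of T' T] finite_T card_T assms by auto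
  then obtain v where v: "v \<in> T" "v \<notin> T'" by blast
  obtain b c where bc: "T = {v, b, c}" "b \<noteq> c" by (rule is_triangleE[OF tri[OF assms(1)] v(1)])
  have "T \<inter> T' \<subseteq> {b, c}" using bc v by auto
  then have sub: "T \<inter> T' = {} \<or> T \<inter> T' = {b} \<or> T \<inter> T' = {c} \<or> T \<inter> T' = {b, c}" by auto
  show ?thesis
  proof (cases "x \<in> T \<inter> T'")
    case True then show ?thesis using that(1) by auto
  next
    case False
    have "T \<inter> T' \<noteq> {}" using x by (metis convex_hull_empty empty_iff)
    moreover have "T \<inter> T' \<noteq> {v}" for v using x False by (metis convex_hull_singleton singletonD singletonI)
    ultimately have e: "T \<inter> T' = {b, c}" using sub by metis
    then have "x \<in> open_segment b c" using x False by (simp add: open_segment_def segment_convex_hull)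
    then show ?thesis using that(2)[of b c] e bc by blast
  qed
qed

lemma closed_segment_in_hull: "{a, b} \<subseteq> T \<Longrightarrow> closed_segment a b \<subseteq> convex hull T"
  using hull_mono[of "{a, b}" T convex] by (simp add: segment_convex_hull)

lemma triangles_at_edge:
  assumes "T \<in> Th" "T' \<in> Th" "T' \<noteq> T" "a \<noteq> b" "{a, b} \<subseteq> T" "{a, b} \<subseteq> T'"
  shows "{T\<in>Th. {a, b} \<subseteq> T} = {T, T'}"
proof
  show "{T\<in>Th. {a, b} \<subseteq> T} \<subseteq> {T, T'}"
  proof
    fix S assume S: "S \<in> {T\<in>Th. {a, b} \<subseteq> T}"
    show "S \<in> {T, T'}"
    proof (cases "S = T")
      case False
      have "T' = S"
        by (rule edge_two_triangles[OF assms(1,2) _ assms(4-6)]) (use S False assms(3) in auto)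
      then show ?thesis by simp
    qed simp
  qed
qed (use assms in auto)

text \<open>Incidences are counted twice: a triangle has three edges, an interior edge lies in two
  triangles and any other edge in one.\<close>

lemma card_edges_triangles: "card (edges Th) + card (interior_edges Th) = 3 * card Th"
proof -
  define k where "k = (\<lambda>e. if e \<in> interior_edges Th then 2 else 1 :: nat)"
  have k: "card {T\<in>Th. e \<subseteq> T} = k e" if e: "e \<in> edges Th" for e
  proof -
    obtain a b T where ab: "e = {a, b}" "a \<noteq> b" "T \<in> Th" "{a, b} \<subseteq> T" by (rule edgesE[OF e])
    show ?thesis
    proof (cases "e \<in> interior_edges Th")
      case True
      then obtain T' where T': "T' \<in> Th" "T' \<noteq> T" "{a, b} \<subseteq> T'" using interior_edge_iff ab by blast
      have "{T\<in>Th. e \<subseteq> T} = {T, T'}"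
        unfolding ab(1) by (rule triangles_at_edge[OF ab(3) T'(1,2) ab(2,4) T'(3)])
      then show ?thesis using True T' by (simp add: card_insert_if k_def)
    next
      case False
      then have "{T\<in>Th. e \<subseteq> T} = {T}" using interior_edge_iff[OF ab(3,4,2)] ab by auto
      then show ?thesis using False by (simp add: k_def)
    qed
  qed
  have 3: "card {e\<in>edges Th. e \<subseteq> T} = 3" if "T \<in> Th" for T
  proof -
    have "{e\<in>edges Th. e \<subseteq> T} = {e. e \<subseteq> T \<and> card e = 2}" using that by (auto simp: edges_def)
    then show ?thesis using n_subsets[OF finite_T[OF that], of 2] card_T[OF that] by (simp add: choose_two)
  qed
  have "3 * card Th = (\<Sum>T\<in>Th. card {e\<in>edges Th. e \<subseteq> T})" using 3 by simp
  also have "\<dots> = sum k (edges Th)"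
    by (rule sum_multicount_gen[OF finite_Th finite_edges]) (simp add: k)
  also have "\<dots> = (\<Sum>e\<in>edges Th. 1 + (if e \<in> interior_edges Th then 1 else 0))"
    by (rule sum.cong) (auto simp: k_def)
  also have "\<dots> = card (edges Th) + card (edges Th \<inter> interior_edges Th)"
    unfolding sum.distrib by (simp add: finite_edges flip: sum.inter_restrict)
  also have "edges Th \<inter> interior_edges Th = interior_edges Th" by (auto simp: interior_edges_def)
  finally show ?thesis by simp
qed

text \<open>Deleting the finitely many vertices leaves the domain connected, and what remains is
  partitioned into closed pieces by the classes of triangles linked through common edges.\<close>

lemma dual_connected:
  assumes conn: "connected \<Omega>" and R: "\<And>T T' a b. T \<in> Th \<Longrightarrow> T' \<in> Th \<Longrightarrow> T \<noteq> T' \<Longrightarrow> a \<noteq> b \<Longrightarrow>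
      {a, b} \<subseteq> T \<Longrightarrow> {a, b} \<subseteq> T' \<Longrightarrow> P T \<Longrightarrow> P T'"
    and T: "T \<in> Th" "P T" "T' \<in> Th"
  shows "P T'"
proof (rule ccontr)
  assume nP: "\<not> P T'"
  let ?S = "\<Omega> - vertices Th"
  let ?A = "\<Union>T\<in>{T\<in>Th. P T}. convex hull T" and ?B = "\<Union>T\<in>{T\<in>Th. \<not> P T}. convex hull T"
  have "connected ?S"
    using connected_open_diff_countable[OF _ open_dom conn countable_finite[OF finite_vertices]] by simp
  moreover have "closed ?A" "closed ?B" using finite_Th closed_hull by auto
  moreover have "?S \<subseteq> ?A \<union> ?B" using dom_subset by auto
  moreover have "?A \<inter> ?B \<inter> ?S = {}"
  proof (rule ccontr)
    assume "?A \<inter> ?B \<inter> ?S \<noteq> {}"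
    then obtain x T1 T2 where x: "x \<in> ?S" "T1 \<in> Th" "P T1" "T2 \<in> Th" "\<not> P T2" "x \<in> convex hull T1" "x \<in> convex hull T2"
      by auto
    then have "T1 \<noteq> T2" by auto
    from common_point_cases[OF x(2,4) this x(6,7)] show False
    proof cases
      case 1 then show False using x by (auto simp: vertices_def)
    next
      case (2 a b) then show False using R[OF x(2,4) \<open>T1 \<noteq> T2\<close>] x by blast
    qed
  qed
  moreover have ne: "convex hull T'' \<inter> ?S \<noteq> {}" if "T'' \<in> Th" for T''
  proof -
    have "infinite (interior (convex hull T''))"
      using interior_convex_hull_nonempty[OF tri[OF that]] finite_imp_not_open by blast
    then obtain x where "x \<in> interior (convex hull T'')" "x \<notin> vertices Th"
      using finite_vertices by (meson finite_subset subsetI)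
    then show ?thesis using interior_hull_subset_dom[OF that] interior_subset by blast
  qed
  moreover have "?A \<inter> ?S \<noteq> {}" "?B \<inter> ?S \<noteq> {}" using ne[OF T(1)] ne[OF T(3)] T nP by blast+
  ultimately show False unfolding connected_closed by blast
qed

end

section \<open>Gluing and topology of the complement\<close>

text \<open>For open bounded sets of complex numbers this is
  \<open>simply_connected_iff_simple\<close>; \<open>f\<close> and \<open>g\<close> identify the
  real plane with the complex one.\<close>

lemma simply_connected_imp_connected_Compl:
  fixes S :: "pt set"
  assumes "open S" "bounded S" "simply_connected S"
  shows "connected (- S)"
proof -
  define f where "f = (\<lambda>z :: pt. Complex (fst z) (snd z))"
  define g where "g = (\<lambda>z. (Re z, Im z))"
  have f: "continuous_on A f" for A
    unfolding f_def Complex_eq by (intro continuous_intros)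
  have g: "continuous_on A g" for A
    unfolding g_def by (intro continuous_intros)
  have gf: "g (f x) = x" "f (g y) = y" for x y by (simp_all add: f_def g_def)
  have hom: "homeomorphism A (f ` A) f g" for A
    unfolding homeomorphism_def using f g gf by (auto simp: image_image)
  have img: "f ` A = g -` A" for A using gf by (auto simp: image_iff) (metis gf(2))
  have "simply_connected (f ` S)"
    using hom[of S] assms(3) homeomorphic_simply_connected_eq homeomorphic_def by blast
  moreover have "open (f ` S)"
    unfolding img using continuous_open_vimage[OF assms(1)] g[of UNIV]
    by (simp add: continuous_on_eq_continuous_at open_vimage assms(1))
  moreover have "bounded (f ` S)"
  proof -
    have "bounded (f ` closure S)"
      using compact_continuous_image[OF f] assms(2) compact_closure compact_imp_bounded by blast
    then show ?thesis using closure_subset by (meson bounded_subset image_mono)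
  qed
  ultimately have "connected (- (f ` S))" using simply_connected_iff_simple by blast
  then have "connected (g ` (- (f ` S)))" by (rule connected_continuous_image[OF g])
  moreover have "g ` (- (f ` S)) = - S"
  proof
    show "g ` (- (f ` S)) \<subseteq> - S" unfolding img by auto
    show "- S \<subseteq> g ` (- (f ` S))" 
    proof
      fix x assume "x \<in> - S"
      then have "f x \<in> - (f ` S)" unfolding img using gf(1) by simp
      then show "x \<in> g ` (- (f ` S))" using gf(1) by (metis image_eqI)
    qed
  qed
  ultimately show ?thesis by simp
qed

text \<open>The values are integer multiples of \<open>2 * pi * \<i>\<close>, so distinct values
  keep a distance of at least \<open>pi\<close>.\<close>

lemma exp_eq_1_imp_constant:
  fixes h :: "'a::topological_space \<Rightarrow> complex"
  assumes S: "connected S" and h: "continuous_on S h" and 1: "\<And>x. x \<in> S \<Longrightarrow> exp (h x) = 1"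
    and xy: "x \<in> S" "y \<in> S"
  shows "h x = h y"
proof -
  have "h constant_on S"
  proof (rule continuous_discrete_range_constant[OF S h])
    fix x assume x: "x \<in> S"
    show "\<exists>e>0. \<forall>y. y \<in> S \<and> h y \<noteq> h x \<longrightarrow> e \<le> norm (h y - h x)"
    proof (intro exI[of _ pi] conjI allI impI)
      fix y assume y: "y \<in> S \<and> h y \<noteq> h x"
      obtain m n :: int where mn: "Re (h x) = 0" "Im (h x) = of_int (2 * m) * pi" "Re (h y) = 0" "Im (h y) = of_int (2 * n) * pi"
        using 1[OF x] 1[of y] y unfolding exp_eq_1 by blast
      then have "m \<noteq> n" using y by (auto simp: complex_eq_iff)
      then have "1 \<le> \<bar>real_of_int (n - m)\<bar>" by linarith
      then have "2 * pi * 1 \<le> 2 * pi * \<bar>real_of_int (n - m)\<bar>" by (intro mult_left_mono) auto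
      also have "\<dots> = \<bar>2 * pi * real_of_int (n - m)\<bar>" by (simp add: abs_mult)
      also have "2 * pi * real_of_int (n - m) = Im (h y - h x)" using mn by (simp add: algebra_simps)
      also have "\<bar>Im (h y - h x)\<bar> \<le> norm (h y - h x)" by (rule abs_Im_le_cmod)
      finally show "pi \<le> norm (h y - h x)" using pi_gt_zero by linarith
    qed simp
  qed
  then show ?thesis using xy unfolding constant_on_def by auto
qed

context triangulation
begin

text \<open>The closed sets pasted together are the triangles and, under the index
  \<open>None\<close>, the complement of \<open>\<Omega>\<close>. They meet only in vertices and
  open edges, which explains the form of the conditions.\<close>

lemma glue:
  fixes F :: "pt set \<Rightarrow> pt \<Rightarrow> 'b::topological_space"
  assumes cont: "\<And>T. T \<in> Th \<Longrightarrow> continuous_on (convex hull T) (F T)"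
    and vert: "\<And>T T' v. T \<in> Th \<Longrightarrow> T' \<in> Th \<Longrightarrow> v \<in> T \<Longrightarrow> v \<in> T' \<Longrightarrow> F T v = F T' v"
    and edge: "\<And>T T' a b x. T \<in> Th \<Longrightarrow> T' \<in> Th \<Longrightarrow> a \<noteq> b \<Longrightarrow> {a, b} \<subseteq> T \<Longrightarrow> {a, b} \<subseteq> T' \<Longrightarrow>
        x \<in> open_segment a b \<Longrightarrow> F T x = F T' x"
    and bvert: "\<And>T v. T \<in> Th \<Longrightarrow> v \<in> T \<Longrightarrow> v \<notin> \<Omega> \<Longrightarrow> F T v = z"
    and bedge: "\<And>T a b x. T \<in> Th \<Longrightarrow> a \<noteq> b \<Longrightarrow> {a, b} \<subseteq> T \<Longrightarrow> {a, b} \<notin> interior_edges Th \<Longrightarrow>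
        x \<in> open_segment a b \<Longrightarrow> F T x = z"
  obtains f where "continuous_on UNIV f" "\<And>T x. T \<in> Th \<Longrightarrow> x \<in> convex hull T \<Longrightarrow> f x = F T x"
    "\<And>x. x \<notin> \<Omega> \<Longrightarrow> f x = z"
proof -
  define K where "K = (\<lambda>i. case i of None \<Rightarrow> - \<Omega> | Some T \<Rightarrow> convex hull T)"
  define G where "G = (\<lambda>i. case i of None \<Rightarrow> (\<lambda>x. z) | Some T \<Rightarrow> F T)"
  let ?I = "insert None (Some ` Th)"
  have FF: "F T x = F T' x" if "T \<in> Th" "T' \<in> Th" "x \<in> convex hull T" "x \<in> convex hull T'" for T T' x
  proof (cases "T = T'")
    case False
    from common_point_cases[OF that(1,2) False that(3,4)] show ?thesis
    proof cases
      case 1 then show ?thesis by (rule vert[OF that(1,2)])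
    next
      case (2 a b) then show ?thesis by (rule edge[OF that(1,2)])
    qed
  qed simp
  have Fz: "F T x = z" if "T \<in> Th" "x \<in> convex hull T" "x \<notin> \<Omega>" for T x
    using boundary_point_cases[OF that]
  proof cases
    case 1 then show ?thesis using bvert[OF that(1) _ that(3)] by blast
  next
    case (2 a b) then show ?thesis by (rule bedge[OF that(1)])
  qed
  have "\<exists>g. continuous_map euclidean euclidean g \<and> (\<forall>x. \<forall>i\<in>?I. x \<in> K i \<longrightarrow> g x = G i x)"
  proof (rule pasting_lemma_exists_closed[of ?I euclidean K euclidean G])
    show "finite ?I" using finite_Th by simp
    show "topspace euclidean \<subseteq> \<Union> (K ` ?I)" using dom_subset by (auto simp: K_def)
    show "closedin euclidean (K i)" if "i \<in> ?I" for i
      using that closed_hull open_dom by (auto simp: K_def)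
    show "continuous_map (subtopology euclidean (K i)) euclidean (G i)" if "i \<in> ?I" for i
      using that cont by (auto simp: K_def G_def continuous_map_iff_continuous)
    show "G i x = G j x" if "i \<in> ?I" "j \<in> ?I" "x \<in> topspace euclidean \<inter> K i \<inter> K j" for i j x
    proof -
      have Gz: "G k x = z" if "k \<in> ?I" "x \<in> K k" "x \<notin> \<Omega>" for k
      proof (cases k)
        case (Some T)
        have "F T x = z" by (rule Fz) (use that Some in \<open>auto simp: K_def\<close>)
        then show ?thesis by (simp add: G_def Some)
      qed (simp add: G_def)
      show ?thesis
      proof (cases "i = None \<or> j = None")
        case True
        then have "x \<notin> \<Omega>" using that(3) by (auto simp: K_def)
        then show ?thesis using Gz[of i] Gz[of j] that by auto
      next
        case False
        then obtain T T' where ij: "i = Some T" "j = Some T'" by auto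
        have "F T x = F T' x" by (rule FF) (use that ij in \<open>auto simp: K_def\<close>)
        then show ?thesis by (simp add: G_def ij)
      qed
    qed
  qed auto
  then obtain g where g: "continuous_map euclidean euclidean g" "\<And>x i. i \<in> ?I \<Longrightarrow> x \<in> K i \<Longrightarrow> g x = G i x"
    by auto
  show ?thesis
  proof (rule that[of g])
    show "continuous_on UNIV g" using g(1) by simp
    show "g x = F T x" if "T \<in> Th" "x \<in> convex hull T" for T x
      using g(2)[of "Some T" x] that by (simp add: K_def G_def)
    show "g x = z" if "x \<notin> \<Omega>" for x
      using g(2)[of None x] that by (simp add: K_def G_def)
  qed
qed

lemma Compl_dom_nonempty: "- \<Omega> \<noteq> {}"
proof
  assume "- \<Omega> = {}"
  then have "\<Omega> = UNIV" by blast
  then show False using bounded_dom not_bounded_UNIV by metis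
qed

section \<open>Exactness of closed edge functions\<close>

text \<open>An integer-valued closed edge function has local potentials on the triangles that are
  integers at the vertices; their exponentials glue to a map from the plane to the circle, which
  lifts because the plane is contractible.\<close>

lemma closed_imp_exact_int:
  assumes conn: "connected (- \<Omega>)"
    and int: "\<And>a b. w a b \<in> \<int>" and anti: "\<And>a b. w b a = - w a b"
    and closed: "\<And>a b c. {a, b, c} \<in> Th \<Longrightarrow> w a b + w b c + w c a = (0::real)"
    and bdry: "\<And>a b. {a, b} \<in> edges Th \<Longrightarrow> {a, b} \<notin> interior_edges Th \<Longrightarrow> w a b = 0"
  obtains \<psi> where "\<And>v. v \<notin> \<Omega> \<Longrightarrow> \<psi> v = (0::real)"
    "\<And>T a b. T \<in> Th \<Longrightarrow> a \<in> T \<Longrightarrow> b \<in> T \<Longrightarrow> \<psi> b - \<psi> a = w a b"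
proof -
  have ww: "w r b - w r a = w a b" if T: "T \<in> Th" and in_T: "r \<in> T" "a \<in> T" "b \<in> T" for T r a b
  proof -
    have 0: "w x x = 0" for x using anti[of x x] by simp
    consider "r = a" | "r = b" | "a = b" | "r \<noteq> a" "r \<noteq> b" "a \<noteq> b" by auto
    then show ?thesis
    proof cases
      case 4
      obtain c where "T = {r, a, c}" by (rule third_vertex[OF T, of r a]) (use in_T 4 in auto)
      then have "{r, a, b} \<in> Th" using 4 in_T T by auto
      from closed[OF this] show ?thesis using anti[of b r] by simp
    qed (use 0 anti[of a b] in auto)
  qed
  define r where "r = (\<lambda>T. SOME a :: pt. a \<in> T)"
  have r: "r T \<in> T" if "T \<in> Th" for T
    unfolding r_def using card_T[OF that] by (metis card.empty ex_in_conv someI_ex zero_neq_numeral)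
  \<comment> \<open>The affine function on \<open>T\<close> with value \<open>w (r T) v\<close> at
    each vertex \<open>v\<close>. A different base vertex changes it by an integer, which is
    invisible in the exponential \<open>F\<close>.\<close>
  define P where "P = (\<lambda>T x. \<Sum>v\<in>T. w (r T) v * bary T v x)"
  have Pv: "P T v = w (r T) v" if T: "T \<in> Th" and v: "v \<in> T" for T v
  proof -
    have "P T v = (\<Sum>u\<in>T. if u = v then w (r T) v else 0)"
      unfolding P_def using v by (intro sum.cong refl) (auto simp: bary_vertex[OF tri[OF T]])
    then show ?thesis using finite_T[OF T] v by simp
  qed
  have Pe: "P T ((1 - s) *\<^sub>R a + s *\<^sub>R b) = w (r T) a + s * w a b"
    if T: "T \<in> Th" and ab: "a \<in> T" "b \<in> T" for T a b s
  proof -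
    have "P T ((1 - s) *\<^sub>R a + s *\<^sub>R b) = (\<Sum>v\<in>T. (1 - s) * (w (r T) v * bary T v a) + s * (w (r T) v * bary T v b))"
      unfolding P_def by (intro sum.cong refl, subst bary_comb[OF tri[OF T]], assumption, simp add: algebra_simps)
    also have "\<dots> = (1 - s) * P T a + s * P T b"
      unfolding P_def by (simp add: sum.distrib sum_distrib_left)
    also have "\<dots> = w (r T) a + s * (w (r T) b - w (r T) a)" using Pv T ab by (simp add: algebra_simps)
    finally show ?thesis using ww[OF T r[OF T] ab] by simp
  qed
  have Pcont: "continuous_on S (P T)" if "T \<in> Th" for T S
    unfolding P_def by (intro continuous_on_sum continuous_on_mult continuous_on_const
        poly2_continuous_on[OF poly2_bary[OF tri[OF that]]])
  define F where "F = (\<lambda>T x. cis (2 * pi * P T x))"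
  have F1: "F T v = 1" if "T \<in> Th" "v \<in> T" for T v
    using Pv[OF that] int cis_multiple_2pi by (simp add: F_def)
  have Fe: "F T ((1 - s) *\<^sub>R a + s *\<^sub>R b) = cis (2 * pi * (s * w a b))"
    if "T \<in> Th" "a \<in> T" "b \<in> T" for T a b s
    using Pe[OF that] int cis_multiple_2pi[of "w (r T) a"]
    by (simp add: F_def distrib_left flip: cis_mult)
  obtain g where g: "continuous_on UNIV g" "\<And>T x. T \<in> Th \<Longrightarrow> x \<in> convex hull T \<Longrightarrow> g x = F T x"
    "\<And>x. x \<notin> \<Omega> \<Longrightarrow> g x = 1"
  proof (rule glue[of F 1])
    show "continuous_on (convex hull T) (F T)" if "T \<in> Th" for T
      unfolding F_def by (intro continuous_intros Pcont that)
    fix T T' a b x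
    assume T: "T \<in> Th" "a \<noteq> b" "{a, b} \<subseteq> T" and x: "x \<in> open_segment a b"
    obtain s where s: "x = (1 - s) *\<^sub>R a + s *\<^sub>R b" using x by (auto simp: in_segment)
    show "F T x = F T' x" if "T' \<in> Th" "{a, b} \<subseteq> T'" 
      unfolding s using Fe T that by simp
    show "F T x = 1" if "{a, b} \<notin> interior_edges Th"
      unfolding s using Fe[of T a b s] bdry[OF edgesI[OF T(1,3,2)] that] T by simp
  qed (use F1 in auto)
  have g0: "g x \<noteq> 0" for x
  proof (cases "x \<in> \<Omega>")
    case True
    then obtain T where "T \<in> Th" "x \<in> convex hull T" using dom_subset by auto
    then show ?thesis using g(2) by (simp add: F_def)
  qed (simp add: g(3))
  obtain h where h: "continuous_on UNIV h" "\<And>x. g x = exp (h x)"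
    using continuous_logarithm_on_contractible[OF g(1) contractible_UNIV] g0 by auto
  have hT: "h b - h a = \<i> * of_real (2 * pi * w a b)" if T: "T \<in> Th" and ab: "a \<in> T" "b \<in> T" for T a b
  proof -
    \<comment> \<open>Both \<open>h\<close> and the local lift have exponential \<open>g\<close> on
      \<open>T\<close>, so their difference is constant there and \<open>h\<close> inherits the
      increments of \<open>P T\<close>.\<close>
    define D where "D = (\<lambda>x. h x - \<i> * of_real (2 * pi * P T x))"
    have "D a = D b"
    proof (rule exp_eq_1_imp_constant[where h = D and S = "convex hull T"])
      show "connected (convex hull T)" by (simp add: convex_connected)
      show "continuous_on (convex hull T) D"
        unfolding D_def by (intro continuous_intros Pcont T continuous_on_subset[OF h(1)]) auto
      show "exp (D x) = 1" if "x \<in> convex hull T" for x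
        using h(2)[of x] g(2)[OF T that]
        by (simp add: D_def F_def exp_diff cis_conv_exp)
    qed (simp_all add: hull_inc ab)
    then have "h b - h a = \<i> * of_real (2 * pi * (P T b - P T a))"
      by (simp add: D_def algebra_simps)
    then show ?thesis using Pv[OF T] ww[OF T r[OF T] ab] ab by simp
  qed
  obtain p where p: "p \<notin> \<Omega>" using Compl_dom_nonempty by auto
  \<comment> \<open>Connectedness of the complement gives \<open>h\<close> one value off
    \<open>\<Omega>\<close>; subtracting it makes the potential vanish at all boundary vertices
    together.\<close>
  have hc: "h x = h p" if "x \<notin> \<Omega>" for x
  proof (rule exp_eq_1_imp_constant[OF conn, where h = h])
    show "continuous_on (- \<Omega>) h" by (rule continuous_on_subset[OF h(1)]) auto
    show "exp (h x) = 1" if "x \<in> - \<Omega>" for x using h(2)[of x] g(3)[of x] that by simp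
  qed (use p that in auto)
  show ?thesis
  proof (rule that[of "\<lambda>v. Im (h v - h p) / (2 * pi)"])
    show "Im (h b - h p) / (2 * pi) - Im (h a - h p) / (2 * pi) = w a b"
      if "T \<in> Th" "a \<in> T" "b \<in> T" for T a b
    proof -
      have "Im (h b - h p) / (2 * pi) - Im (h a - h p) / (2 * pi) = Im (h b - h a) / (2 * pi)"
        by (simp add: diff_divide_distrib)
      also have "\<dots> = w a b" unfolding hT[OF that] by simp
      finally show ?thesis .
    qed
  qed (simp add: hc)
qed

end

section \<open>From integral to real edge functions\<close>

lemma finite_common_denominator:
  assumes "finite A"
  shows "\<exists>d::real. d > 0 \<and> d \<in> \<int> \<and> (\<forall>q\<in>A. d * of_rat q \<in> \<int>)"
  using assms
proof induction
  case (insert q A)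
  then obtain d :: real where d: "d > 0" "d \<in> \<int>" "\<forall>q\<in>A. d * of_rat q \<in> \<int>" by blast
  obtain m n :: int where q: "q = of_int m / of_int n" "n > 0"
    by (metis Fract_of_int_quotient Rat_cases)
  have "real_of_int n * of_rat q = of_int m" using q by (simp add: of_rat_divide)
  then have "(of_int n * d) * of_rat q = d * of_int m" by (metis mult.assoc mult.commute)
  moreover have "(of_int n * d) * of_rat q' = of_int n * (d * of_rat q')" for q' by simp
  ultimately have "(of_int n * d) * of_rat q' \<in> \<int>" if "q' \<in> insert q A" for q'
    using that d by (metis Ints_mult Ints_of_int insertE)
  then show ?case using d q
    by (intro exI[of _ "of_int n * d"] conjI ballI) auto
qed (auto intro: exI[of _ 1])

interpretation ratreal: vector_space "\<lambda>(q::rat) (x::real). of_rat q * x"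
  by unfold_locales (auto simp: algebra_simps of_rat_add of_rat_mult)

context triangulation
begin

text \<open>A real-valued closed edge function is a combination of rational-valued closed ones, with
  coefficients from a rational basis of the span of its values.\<close>

lemma closed_imp_exact:
  assumes conn: "connected (- \<Omega>)"
    and anti: "\<And>a b. w b a = - w a b"
    and closed: "\<And>a b c. {a, b, c} \<in> Th \<Longrightarrow> w a b + w b c + w c a = (0::real)"
    and bdry: "\<And>a b. {a, b} \<in> edges Th \<Longrightarrow> {a, b} \<notin> interior_edges Th \<Longrightarrow> w a b = 0"
  obtains \<psi> where "\<And>v. v \<notin> \<Omega> \<Longrightarrow> \<psi> v = (0::real)"
    "\<And>T a b. T \<in> Th \<Longrightarrow> a \<in> T \<Longrightarrow> b \<in> T \<Longrightarrow> \<psi> b - \<psi> a = w a b"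
proof -
  let ?V = "vertices Th"
  \<comment> \<open>Outside the vertices \<open>w\<close> is arbitrary; cutting it off there leaves
    finitely many values, so their rational span has a finite basis.\<close>
  define u where "u = (\<lambda>a b. if a \<in> ?V \<and> b \<in> ?V then w a b else 0)"
  have u_anti: "u b a = - u a b" for a b using anti[of b a] by (simp add: u_def)
  have u_eq: "u a b = w a b" if "T \<in> Th" "a \<in> T" "b \<in> T" for T a b
    using that by (auto simp: u_def vertices_def)
  define A where "A = (\<lambda>(a, b). u a b) ` (?V \<times> ?V)"
  have finA: "finite A" using finite_vertices by (simp add: A_def)
  obtain B where B: "B \<subseteq> A" "ratreal.independent B" "A \<subseteq> ratreal.span B"
    using ratreal.basis_exists .
  have finB: "finite B" using B finA finite_subset by blast
  have sp: "u a b \<in> ratreal.span B" for a b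
  proof (cases "a \<in> ?V \<and> b \<in> ?V")
    case True then show ?thesis using B(3) by (auto simp: A_def)
  next
    case False then show ?thesis by (auto simp: u_def intro: ratreal.span_zero)
  qed
  \<comment> \<open>Taking the coordinate at a basis element is linear over the rationals, so each
    \<open>R \<beta>\<close> inherits antisymmetry, closedness and vanishing on boundary edges. A
    common denominator \<open>d\<close> then makes it integral.\<close>
  define R where "R = (\<lambda>\<beta> a b. ratreal.representation B (u a b) \<beta>)"
  have "\<exists>d \<psi>. d > (0::real) \<and> (\<forall>v. v \<notin> \<Omega> \<longrightarrow> \<psi> v = (0::real)) \<and>
      (\<forall>T a b. T \<in> Th \<longrightarrow> a \<in> T \<longrightarrow> b \<in> T \<longrightarrow> \<psi> b - \<psi> a = d * of_rat (R \<beta> a b))" for \<beta>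
  proof -
    have "finite (insert 0 ((\<lambda>(a, b). R \<beta> a b) ` (?V \<times> ?V)))" using finite_vertices by simp
    from finite_common_denominator[OF this] obtain d :: real where d: "d > 0" "d \<in> \<int>"
      "\<And>a b. a \<in> ?V \<Longrightarrow> b \<in> ?V \<Longrightarrow> d * of_rat (R \<beta> a b) \<in> \<int>" by auto
    have Rz: "R \<beta> a b = 0" if "u a b = 0" for a b
      using that by (simp add: R_def ratreal.representation_zero)
    obtain \<psi> where "\<And>v. v \<notin> \<Omega> \<Longrightarrow> \<psi> v = (0::real)"
      "\<And>T a b. T \<in> Th \<Longrightarrow> a \<in> T \<Longrightarrow> b \<in> T \<Longrightarrow> \<psi> b - \<psi> a = d * of_rat (R \<beta> a b)"
    proof (rule closed_imp_exact_int[OF conn, of "\<lambda>a b. d * of_rat (R \<beta> a b)"])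
      show "d * of_rat (R \<beta> a b) \<in> \<int>" for a b
      proof (cases "a \<in> ?V \<and> b \<in> ?V")
        case False
        then have "R \<beta> a b = 0" by (intro Rz) (auto simp: u_def)
        then show ?thesis by simp
      qed (use d in auto)
      show "d * of_rat (R \<beta> b a) = - (d * of_rat (R \<beta> a b))" for a b
        using ratreal.representation_neg[OF B(2) sp, of a b] u_anti[of b a]
        by (simp add: R_def of_rat_minus)
      show "d * of_rat (R \<beta> a b) + d * of_rat (R \<beta> b c) + d * of_rat (R \<beta> c a) = 0"
        if T: "{a, b, c} \<in> Th" for a b c
      proof -
        have "u a b + u b c + u c a = 0"
          using closed[OF T] u_eq[OF T] by simp
        then have "ratreal.representation B (u a b + u b c + u c a) \<beta> = 0"
          by (simp add: ratreal.representation_zero)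
        then have "R \<beta> a b + R \<beta> b c + R \<beta> c a = 0"
          by (simp add: R_def ratreal.representation_add[OF B(2)] sp ratreal.span_add)
        then have "(of_rat (R \<beta> a b + R \<beta> b c + R \<beta> c a) :: real) = 0" by simp
        then show ?thesis by (simp add: of_rat_add flip: distrib_left)
      qed
      show "d * of_rat (R \<beta> a b) = 0" if e: "{a, b} \<in> edges Th" "{a, b} \<notin> interior_edges Th" for a b
        using bdry[OF e] by (simp add: Rz u_def)
    qed blast
    then show ?thesis using d(1) by blast
  qed
  then obtain d \<psi> where d: "\<And>\<beta>. d \<beta> > (0::real)" and \<psi>: "\<And>\<beta> v. v \<notin> \<Omega> \<Longrightarrow> \<psi> \<beta> v = (0::real)"
    "\<And>\<beta> T a b. T \<in> Th \<Longrightarrow> a \<in> T \<Longrightarrow> b \<in> T \<Longrightarrow> \<psi> \<beta> b - \<psi> \<beta> a = d \<beta> * of_rat (R \<beta> a b)"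
    by metis
  show ?thesis
  \<comment> \<open>Dividing by \<open>d \<beta>\<close> undoes the clearing of denominators; the
    weights \<open>\<beta>\<close> reassemble each value from its coordinates.\<close>
  proof (rule that[of "\<lambda>v. \<Sum>\<beta>\<in>B. \<beta> / d \<beta> * \<psi> \<beta> v"])
    show "(\<Sum>\<beta>\<in>B. \<beta> / d \<beta> * \<psi> \<beta> b) - (\<Sum>\<beta>\<in>B. \<beta> / d \<beta> * \<psi> \<beta> a) = w a b"
      if T: "T \<in> Th" "a \<in> T" "b \<in> T" for T a b
    proof -
      have "(\<Sum>\<beta>\<in>B. \<beta> / d \<beta> * \<psi> \<beta> b) - (\<Sum>\<beta>\<in>B. \<beta> / d \<beta> * \<psi> \<beta> a)
        = (\<Sum>\<beta>\<in>B. \<beta> / d \<beta> * (\<psi> \<beta> b - \<psi> \<beta> a))"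
        by (simp add: sum_subtractf right_diff_distrib)
      also have "\<dots> = (\<Sum>\<beta>\<in>B. of_rat (R \<beta> a b) * \<beta>)"
        using d by (intro sum.cong refl) (simp add: \<psi>(2)[OF T] less_imp_neq[THEN not_sym])
      also have "\<dots> = u a b"
        unfolding R_def by (rule ratreal.sum_representation_eq[OF B(2) sp finB subset_refl])
      finally show ?thesis using u_eq[OF T] by simp
    qed
  qed (simp add: \<psi>(1))
qed

end

section \<open>The Euler relation\<close>

interpretation fsp: vector_space_pair "fscale :: real \<Rightarrow> ('a \<Rightarrow> real) \<Rightarrow> 'a \<Rightarrow> real"
    "fscale :: real \<Rightarrow> ('b \<Rightarrow> real) \<Rightarrow> 'b \<Rightarrow> real"
  by unfold_locales

lemma supportedD: "f \<in> supported A \<Longrightarrow> x \<notin> A \<Longrightarrow> f x = 0"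
  unfolding supported_def by blast

text \<open>The boundary of \<open>T\<close> run counterclockwise: the third vertex lies to the left
  of the edge from \<open>a\<close> to \<open>b\<close>.\<close>

definition ccw_pairs :: "pt set \<Rightarrow> (pt \<times> pt) set" where
  "ccw_pairs T = {(a, b). a \<in> T \<and> b \<in> T \<and> a \<noteq> b \<and> (\<forall>c\<in>T - {a, b}. cr (b - a) (c - a) > 0)}"

lemma cr_swap: "cr (a - b) (c - b) = - cr (b - a) (c - a)"
  by (simp add: cr_def algebra_simps)

lemma cr_rotate: "cr (c - b) (a - b) = cr (b - a) (c - a)"
  by (simp add: cr_def algebra_simps)

lemma ccw_pairs_eq:
  assumes "is_triangle {a, b, c}" "cr (b - a) (c - a) > 0"
  shows "ccw_pairs {a, b, c} = {(a, b), (b, c), (c, a)}"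
proof -
  note d = is_triangle_cr[OF assms(1)]
  have "cr (c - b) (a - b) > 0" "cr (a - c) (b - c) > 0"
    using assms(2) cr_rotate[of c b a] cr_rotate[of a c b] by simp_all
  moreover have "\<not> cr (a - b) (c - b) > 0" "\<not> cr (b - c) (a - c) > 0" "\<not> cr (c - a) (b - a) > 0"
    using calculation assms(2) cr_swap[of a b c] cr_swap[of b c a] cr_swap[of c a b] by simp_all
  ultimately show ?thesis
    unfolding ccw_pairs_def using d assms(2) by auto
qed

context triangulation
begin

lemma ccw_pairsE:
  assumes "T \<in> Th" "(a, b) \<in> ccw_pairs T"
  obtains c where "T = {a, b, c}" "a \<noteq> b" "cr (b - a) (c - a) > 0"
proof -
  have ab: "{a, b} \<subseteq> T" "a \<noteq> b" using assms(2) by (auto simp: ccw_pairs_def)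
  obtain c where c: "T = {a, b, c}" "c \<noteq> a" "c \<noteq> b" by (rule third_vertex[OF assms(1) ab])
  then have "c \<in> T - {a, b}" by auto
  then have "cr (b - a) (c - a) > 0" using assms(2) by (auto simp: ccw_pairs_def)
  then show ?thesis using that c ab by blast
qed

lemma ccw_pairsI: "is_triangle {a, b, c} \<Longrightarrow> cr (b - a) (c - a) > 0 \<Longrightarrow> (a, b) \<in> ccw_pairs {a, b, c}"
  using ccw_pairs_eq by auto

lemma finite_ccw_pairs: "T \<in> Th \<Longrightarrow> finite (ccw_pairs T)"
  by (rule finite_subset[of _ "T \<times> T"]) (auto simp: ccw_pairs_def finite_T)

lemma ccw_pairs_unique:
  assumes "T \<in> Th" "T' \<in> Th" "p \<in> ccw_pairs T" "p \<in> ccw_pairs T'"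
  shows "T = T'"
proof -
  obtain a b where p: "p = (a, b)" by (cases p)
  obtain c where c: "T = {a, b, c}" "cr (b - a) (c - a) > 0" using ccw_pairsE assms(1,3) p by metis
  obtain c' where c': "T' = {a, b, c'}" "cr (b - a) (c' - a) > 0" using ccw_pairsE assms(2,4) p by metis
  have "\<not> cr (b - a) (c - a) * cr (b - a) (c' - a) < 0" using c(2) c'(2) by (simp add: not_less)
  then have "c = c'" using opposite_sides[of a b c c'] assms c(1) c'(1) by blast
  then show ?thesis using c c' by simp
qed

text \<open>The third vertices lie on opposite sides of the common edge, so the two orientations of
  that edge cancel.\<close>

lemma ccw_pairs_neighbour:
  assumes T: "T \<in> Th" "T' \<in> Th" "T \<noteq> T'" "(a, b) \<in> ccw_pairs T" "{a, b} \<subseteq> T'"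
  shows "(b, a) \<in> ccw_pairs T'"
proof -
  obtain c where c: "T = {a, b, c}" "a \<noteq> b" "cr (b - a) (c - a) > 0" by (rule ccw_pairsE[OF T(1,4)])
  obtain c' where c': "T' = {a, b, c'}" by (rule third_vertex[OF T(2,5) c(2)])
  have "cr (b - a) (c - a) * cr (b - a) (c' - a) < 0"
    by (rule opposite_sides) (use T(1-3) c(1) c' in metis)+
  then have "cr (a - b) (c' - b) > 0" using c(3) by (simp add: cr_swap[of a b] mult_less_0_iff)
  moreover have "T' = {b, a, c'}" using c' by auto
  ultimately show ?thesis using ccw_pairsI tri[OF T(2)] by auto
qed

text \<open>Simplicial 1-cochains relative to the boundary, on ordered pairs so that reversing an
  edge is a change of sign. With \<open>vertex_diff\<close> and \<open>coboundary\<close> they form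
  the relative cochain complex.\<close>

definition cochains :: "(pt \<times> pt \<Rightarrow> real) set" where
  "cochains = {w. (\<forall>a b. w (b, a) = - w (a, b)) \<and> (\<forall>a b. w (a, b) \<noteq> 0 \<longrightarrow> {a, b} \<in> interior_edges Th)}"

definition coboundary :: "(pt \<times> pt \<Rightarrow> real) \<Rightarrow> pt set \<Rightarrow> real" where
  "coboundary w T = (if T \<in> Th then \<Sum>p\<in>ccw_pairs T. w p else 0)"

definition vertex_diff :: "(pt \<Rightarrow> real) \<Rightarrow> pt \<times> pt \<Rightarrow> real" where
  "vertex_diff \<psi> = (\<lambda>(a, b). if {a, b} \<in> edges Th then \<psi> b - \<psi> a else 0)"

lemma cochainsI:
  "(\<And>a b. w (b, a) = - w (a, b)) \<Longrightarrow> (\<And>a b. w (a, b) \<noteq> 0 \<Longrightarrow> {a, b} \<in> interior_edges Th) \<Longrightarrow> w \<in> cochains"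
  unfolding cochains_def by blast

lemma cochains_anti: "w \<in> cochains \<Longrightarrow> w (b, a) = - w (a, b)"
  and cochains_support: "w \<in> cochains \<Longrightarrow> w (a, b) \<noteq> 0 \<Longrightarrow> {a, b} \<in> interior_edges Th"
  unfolding cochains_def by blast+

lemma subspace_cochains: "fs.subspace cochains"
  unfolding fs.subspace_def
proof (intro conjI ballI allI)
  show "0 \<in> cochains" by (rule cochainsI) auto
next
  fix v w assume vw: "v \<in> cochains" "w \<in> cochains"
  show "v + w \<in> cochains"
  proof (rule cochainsI)
    show "(v + w) (b, a) = - (v + w) (a, b)" for a b
      using cochains_anti[OF vw(1), of b a] cochains_anti[OF vw(2), of b a] by simp
    fix a b assume "(v + w) (a, b) \<noteq> 0"
    then have "v (a, b) \<noteq> 0 \<or> w (a, b) \<noteq> 0" by auto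
    then show "{a, b} \<in> interior_edges Th" using cochains_support vw by blast
  qed
next
  fix c w assume w: "w \<in> cochains"
  show "(\<lambda>p. c * w p) \<in> cochains"
  proof (rule cochainsI)
    show "c * w (b, a) = - (c * w (a, b))" for a b using cochains_anti[OF w, of b a] by simp
    show "{a, b} \<in> interior_edges Th" if "c * w (a, b) \<noteq> 0" for a b
      using cochains_support[OF w, of a b] that by auto
  qed
qed

lemma coboundary_linear: "coboundary (w + w') = coboundary w + coboundary w'"
  "coboundary (\<lambda>p. c * w p) = (\<lambda>T. c * coboundary w T)"
  by (auto simp: coboundary_def fun_eq_iff sum.distrib sum_distrib_left)

lemma coboundary_triangle:
  assumes w: "w \<in> cochains" and T: "{a, b, c} \<in> Th"
  shows "coboundary w {a, b, c} = 0 \<longleftrightarrow> w (a, b) + w (b, c) + w (c, a) = 0"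
proof -
  note d = is_triangle_cr[OF tri[OF T]]
  have anti: "w (x, y) = - w (y, x)" for x y by (rule cochains_anti[OF w])
  show ?thesis
  proof (cases "cr (b - a) (c - a) > 0")
    case True
    then have "coboundary w {a, b, c} = w (a, b) + w (b, c) + w (c, a)"
      using T d by (simp add: coboundary_def ccw_pairs_eq[OF tri[OF T]] add.assoc)
    then show ?thesis by simp
  next
    case False
    have r: "{a, b, c} = {b, a, c}" by auto
    have "cr (a - b) (c - b) > 0" using False d by (simp add: cr_swap[of a b])
    then have "coboundary w {a, b, c} = w (b, a) + w (a, c) + w (c, b)"
      using T d unfolding r by (simp add: coboundary_def ccw_pairs_eq[OF tri[OF T[unfolded r]]] add.assoc)
    also have "\<dots> = - (w (a, b) + w (b, c) + w (c, a))"
      using anti[of a b] anti[of b c] anti[of c a] by linarith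
    finally show ?thesis by linarith
  qed
qed

lemma interior_edge_neq: "{a, b} \<in> interior_edges Th \<Longrightarrow> a \<noteq> b"
  by (auto simp: interior_edges_def edges_def)

lemma dim_cochains: "fs.dim cochains = card (interior_edges Th)"
proof -
  \<comment> \<open>Lexicographic order of the ends orients each edge; the sign
    \<open>\<sigma>\<close> turns a function of unordered edges into an antisymmetric one.\<close>
  define \<sigma> where "\<sigma> = (\<lambda>(a::pt) (b::pt). if fst a < fst b \<or> fst a = fst b \<and> snd a < snd b then 1 else - 1 :: real)"
  define \<Phi> where "\<Phi> = (\<lambda>(f :: pt set \<Rightarrow> real) (a, b). \<sigma> a b * f {a, b})"
  have \<sigma>: "\<sigma> b a = - \<sigma> a b" if "a \<noteq> b" for a b
    using that by (auto simp: \<sigma>_def prod_eq_iff)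
  have \<sigma>\<sigma>: "\<sigma> a b * \<sigma> a b = 1" for a b by (simp add: \<sigma>_def)
  let ?S = "supported (interior_edges Th)"
  have "fs.dim (\<Phi> ` ?S) = fs.dim ?S"
  proof (rule fsp.dim_image_inj_on[OF subspace_supported])
    show "inj_on \<Phi> ?S"
    proof (rule inj_onI, rule ext)
      fix f g e assume f: "f \<in> ?S" "g \<in> ?S" "\<Phi> f = \<Phi> g"
      show "f e = g e"
      proof (cases "e \<in> interior_edges Th")
        case True
        then obtain a b where e: "e = {a, b}" using edgesE by (metis (mono_tags, lifting) interior_edges_def mem_Collect_eq)
        have "\<sigma> a b * f e = \<sigma> a b * g e" using fun_cong[OF f(3), of "(a, b)"] by (simp add: \<Phi>_def e)
        then show ?thesis using \<sigma>\<sigma>[of a b] by auto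
      qed (use f in \<open>auto simp: supported_def\<close>)
    qed
  qed (auto simp: \<Phi>_def fun_eq_iff algebra_simps)
  moreover have "\<Phi> ` ?S = cochains"
  proof
    show "\<Phi> ` ?S \<subseteq> cochains"
    proof
      fix w assume "w \<in> \<Phi> ` ?S"
      then obtain f where f: "f \<in> ?S" "w = \<Phi> f" by auto
      have "w (b, a) = - w (a, b)" for a b
      proof (cases "a = b")
        case True
        then have "f {a, b} = 0" using f(1) interior_edge_neq[of a b] by (auto simp: supported_def)
        then show ?thesis using True by (simp add: f(2) \<Phi>_def)
      next
        case False
        have "{b, a} = {a, b}" by auto
        then show ?thesis using \<sigma>[OF False] by (simp add: f(2) \<Phi>_def)
      qed
      moreover have "w (a, b) \<noteq> 0 \<longrightarrow> {a, b} \<in> interior_edges Th" for a b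
        using f by (auto simp: \<Phi>_def supported_def)
      ultimately show "w \<in> cochains" by (intro cochainsI) blast+
    qed
    show "cochains \<subseteq> \<Phi> ` ?S"
    proof
      fix w assume w: "w \<in> cochains"
      \<comment> \<open>Either order of the two ends may be picked, since
        \<open>\<sigma> a b * w (a, b)\<close> is symmetric in \<open>a\<close> and
        \<open>b\<close>.\<close>
      define f where "f = (\<lambda>e. if e \<in> interior_edges Th
        then case (SOME p. e = {fst p, snd p}) of (a, b) \<Rightarrow> \<sigma> a b * w (a, b) else 0)"
      have "\<Phi> f (a, b) = w (a, b)" for a b
      proof (cases "{a, b} \<in> interior_edges Th")
        case True
        obtain x y where xy: "(SOME p. {a, b} = {fst p, snd p}) = (x, y)" by (cases "SOME p. {a, b} = {fst p, snd p}")
        have "{a, b} = {x, y}"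
          using someI[of "\<lambda>p. {a, b} = {fst p, snd p}" "(a, b)"] xy by simp
        then have "(x, y) = (a, b) \<or> (x, y) = (b, a)" by (auto simp: doubleton_eq_iff)
        moreover have "\<sigma> b a * w (b, a) = \<sigma> a b * w (a, b)"
          unfolding cochains_anti[OF w, of b a] \<sigma>[OF interior_edge_neq[OF True]] by simp
        ultimately have "\<sigma> x y * w (x, y) = \<sigma> a b * w (a, b)" by (metis prod.inject)
        then show ?thesis using True xy \<sigma>\<sigma>[of a b]
          by (simp add: \<Phi>_def f_def mult.assoc[symmetric])
      next
        case False
        then have "w (a, b) = 0" using cochains_support[OF w] by blast
        then show ?thesis using False by (simp add: \<Phi>_def f_def)
      qed
      moreover have "f \<in> ?S" by (simp add: f_def supported_def)
      ultimately show "w \<in> \<Phi> ` ?S" by (intro image_eqI[of _ _ f]) auto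
    qed
  qed
  ultimately show ?thesis using dim_supported[OF finite_interior_edges] by simp
qed

lemma cochains_finite_dim: "\<exists>A. finite A \<and> cochains \<subseteq> fs.span A"
proof -
  let ?E = "vertices Th \<times> vertices Th"
  have "cochains \<subseteq> supported ?E"
  proof
    fix w assume w: "w \<in> cochains"
    have "{a, b} \<subseteq> vertices Th" if "w (a, b) \<noteq> 0" for a b
      using cochains_support[OF w that] by (auto simp: interior_edges_def edges_def vertices_def)
    then show "w \<in> supported ?E" by (auto simp: supported_def)
  qed
  also have "\<dots> \<subseteq> fs.span ((\<lambda>a. indicator {a}) ` ?E)"
    by (rule supported_subset_span) (simp add: finite_vertices)
  finally show ?thesis
    by (intro exI[of _ "(\<lambda>a. indicator {a}) ` ?E"] conjI) (simp add: finite_vertices)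
qed

text \<open>Take a vertex with largest first coordinate: no point of the union lies to its right, so
  no ball round it is contained in the union.\<close>

lemma exists_boundary_vertex: "\<exists>T\<in>Th. \<exists>v\<in>T. v \<notin> \<Omega>"
proof -
  have "vertices Th \<noteq> {}"
    using Th_nonempty card_T by (fastforce simp: vertices_def)
  then have "Max (fst ` vertices Th) \<in> fst ` vertices Th"
    using finite_vertices by (intro Max_in) auto
  then obtain v where v: "v \<in> vertices Th" "fst v = Max (fst ` vertices Th)" by auto
  then have max: "fst u \<le> fst v" if "u \<in> vertices Th" for u
    using that finite_vertices by simp
  have le: "fst x \<le> fst v" if x: "x \<in> hullunion" for x
  proof -
    obtain T where T: "T \<in> Th" "x \<in> convex hull T" using x by auto
    have "convex {x :: pt. fst x \<le> fst v}"
      unfolding convex_alt by (auto intro: convex_bound_le)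
    then have "convex hull T \<subseteq> {x. fst x \<le> fst v}"
      using T(1) max by (intro hull_minimal) (auto simp: vertices_def)
    then show ?thesis using T(2) by auto
  qed
  have "v \<notin> \<Omega>"
  proof
    assume "v \<in> \<Omega>"
    then obtain e where e: "e > 0" "ball v e \<subseteq> \<Omega>" using open_dom by (meson openE)
    have "v + (e / 2, 0) \<in> ball v e" using e by (simp add: dist_norm)
    then have "fst (v + (e / 2, 0)) \<le> fst v" using e dom_subset le by blast
    then show False using e by simp
  qed
  then show ?thesis using v by (auto simp: vertices_def)
qed

text \<open>The difference of two functions with the same image is constant on each triangle and
  zero at a boundary vertex; zero then spreads across common edges to all triangles.\<close>

lemma inj_vertex_diff:
  assumes conn: "connected \<Omega>"
  shows "inj_on vertex_diff (supported (interior_vertices Th))"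
proof (rule inj_onI)
  fix f g assume f: "f \<in> supported (interior_vertices Th)" "g \<in> supported (interior_vertices Th)"
    "vertex_diff f = vertex_diff g"
  define h where "h = (\<lambda>v. f v - g v)"
  have h: "h a = h b" if "T \<in> Th" "a \<in> T" "b \<in> T" for T a b
  proof (cases "a = b")
    case False
    then have "{a, b} \<in> edges Th" using that edgesI by auto
    then show ?thesis using fun_cong[OF f(3), of "(a, b)"] by (simp add: vertex_diff_def h_def)
  qed simp
  have h0: "h v = 0" if "v \<notin> interior_vertices Th" for v
    using supportedD[OF f(1) that] supportedD[OF f(2) that] by (simp add: h_def)
  obtain T0 v0 where T0: "T0 \<in> Th" "v0 \<in> T0" "v0 \<notin> \<Omega>" using exists_boundary_vertex by blast
  have "h v0 = 0" using T0 by (intro h0) (auto simp: interior_vertices_def)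
  have all: "\<forall>v\<in>T. h v = 0" if "T \<in> Th" for T
  proof (rule dual_connected[OF conn, where P = "\<lambda>T. \<forall>v\<in>T. h v = 0" and T = T0])
    show "\<forall>v\<in>T0. h v = 0" using h T0 \<open>h v0 = 0\<close> by metis
    show "\<forall>v\<in>T'. h v = 0" if "T' \<in> Th" "{a, b} \<subseteq> T" "{a, b} \<subseteq> T'" "\<forall>v\<in>T. h v = 0" for T T' a b
      using that h[OF that(1)] by (metis insert_subset)
  qed (use T0 that in auto)
  have "h v = 0" for v
  proof (cases "v \<in> interior_vertices Th")
    case True then show ?thesis using all by (auto simp: interior_vertices_def vertices_def)
  qed (rule h0)
  then show "f = g" by (auto simp: h_def fun_eq_iff)
qed

text \<open>A potential that vanishes off \<open>\<Omega>\<close> is supported on interior vertices.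
  Conversely, a boundary edge has both ends off \<open>\<Omega>\<close>, so such a potential has no
  difference along it.\<close>

lemma kernel_coboundary:
  assumes conn: "connected (- \<Omega>)"
  shows "{w\<in>cochains. coboundary w = 0} = vertex_diff ` supported (interior_vertices Th)"
proof
  show "{w\<in>cochains. coboundary w = 0} \<subseteq> vertex_diff ` supported (interior_vertices Th)"
  proof safe
    fix w assume w: "w \<in> cochains" and 0: "coboundary w = 0"
    obtain \<psi> where \<psi>: "\<And>v. v \<notin> \<Omega> \<Longrightarrow> \<psi> v = (0::real)"
      "\<And>T a b. T \<in> Th \<Longrightarrow> a \<in> T \<Longrightarrow> b \<in> T \<Longrightarrow> \<psi> b - \<psi> a = w (a, b)"
    proof (rule closed_imp_exact[OF conn, of "\<lambda>a b. w (a, b)"])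
      show "w (b, a) = - w (a, b)" for a b by (rule cochains_anti[OF w])
      show "w (a, b) + w (b, c) + w (c, a) = 0" if "{a, b, c} \<in> Th" for a b c
        using coboundary_triangle[OF w that] 0 by simp
      show "w (a, b) = 0" if "{a, b} \<notin> interior_edges Th" for a b
        using cochains_support[OF w] that by blast
    qed blast
    define \<psi>' where "\<psi>' = (\<lambda>v. if v \<in> interior_vertices Th then \<psi> v else 0)"
    have \<psi>': "\<psi>' v = \<psi> v" if "T \<in> Th" "v \<in> T" for T v
      using that \<psi>(1) by (auto simp: \<psi>'_def interior_vertices_def vertices_def)
    have "w (a, b) = vertex_diff \<psi>' (a, b)" for a b
    proof (cases "{a, b} \<in> edges Th")
      case True
      then obtain T where T: "T \<in> Th" "a \<in> T" "b \<in> T" by (auto simp: edges_def)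
      then show ?thesis using True \<psi>(2)[OF T] \<psi>' by (simp add: vertex_diff_def)
    next
      case False
      then have "{a, b} \<notin> interior_edges Th" by (simp add: interior_edges_def)
      then have "w (a, b) = 0" using cochains_support[OF w] by blast
      then show ?thesis using False by (simp add: vertex_diff_def)
    qed
    then have "w = vertex_diff \<psi>'" by auto
    moreover have "\<psi>' \<in> supported (interior_vertices Th)" by (simp add: \<psi>'_def supported_def)
    ultimately show "w \<in> vertex_diff ` supported (interior_vertices Th)" by blast
  qed
  show "vertex_diff ` supported (interior_vertices Th) \<subseteq> {w\<in>cochains. coboundary w = 0}"
  proof safe
    fix \<psi> assume \<psi>: "\<psi> \<in> supported (interior_vertices Th)"
    have e: "{a, b} \<in> interior_edges Th" if ne: "vertex_diff \<psi> (a, b) \<noteq> 0" for a b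
    proof (rule ccontr)
      assume n: "{a, b} \<notin> interior_edges Th"
      have ab: "{a, b} \<in> edges Th" using ne by (auto simp: vertex_diff_def split: if_splits)
      have "a \<in> closed_segment a b" "b \<in> closed_segment a b" by auto
      then have "a \<notin> \<Omega>" "b \<notin> \<Omega>" using boundary_edge_closed_segment[OF ab n] by blast+
      then have "\<psi> a = 0" "\<psi> b = 0"
        by (intro supportedD[OF \<psi>]; simp add: interior_vertices_def)+
      then show False using ne by (simp add: vertex_diff_def split: if_splits)
    qed
    show c: "vertex_diff \<psi> \<in> cochains"
    proof (rule cochainsI[OF _ e])
      fix a b show "vertex_diff \<psi> (b, a) = - vertex_diff \<psi> (a, b)"
        using insert_commute[of a b "{}"] by (simp add: vertex_diff_def)
    qed
    show "coboundary (vertex_diff \<psi>) = 0"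
    proof
      fix T show "coboundary (vertex_diff \<psi>) T = 0 T"
      proof (cases "T \<in> Th")
        case True
        obtain a b c where T: "T = {a, b, c}" "a \<noteq> b" "a \<noteq> c" "b \<noteq> c"
          by (rule is_triangle_vertices[OF tri[OF True]])
        have "{a, b} \<in> edges Th" "{b, c} \<in> edges Th" "{c, a} \<in> edges Th"
          using T True by (auto intro!: edgesI)
        then show ?thesis using coboundary_triangle[OF c True[unfolded T(1)]] T(1)
          by (simp add: vertex_diff_def)
      qed (simp add: coboundary_def)
    qed
  qed
qed

text \<open>An interior edge is run once in each direction, by its two triangles. Reversal is thus
  an involution on the directed edges with \<open>w\<close> nonzero, and it negates
  \<open>w\<close>.\<close>

lemma sum_coboundary:
  assumes w: "w \<in> cochains"
  shows "(\<Sum>T\<in>Th. coboundary w T) = 0"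
proof -
  define D where "D = (\<Union>T\<in>Th. ccw_pairs T)"
  have finD: "finite D" using finite_Th finite_ccw_pairs by (simp add: D_def)
  have "(\<Sum>T\<in>Th. coboundary w T) = (\<Sum>T\<in>Th. \<Sum>p\<in>ccw_pairs T. w p)"
    by (simp add: coboundary_def)
  also have "\<dots> = sum w D"
    unfolding D_def
  proof (rule sum.UNION_disjoint[symmetric, OF finite_Th])
    show "\<forall>T\<in>Th. finite (ccw_pairs T)" using finite_ccw_pairs by blast
    show "\<forall>T\<in>Th. \<forall>T'\<in>Th. T \<noteq> T' \<longrightarrow> ccw_pairs T \<inter> ccw_pairs T' = {}"
      using ccw_pairs_unique by blast
  qed
  also have "\<dots> = sum w {p\<in>D. w p \<noteq> 0}"
    using finD by (intro sum.mono_neutral_right) auto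
  also have "\<dots> = 0"
  proof -
    let ?D = "{p\<in>D. w p \<noteq> 0}"
    have anti: "w (prod.swap p) = - w p" for p
      using cochains_anti[OF w, of "snd p" "fst p"] by (cases p) simp
    have sw: "prod.swap p \<in> ?D" if p: "p \<in> ?D" for p
    proof -
      obtain a b where ab: "p = (a, b)" by (cases p)
      obtain T where T: "T \<in> Th" "(a, b) \<in> ccw_pairs T" using p ab by (auto simp: D_def)
      have e: "{a, b} \<in> interior_edges Th" using cochains_support[OF w] p ab by blast
      have sub: "{a, b} \<subseteq> T" "a \<noteq> b" using T(2) by (auto simp: ccw_pairs_def)
      obtain T' where T': "T' \<in> Th" "T' \<noteq> T" "{a, b} \<subseteq> T'"
        using interior_edge_iff[OF T(1) sub] e by blast
      have "(b, a) \<in> ccw_pairs T'" by (rule ccw_pairs_neighbour[OF T(1) T'(1) T'(2)[symmetric] T(2) T'(3)])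
      then show ?thesis using T'(1) p anti[of p] ab by (auto simp: D_def)
    qed
    have "sum w ?D = sum (\<lambda>p. w (prod.swap p)) ?D"
      by (rule sum.reindex_bij_witness[of _ prod.swap prod.swap]) (use sw in auto)
    also have "\<dots> = - sum w ?D" by (simp add: anti sum_negf)
    finally show ?thesis by simp
  qed
  finally show ?thesis .
qed

text \<open>A unit weight on the edge between neighbours moves a unit from one to the other;
  \<open>dual_connected\<close> composes such moves.\<close>

lemma exists_unit_flow:
  assumes conn: "connected \<Omega>" and T0: "T0 \<in> Th" and T: "T \<in> Th"
  shows "\<exists>w\<in>cochains. coboundary w = (\<lambda>S. indicator {T} S - indicator {T0} S)"
proof (rule dual_connected[OF conn, where T = T0 and
    P = "\<lambda>T. \<exists>w\<in>cochains. coboundary w = (\<lambda>S. indicator {T} S - indicator {T0} S)"])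
  show "\<exists>w\<in>cochains. coboundary w = (\<lambda>S. indicator {T0} S - indicator {T0} S)"
    using fs.subspace_0[OF subspace_cochains] by (intro bexI[of _ 0]) (auto simp: coboundary_def fun_eq_iff)
  fix T T' a b
  assume T: "T \<in> Th" "T' \<in> Th" "T \<noteq> T'" "a \<noteq> b" "{a, b} \<subseteq> T" "{a, b} \<subseteq> T'"
    and "\<exists>w\<in>cochains. coboundary w = (\<lambda>S. indicator {T} S - indicator {T0} S)"
  then obtain w where w: "w \<in> cochains" "coboundary w = (\<lambda>S. indicator {T} S - indicator {T0} S)" by blast
  obtain p q where pq: "(p, q) \<in> ccw_pairs T'" "{p, q} \<subseteq> T" "{p, q} \<in> interior_edges Th"
  proof -
    obtain c where c: "T' = {a, b, c}" "cr (b - a) (c - a) \<noteq> 0" by (rule third_vertex[OF T(2,6,4)])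
    have e: "{a, b} \<in> interior_edges Th" using interior_edge_iff[OF T(1,5,4)] T by blast
    have c2: "T' = {b, a, c}" using c by auto
    have "(a, b) \<in> ccw_pairs T' \<or> (b, a) \<in> ccw_pairs T'"
    proof (cases "cr (b - a) (c - a) > 0")
      case True then show ?thesis using ccw_pairsI[of a b c] tri[OF T(2)] c by simp
    next
      case False
      then have "cr (a - b) (c - b) > 0" using c(2) by (simp add: cr_swap[of a b])
      then show ?thesis using ccw_pairsI[of b a c] tri[OF T(2)] c2 by simp
    qed
    then show ?thesis using that[of a b] that[of b a] e T(5) by (auto simp: insert_commute)
  qed
  have qp: "(q, p) \<in> ccw_pairs T" by (rule ccw_pairs_neighbour[OF T(2,1) T(3)[symmetric] pq(1,2)])
  have ne: "p \<noteq> q" using interior_edge_neq pq by blast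
  define u where "u = (\<lambda>x. indicator {(p, q)} x - indicator {(q, p)} x :: real)"
  have u: "u \<in> cochains"
  proof (rule cochainsI)
    show "u (b, a) = - u (a, b)" for a b
      unfolding u_def indicator_def using ne by (cases "a = p"; cases "b = q"; cases "a = q"; cases "b = p") simp_all
    fix a b assume "u (a, b) \<noteq> 0"
    then have "(a, b) = (p, q) \<or> (a, b) = (q, p)" by (auto simp: u_def indicator_def split: if_splits)
    then have "{a, b} = {p, q}" by auto
    then show "{a, b} \<in> interior_edges Th" using pq(3) by simp
  qed
  have "coboundary u S = indicator {T'} S - indicator {T} S" for S
  proof (cases "S \<in> Th")
    case True
    have "coboundary u S = (\<Sum>x\<in>ccw_pairs S. if x = (p, q) then 1 else 0) - (\<Sum>x\<in>ccw_pairs S. if x = (q, p) then 1 else 0)"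
      using True by (simp add: coboundary_def u_def sum_subtractf indicator_def of_bool_def)
    also have "\<dots> = (if (p, q) \<in> ccw_pairs S then 1 else 0) - (if (q, p) \<in> ccw_pairs S then 1 else 0)"
      using finite_ccw_pairs[OF True] by simp
    also have "(p, q) \<in> ccw_pairs S \<longleftrightarrow> S = T'" using ccw_pairs_unique[OF True T(2)] pq(1) by blast
    also have "(q, p) \<in> ccw_pairs S \<longleftrightarrow> S = T" using ccw_pairs_unique[OF True T(1)] qp by blast
    finally show ?thesis by (simp add: indicator_def)
  next
    case False
    then show ?thesis using T by (auto simp: coboundary_def indicator_def)
  qed
  then have "coboundary (w + u) = (\<lambda>S. indicator {T'} S - indicator {T0} S)"
    by (auto simp: coboundary_linear w(2))
  then show "\<exists>w\<in>cochains. coboundary w = (\<lambda>S. indicator {T'} S - indicator {T0} S)"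
    using fs.subspace_add[OF subspace_cochains w(1) u] by blast
qed (use T0 T in auto)

lemma image_coboundary:
  assumes conn: "connected \<Omega>"
  shows "coboundary ` cochains = {l\<in>supported Th. (\<Sum>T\<in>Th. l T) = 0}"
proof
  show "coboundary ` cochains \<subseteq> {l\<in>supported Th. (\<Sum>T\<in>Th. l T) = 0}"
    using sum_coboundary by (auto simp: supported_def coboundary_def)
  show "{l\<in>supported Th. (\<Sum>T\<in>Th. l T) = 0} \<subseteq> coboundary ` cochains"
  proof safe
    fix l assume l: "l \<in> supported Th" "(\<Sum>T\<in>Th. l T) = 0"
    obtain T0 where T0: "T0 \<in> Th" using Th_nonempty by blast
    obtain w where w: "\<And>T. T \<in> Th \<Longrightarrow> w T \<in> cochains"
      "\<And>T. T \<in> Th \<Longrightarrow> coboundary (w T) = (\<lambda>S. indicator {T} S - indicator {T0} S)"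
      using exists_unit_flow[OF conn T0] by metis
    \<comment> \<open>The amount \<open>l T\<close> is carried from \<open>T0\<close> to each
      \<open>T\<close>. The total taken from \<open>T0\<close> is the sum of \<open>l\<close>, which
      is zero.\<close>
    define u where "u = (\<Sum>T\<in>Th. (\<lambda>p. l T * w T p))"
    have "u \<in> cochains"
      unfolding u_def using w(1) by (intro fs.subspace_sum fs.subspace_scale subspace_cochains)
    moreover have "coboundary u S = l S" for S
    proof (cases "S \<in> Th")
      case True
      have cs: "coboundary (sum f I) = (\<Sum>i\<in>I. coboundary (f i))" for f and I :: "pt set set"
      proof (induction I rule: infinite_finite_induct)
        case (insert x F)
        then show ?case by (simp only: sum.insert[OF insert.hyps] coboundary_linear)
      qed (auto simp: coboundary_def fun_eq_iff)
      have "coboundary u S = (\<Sum>T\<in>Th. l T * (indicator {T} S - indicator {T0} S))"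
        unfolding u_def cs sum_fun_apply by (intro sum.cong refl) (simp add: coboundary_linear w(2))
      also have "\<dots> = (\<Sum>T\<in>Th. if T = S then l T else 0) - (\<Sum>T\<in>Th. l T) * indicator {T0} S"
        unfolding sum_distrib_right sum_subtractf[symmetric]
        by (intro sum.cong refl) (auto simp: indicator_def)
      also have "\<dots> = l S" using True l(2) finite_Th by simp
      finally show ?thesis .
    qed (use l in \<open>auto simp: coboundary_def supported_def\<close>)
    ultimately show "l \<in> coboundary ` cochains" by (metis ext image_eqI)
  qed
qed

lemma dim_sum_zero:
  "fs.dim {l\<in>supported Th. (\<Sum>T\<in>Th. l T) = 0} + 1 = card Th"
proof -
  \<comment> \<open>The sum is viewed as a function on \<open>unit\<close>, because the target of
    the rank formula is a space of functions.\<close>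
  let ?s = "\<lambda>l (x::unit). \<Sum>T\<in>Th. l T :: real"
  let ?S = "supported Th :: (pt set \<Rightarrow> real) set"
  have "fs.dim ?S = fs.dim {l\<in>?S. ?s l = 0} + fs.dim (?s ` ?S)"
    by (rule fsp.rank_nullity_on[OF subspace_supported _ supported_subset_span[OF finite_Th]])
      (use finite_Th in \<open>auto simp: sum.distrib sum_distrib_left\<close>)
  moreover have "{l\<in>?S. ?s l = 0} = {l\<in>?S. (\<Sum>T\<in>Th. l T) = 0}" by (auto simp: fun_eq_iff)
  moreover have "?s ` ?S = supported UNIV"
  proof -
    obtain T0 where T0: "T0 \<in> Th" using Th_nonempty by blast
    have "f \<in> ?s ` ?S" for f
    proof (rule image_eqI[of _ _ "\<lambda>T. if T = T0 then f () else 0"])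
      show "f = ?s (\<lambda>T. if T = T0 then f () else 0)" using T0 finite_Th by (auto simp: fun_eq_iff)
    qed (use T0 in \<open>auto simp: supported_def\<close>)
    then show ?thesis by (auto simp: supported_def)
  qed
  ultimately show ?thesis using dim_supported[OF finite_Th] dim_supported[of "UNIV :: unit set"] by simp
qed

theorem euler_relation:
  assumes conn: "connected \<Omega>" and compl: "connected (- \<Omega>)"
  shows "card (interior_vertices Th) + card Th = card (interior_edges Th) + 1"
proof -
  obtain A where A: "finite A" "cochains \<subseteq> fs.span A" using cochains_finite_dim by blast
  have fin: "finite (interior_vertices Th)" using finite_vertices by (simp add: interior_vertices_def)
  have "fs.dim cochains = fs.dim {w\<in>cochains. coboundary w = 0} + fs.dim (coboundary ` cochains)"
    by (rule fsp.rank_nullity_on[OF subspace_cochains A]) (simp_all add: coboundary_linear)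
  moreover have "fs.dim {w\<in>cochains. coboundary w = 0} = card (interior_vertices Th)"
  proof -
    have "fs.dim (vertex_diff ` supported (interior_vertices Th)) = fs.dim (supported (interior_vertices Th))"
      by (rule fsp.dim_image_inj_on[OF subspace_supported _ _ inj_vertex_diff[OF conn]])
        (auto simp: vertex_diff_def fun_eq_iff algebra_simps)
    then show ?thesis using kernel_coboundary[OF compl] dim_supported[OF fin] by simp
  qed
  ultimately show ?thesis
    using dim_cochains image_coboundary[OF conn] dim_sum_zero by simp
qed

end

section \<open>Dimension of the continuous piecewise cubics\<close>

text \<open>Ten nodes against ten coefficients: the four nodes on each axis eliminate the constant
  and the pure powers of that variable, the remaining three the mixed terms.\<close>

lemma poly2_3_zero_reference:
  assumes q: "poly2 3 q"
    and z: "q (0, 0) = 0" "q (0, 1/3) = 0" "q (0, 2/3) = 0" "q (0, 1) = 0" "q (1/3, 0) = 0" "q (1/3, 1/3) = 0"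
    "q (1/3, 2/3) = 0" "q (2/3, 0) = 0" "q (2/3, 1/3) = 0" "q (1, 0) = 0"
  shows "q x = 0"
proof -
  obtain c where c: "\<And>x y. q (x, y) = (\<Sum>i\<le>3. \<Sum>j\<le>3 - i. c i j * x ^ i * y ^ j)"
    using q unfolding poly2_def by blast
  obtain c0 c1 c2 c3 c4 c5 c6 c7 c8 c9 where e: "\<And>x y. q (x, y) = c0 + c1 * y + c2 * y ^ 2 + c3 * y ^ 3
      + c4 * x + c5 * x * y + c6 * x * y ^ 2 + c7 * x ^ 2 + c8 * x ^ 2 * y + c9 * x ^ 3"
  proof
    show "q (x, y) = c 0 0 + c 0 1 * y + c 0 2 * y ^ 2 + c 0 3 * y ^ 3 + c 1 0 * x + c 1 1 * x * y + c 1 2 * x * y ^ 2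
      + c 2 0 * x ^ 2 + c 2 1 * x ^ 2 * y + c 3 0 * x ^ 3" for x y
      unfolding c by (simp add: eval_nat_numeral)
  qed
  note ** = z[unfolded e, simplified power_divide, simplified]
  have "c0 = 0" using ** by linarith
  moreover have "c1 = 0" "c2 = 0" "c3 = 0" using ** by linarith+
  moreover have "c4 = 0" "c7 = 0" "c9 = 0" using ** by linarith+
  moreover have "c5 = 0" "c6 = 0" "c8 = 0" using ** by linarith+
  ultimately show ?thesis by (cases x) (simp add: e)
qed

lemma poly2_3_unisolvent:
  assumes T: "is_triangle T" and p: "poly2 3 p"
    and v: "\<And>a. a \<in> T \<Longrightarrow> p a = 0"
    and e: "\<And>a b. a \<in> T \<Longrightarrow> b \<in> T \<Longrightarrow> a \<noteq> b \<Longrightarrow> p ((2/3) *\<^sub>R a + (1/3) *\<^sub>R b) = 0"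
    and m: "p (\<Sum>a\<in>T. (1/3) *\<^sub>R a) = 0"
  shows "p x = 0"
proof -
  obtain a b c where abc: "T = {a, b, c}" "a \<noteq> b" "a \<noteq> c" "b \<noteq> c"
    by (rule is_triangle_vertices[OF T])
  \<comment> \<open>\<open>A\<close> and \<open>B\<close> are the components of the affine map that
    sends (0, 0), (1, 0), (0, 1) to \<open>a\<close>, \<open>b\<close>, \<open>c\<close>.\<close>
  define A where "A = (\<lambda>z :: pt. fst a + (fst b - fst a) * fst z + (fst c - fst a) * snd z)"
  define B where "B = (\<lambda>z :: pt. snd a + (snd b - snd a) * fst z + (snd c - snd a) * snd z)"
  define q where "q = (\<lambda>z. p (A z, B z))"
  have "poly2 1 A" "poly2 1 B" unfolding A_def B_def by (rule poly2_1I)+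
  then have q: "poly2 3 q" unfolding q_def by (rule poly2_comp_affine[OF p])
  have qe: "q (s, t) = p ((1 - s - t) *\<^sub>R a + s *\<^sub>R b + t *\<^sub>R c)" for s t
    unfolding q_def A_def B_def by (rule arg_cong[of _ _ p]) (simp add: prod_eq_iff algebra_simps)
  have m': "(\<Sum>a\<in>T. (1/3) *\<^sub>R a) = (1/3) *\<^sub>R a + (1/3) *\<^sub>R b + (1/3) *\<^sub>R c"
    using abc by (simp add: add.assoc)
  have q0: "q z = 0" for z
  proof (rule poly2_3_zero_reference[OF q])
    show "q (0, 0) = 0" "q (0, 1/3) = 0" "q (0, 2/3) = 0" "q (0, 1) = 0" "q (1/3, 0) = 0" "q (1/3, 1/3) = 0"
    "q (1/3, 2/3) = 0" "q (2/3, 0) = 0" "q (2/3, 1/3) = 0" "q (1, 0) = 0"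
      using v[of a] v[of b] v[of c] e[of a b] e[of a c] e[of b a] e[of b c] e[of c a] e[of c b] m[unfolded m'] abc
      by (simp_all add: qe add.commute)
  qed
  have "x = (1 - bary T b x - bary T c x) *\<^sub>R a + bary T b x *\<^sub>R b + bary T c x *\<^sub>R c"
  proof -
    have "bary T a x = 1 - bary T b x - bary T c x" using bary_sum[OF T, of x] abc by simp
    then show ?thesis using bary_sum_scale[OF T, of x] abc by (simp add: add.assoc)
  qed
  then show ?thesis using q0[of "(bary T b x, bary T c x)"] unfolding qe by simp
qed

text \<open>A point names a vertex node and a set of points the centroid of a triangle. An ordered
  pair names the edge point one third of the way from its first to its second end, so the two orders
  give the two nodes of an edge.\<close>

type_synonym node = "pt + (pt \<times> pt) + pt set"

definition node_pt :: "node \<Rightarrow> pt" where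
  "node_pt i = (case i of Inl v \<Rightarrow> v
     | Inr (Inl (a, b)) \<Rightarrow> (2/3) *\<^sub>R a + (1/3) *\<^sub>R b
     | Inr (Inr T) \<Rightarrow> (\<Sum>a\<in>T. (1/3) *\<^sub>R a))"

section \<open>Nodal values of continuous piecewise cubics\<close>

context triangulation
begin

definition P3 :: "(pt \<Rightarrow> real) set" where
  "P3 = {f. continuous_on UNIV f \<and> (\<forall>x. x \<notin> \<Omega> \<longrightarrow> f x = 0) \<and>
     (\<forall>T\<in>Th. \<exists>p. poly2 3 p \<and> (\<forall>x\<in>convex hull T. f x = p x))}"

lemma P3D:
  assumes "f \<in> P3"
  shows "continuous_on UNIV f" "x \<notin> \<Omega> \<Longrightarrow> f x = 0"
    "T \<in> Th \<Longrightarrow> \<exists>p. poly2 3 p \<and> (\<forall>x\<in>convex hull T. f x = p x)"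
  using assms unfolding P3_def by blast+

lemma subspace_P3: "fs.subspace P3"
  unfolding fs.subspace_def
proof (intro conjI ballI allI)
  show "0 \<in> P3" unfolding P3_def by (auto simp: zero_fun_def intro: exI[of _ "\<lambda>_. 0"])
next
  fix f g assume f: "f \<in> P3" and g: "g \<in> P3"
  show "f + g \<in> P3"
    unfolding P3_def
  proof (safe)
    show "continuous_on UNIV (f + g)"
      unfolding plus_fun_def using P3D(1) f g by (intro continuous_on_add)
    show "(f + g) x = 0" if "x \<notin> \<Omega>" for x using P3D(2)[OF f that] P3D(2)[OF g that] by simp
    fix T assume T: "T \<in> Th"
    obtain p q where "poly2 3 p" "\<forall>x\<in>convex hull T. f x = p x" "poly2 3 q" "\<forall>x\<in>convex hull T. g x = q x"
      using P3D(3)[OF f T] P3D(3)[OF g T] by blast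
    then show "\<exists>p. poly2 3 p \<and> (\<forall>x\<in>convex hull T. (f + g) x = p x)"
      by (intro exI[of _ "\<lambda>z. p z + q z"]) (simp add: poly2_add)
  qed
next
  fix c f assume f: "f \<in> P3"
  show "(\<lambda>x. c * f x) \<in> P3"
    unfolding P3_def
  proof (safe)
    show "continuous_on UNIV (\<lambda>x. c * f x)"
      using P3D(1) f by (intro continuous_on_mult_left)
    show "c * f x = 0" if "x \<notin> \<Omega>" for x using P3D(2)[OF f that] by simp
    fix T assume T: "T \<in> Th"
    obtain p where "poly2 3 p" "\<forall>x\<in>convex hull T. f x = p x"
      using P3D(3)[OF f T] by blast
    then show "\<exists>p. poly2 3 p \<and> (\<forall>x\<in>convex hull T. c * f x = p x)"
      by (intro exI[of _ "\<lambda>z. c * p z"]) (simp add: poly2_cmult)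
  qed
qed

definition directed_edges :: "(pt \<times> pt) set" where
  "directed_edges = {(a, b). {a, b} \<in> interior_edges Th}"

definition nodes :: "node set" where
  "nodes = interior_vertices Th <+> directed_edges <+> Th"

lemma finite_interior_vertices: "finite (interior_vertices Th)"
  using finite_vertices by (simp add: interior_vertices_def)

lemma card_directed_edges: "card directed_edges = 2 * card (interior_edges Th)" and finite_directed_edges: "finite directed_edges"
proof -
  let ?D = "\<lambda>e. {(a, b). {a, b} = (e :: pt set)}"
  have D: "card (?D e) = 2 \<and> finite (?D e)" if "e \<in> interior_edges Th" for e
  proof -
    have "e \<in> edges Th" using that by (simp add: interior_edges_def)
    then obtain a b where "e = {a, b}" "a \<noteq> b" by (rule edgesE)
    then have "?D e = {(a, b), (b, a)}" by (auto simp: doubleton_eq_iff)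
    then show ?thesis using \<open>a \<noteq> b\<close> by simp
  qed
  have U: "directed_edges = (\<Union>e\<in>interior_edges Th. ?D e)" by (auto simp: directed_edges_def)
  have "card directed_edges = (\<Sum>e\<in>interior_edges Th. card (?D e))"
    unfolding U
  proof (rule card_UN_disjoint[OF finite_interior_edges])
    show "\<forall>e\<in>interior_edges Th. finite (?D e)" using D by blast
    show "\<forall>e\<in>interior_edges Th. \<forall>e'\<in>interior_edges Th. e \<noteq> e' \<longrightarrow> ?D e \<inter> ?D e' = {}" by blast
  qed
  then show "card directed_edges = 2 * card (interior_edges Th)" using D by simp
  show "finite directed_edges" unfolding U using finite_interior_edges D by blast
qed

lemma finite_nodes: "finite nodes"
  and card_nodes: "card nodes = card (interior_vertices Th) + 2 * card (interior_edges Th) + card Th"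
  using finite_interior_vertices finite_directed_edges finite_Th card_directed_edges
  by (simp_all add: nodes_def card_Plus)

definition eval_nodes :: "(pt \<Rightarrow> real) \<Rightarrow> node \<Rightarrow> real" where
  "eval_nodes f i = (if i \<in> nodes then f (node_pt i) else 0)"

text \<open>The ten nodes of a triangle that are not listed in \<open>nodes\<close> lie off
  \<open>\<Omega>\<close>, where \<open>f\<close> vanishes anyway; the cubic piece is then zero by
  unisolvence.\<close>

lemma eval_nodes_eq_0_imp:
  assumes f: "f \<in> P3" and z: "eval_nodes f = 0"
  shows "f x = 0"
proof (cases "x \<in> \<Omega>")
  case True
  then obtain T where T: "T \<in> Th" "x \<in> convex hull T" using dom_subset by auto
  obtain p where p: "poly2 3 p" "\<forall>x\<in>convex hull T. f x = p x" using P3D(3)[OF f T(1)] by blast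
  have z': "f (node_pt i) = 0" if "i \<in> nodes" for i
    using fun_cong[OF z, of i] that by (simp add: eval_nodes_def)
  have "p x = 0"
  proof (rule poly2_3_unisolvent[OF tri[OF T(1)] p(1)])
    fix a assume a: "a \<in> T"
    have "f a = 0"
    proof (cases "a \<in> \<Omega>")
      case True
      then have "Inl a \<in> nodes" using a T(1) by (auto simp: nodes_def interior_vertices_def vertices_def)
      from z'[OF this] show ?thesis by (simp add: node_pt_def)
    qed (rule P3D(2)[OF f])
    then show "p a = 0" using p(2) hull_inc[OF a] by metis
  next
    fix a b assume ab: "a \<in> T" "b \<in> T" "a \<noteq> b"
    let ?y = "(2/3) *\<^sub>R a + (1/3) *\<^sub>R b"
    have "(1 - 1/3) *\<^sub>R a + (1/3) *\<^sub>R b \<in> closed_segment a b" unfolding in_segment by (rule exI[of _ "1/3"]) simp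
    then have y: "?y \<in> closed_segment a b" by simp
    have "f ?y = 0"
    proof (cases "{a, b} \<in> interior_edges Th")
      case True
      then have "Inr (Inl (a, b)) \<in> nodes" by (auto simp: nodes_def directed_edges_def)
      from z'[OF this] show ?thesis by (simp add: node_pt_def)
    next
      case False
      have "{a, b} \<in> edges Th" using edgesI[OF T(1)] ab by simp
      then have "?y \<notin> \<Omega>" using boundary_edge_closed_segment False y by blast
      then show ?thesis by (rule P3D(2)[OF f])
    qed
    moreover have "?y \<in> convex hull T" using closed_segment_in_hull[of a b T] ab y by blast
    ultimately show "p ?y = 0" using p(2) by metis
  next
    have "Inr (Inr T) \<in> nodes" using T(1) by (auto simp: nodes_def)
    from z'[OF this] have "f (\<Sum>a\<in>T. (1/3) *\<^sub>R a) = 0" by (simp add: node_pt_def)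
    moreover have "(\<Sum>a\<in>T. (1/3) *\<^sub>R a) \<in> convex hull T"
      using card_T[OF T(1)] finite_T[OF T(1)] by (auto simp: convex_hull_finite intro!: exI[of _ "\<lambda>_. 1/3"])
    ultimately show "p (\<Sum>a\<in>T. (1/3) *\<^sub>R a) = 0" using p(2) by metis
  qed
  then show ?thesis using p(2) T(2) by simp
qed (rule P3D(2)[OF f])

lemma inj_eval_nodes: "inj_on eval_nodes P3"
proof (rule inj_onI, rule ext)
  fix f g x assume f: "f \<in> P3" "g \<in> P3" "eval_nodes f = eval_nodes g"
  have "eval_nodes (f - g) = 0"
  proof
    fix i show "eval_nodes (f - g) i = 0 i"
      using fun_cong[OF f(3), of i] by (simp add: eval_nodes_def split: if_splits)
  qed
  then have "(f - g) x = 0"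
    using eval_nodes_eq_0_imp[OF fs.subspace_diff[OF subspace_P3 f(1,2)]] by blast
  then show "f x = g x" by simp
qed

text \<open>The cubic Lagrange basis in barycentric coordinates for vertices, edge nodes and
  centroid. The factors 1/2, 9/2 and 27 give each basis function the value 1 at its own
  node.\<close>

definition interpolant :: "(node \<Rightarrow> real) \<Rightarrow> pt set \<Rightarrow> pt \<Rightarrow> real" where
  "interpolant v T x =
     (\<Sum>a\<in>T. v (Inl a) * (1/2 * bary T a x * (3 * bary T a x - 1) * (3 * bary T a x - 2)))
   + (\<Sum>(a, b)\<in>{(a, b). a \<in> T \<and> b \<in> T \<and> a \<noteq> b}. v (Inr (Inl (a, b))) * (9/2 * bary T a x * bary T b x * (3 * bary T a x - 1)))
   + 27 * v (Inr (Inr T)) * (\<Prod>a\<in>T. bary T a x)"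

lemma interpolant_triangle:
  assumes T: "T = {a, b, c}" "a \<noteq> b" "a \<noteq> c" "b \<noteq> c"
  shows "interpolant v T x =
     v (Inl a) * (1/2 * bary T a x * (3 * bary T a x - 1) * (3 * bary T a x - 2))
   + v (Inl b) * (1/2 * bary T b x * (3 * bary T b x - 1) * (3 * bary T b x - 2))
   + v (Inl c) * (1/2 * bary T c x * (3 * bary T c x - 1) * (3 * bary T c x - 2))
   + v (Inr (Inl (a, b))) * (9/2 * bary T a x * bary T b x * (3 * bary T a x - 1))
   + v (Inr (Inl (b, a))) * (9/2 * bary T b x * bary T a x * (3 * bary T b x - 1))
   + v (Inr (Inl (a, c))) * (9/2 * bary T a x * bary T c x * (3 * bary T a x - 1))
   + v (Inr (Inl (c, a))) * (9/2 * bary T c x * bary T a x * (3 * bary T c x - 1))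
   + v (Inr (Inl (b, c))) * (9/2 * bary T b x * bary T c x * (3 * bary T b x - 1))
   + v (Inr (Inl (c, b))) * (9/2 * bary T c x * bary T b x * (3 * bary T c x - 1))
   + 27 * v (Inr (Inr T)) * (bary T a x * bary T b x * bary T c x)"
proof -
  have S: "{(a, b). a \<in> T \<and> b \<in> T \<and> a \<noteq> b} = {(a, b), (b, a), (a, c), (c, a), (b, c), (c, b)}"
    using T by auto
  have s: "(\<Sum>u\<in>T. f u) = f a + f b + f c" "(\<Prod>u\<in>T. f u) = f a * f b * f c" for f :: "pt \<Rightarrow> real"
    using T by (simp_all add: add.assoc mult.assoc)
  show ?thesis
    unfolding interpolant_def S s using T(2-4) by simp
qed

lemma poly2_interpolant:
  assumes T: "T \<in> Th"
  shows "poly2 3 (interpolant v T)"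
proof -
  obtain a b c where abc: "T = {a, b, c}" "a \<noteq> b" "a \<noteq> c" "b \<noteq> c"
    by (rule is_triangle_vertices[OF tri[OF T]])
  have l: "poly2 1 (bary T u)" if "u \<in> T" for u by (rule poly2_bary[OF tri[OF T] that])
  have l': "poly2 1 (\<lambda>x. 3 * bary T u x - k)" if "u \<in> T" for u k
    by (intro poly2_diff poly2_cmult poly2_const l that)
  have cub: "poly2 3 (\<lambda>x. k * f x * g x * h x)" if "poly2 1 f" "poly2 1 g" "poly2 1 h" for f g h k
    using poly2_mult[OF poly2_mult[OF poly2_cmult[OF that(1), of k] that(2)] that(3)] by (simp add: numeral_3_eq_3)
  have cub': "poly2 3 (\<lambda>x. f x * g x * h x)" if "poly2 1 f" "poly2 1 g" "poly2 1 h" for f g h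
    using cub[OF that, of 1] by simp
  have abc': "a \<in> T" "b \<in> T" "c \<in> T" using abc by auto
  show ?thesis
    unfolding interpolant_triangle[OF abc, abs_def]
    by (rule poly2_add poly2_cmult cub cub' l l' abc')+
qed

text \<open>The restriction to an edge involves only the four nodal values on that edge. Hence the
  interpolants of neighbours agree on it, and they vanish on boundary edges when those values
  do.\<close>

lemma interpolant_edge:
  assumes T: "T \<in> Th" "{a, b} \<subseteq> T" "a \<noteq> b"
  shows "interpolant v T ((1 - s) *\<^sub>R a + s *\<^sub>R b) =
     v (Inl a) * (1/2 * (1 - s) * (3 * (1 - s) - 1) * (3 * (1 - s) - 2)) + v (Inl b) * (1/2 * s * (3 * s - 1) * (3 * s - 2))
   + v (Inr (Inl (a, b))) * (9/2 * (1 - s) * s * (3 * (1 - s) - 1)) + v (Inr (Inl (b, a))) * (9/2 * s * (1 - s) * (3 * s - 1))"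
proof -
  obtain c where c: "T = {a, b, c}" "c \<noteq> a" "c \<noteq> b" by (rule third_vertex[OF T])
  have m: "a \<in> T" "b \<in> T" "c \<in> T" using c by auto
  have "bary T a ((1 - s) *\<^sub>R a + s *\<^sub>R b) = 1 - s" "bary T b ((1 - s) *\<^sub>R a + s *\<^sub>R b) = s"
    "bary T c ((1 - s) *\<^sub>R a + s *\<^sub>R b) = 0"
    using c(2,3) T(3) m by (simp_all add: bary_comb[OF tri[OF T(1)]] bary_vertex[OF tri[OF T(1)]])
  then show ?thesis using interpolant_triangle[OF c(1) T(3) c(2)[symmetric] c(3)[symmetric], of v "(1 - s) *\<^sub>R a + s *\<^sub>R b"]
    by simp
qed

lemma interpolant_vertex:
  assumes T: "T \<in> Th" "a \<in> T"
  shows "interpolant v T a = v (Inl a)"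
proof -
  obtain b c where "T = {a, b, c}" "a \<noteq> b" by (rule is_triangleE[OF tri[OF T(1)] T(2)])
  then show ?thesis using interpolant_edge[of T a b v 0] T by simp
qed

lemma interpolant_centre:
  assumes T: "T \<in> Th"
  shows "interpolant v T (\<Sum>a\<in>T. (1/3) *\<^sub>R a) = v (Inr (Inr T))"
proof -
  obtain a b c where abc: "T = {a, b, c}" "a \<noteq> b" "a \<noteq> c" "b \<noteq> c"
    by (rule is_triangle_vertices[OF tri[OF T]])
  have abc': "a \<in> T" "b \<in> T" "c \<in> T" using abc by auto
  define m where "m = (\<Sum>a\<in>T. (1/3) *\<^sub>R a)"
  have "m = (1/3) *\<^sub>R a + (1/3) *\<^sub>R b + (1/3) *\<^sub>R c"
    unfolding m_def using abc by (simp add: add.assoc)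
  also have "\<dots> = (1 - 1/3) *\<^sub>R ((1 - 1/2) *\<^sub>R a + (1/2) *\<^sub>R b) + (1/3) *\<^sub>R c" by (simp add: algebra_simps)
  finally have "bary T u m = (1 - 1/3) * ((1 - 1/2) * bary T u a + (1/2) * bary T u b) + (1/3) * bary T u c" if "u \<in> T" for u
    using bary_comb[OF tri[OF T] that] by metis
  then have bm: "bary T a m = 1/3" "bary T b m = 1/3" "bary T c m = 1/3"
    using abc(2-4) abc' by (simp_all add: bary_vertex[OF tri[OF T]])
  show ?thesis unfolding m_def[symmetric] interpolant_triangle[OF abc] bm by simp
qed

lemma eval_nodes_surj:
  assumes v: "v \<in> supported nodes"
  shows "\<exists>f\<in>P3. eval_nodes f = v"
proof -
  have b1: "v (Inl a) = 0" if "a \<notin> \<Omega>" for a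
    using that by (intro supportedD[OF v]) (auto simp: nodes_def interior_vertices_def)
  have b2: "v (Inr (Inl (a, b))) = 0" if "{a, b} \<notin> interior_edges Th" for a b
    using that by (intro supportedD[OF v]) (auto simp: nodes_def directed_edges_def)
  obtain f where f: "continuous_on UNIV f" "\<And>T x. T \<in> Th \<Longrightarrow> x \<in> convex hull T \<Longrightarrow> f x = interpolant v T x"
    "\<And>x. x \<notin> \<Omega> \<Longrightarrow> f x = 0"
  proof (rule glue[of "interpolant v" 0])
    show "continuous_on (convex hull T) (interpolant v T)" if "T \<in> Th" for T
      by (rule poly2_continuous_on[OF poly2_interpolant[OF that]])
    show "interpolant v T u = interpolant v T' u" if "T \<in> Th" "T' \<in> Th" "u \<in> T" "u \<in> T'" for T T' u
      using that by (simp add: interpolant_vertex)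
    show "interpolant v T u = 0" if "T \<in> Th" "u \<in> T" "u \<notin> \<Omega>" for T u
      using that b1 by (simp add: interpolant_vertex)
    fix T T' a b x
    assume T: "T \<in> Th" "a \<noteq> b" "{a, b} \<subseteq> T" and x: "x \<in> open_segment a b"
    obtain s where s: "x = (1 - s) *\<^sub>R a + s *\<^sub>R b" using x by (auto simp: in_segment)
    show "interpolant v T x = interpolant v T' x" if "T' \<in> Th" "{a, b} \<subseteq> T'"
      unfolding s interpolant_edge[OF T(1,3,2)] interpolant_edge[OF that T(2)] ..
    show "interpolant v T x = 0" if "{a, b} \<notin> interior_edges Th"
    proof -
      have "{a, b} \<in> edges Th" by (rule edgesI[OF T(1,3,2)])
      moreover have "a \<in> closed_segment a b" "b \<in> closed_segment a b" by auto
      ultimately have "a \<notin> \<Omega>" "b \<notin> \<Omega>" using boundary_edge_closed_segment that by blast+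
      then show ?thesis
        unfolding s interpolant_edge[OF T(1,3,2)] using b1 b2 that by (simp add: insert_commute)
    qed
  qed blast
  have "f \<in> P3"
    unfolding P3_def using f poly2_interpolant by blast
  moreover have "eval_nodes f i = v i" for i
  proof (cases "i \<in> nodes")
    case True
    then consider a where "i = Inl a" "a \<in> interior_vertices Th"
      | a b where "i = Inr (Inl (a, b))" "{a, b} \<in> interior_edges Th"
      | T where "i = Inr (Inr T)" "T \<in> Th"
      by (auto simp: nodes_def directed_edges_def)
    then have "f (node_pt i) = v i"
    proof cases
      case (1 a)
      then obtain T where T: "T \<in> Th" "a \<in> T" unfolding interior_vertices_def vertices_def by blast
      then show ?thesis using f(2)[OF T(1) hull_inc[OF T(2)]] 1 by (simp add: node_pt_def interpolant_vertex)
    next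
      case (2 a b)
      then obtain T where T: "T \<in> Th" "{a, b} \<subseteq> T" unfolding interior_edges_def edges_def by blast
      have e: "(1 - 1/3) *\<^sub>R a + (1/3) *\<^sub>R b \<in> closed_segment a b" unfolding in_segment by (rule exI[of _ "1/3"]) simp
      have "f ((1 - 1/3) *\<^sub>R a + (1/3) *\<^sub>R b) = interpolant v T ((1 - 1/3) *\<^sub>R a + (1/3) *\<^sub>R b)"
        using f(2)[OF T(1)] closed_segment_in_hull[OF T(2)] e by blast
      also have "\<dots> = v i" unfolding interpolant_edge[OF T interior_edge_neq[OF 2(2)]] 2 by simp
      finally show ?thesis using 2 by (simp add: node_pt_def)
    next
      case (3 T)
      have "(\<Sum>a\<in>T. (1/3) *\<^sub>R a) \<in> convex hull T"
        using card_T[OF 3(2)] finite_T[OF 3(2)] by (auto simp: convex_hull_finite intro!: exI[of _ "\<lambda>_. 1/3"])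
      from f(2)[OF 3(2) this] show ?thesis using 3 interpolant_centre[OF 3(2)] by (simp add: node_pt_def)
    qed
    then show ?thesis using True by (simp add: eval_nodes_def)
  next
    case False
    then show ?thesis using supportedD[OF v] by (simp add: eval_nodes_def)
  qed
  ultimately show ?thesis by blast
qed

text \<open>A vector field is encoded as one real function on \<open>bool \<times> pt\<close>: the value at
  \<open>(True, x)\<close> is its first component at \<open>x\<close>, the value at \<open>(False, x)\<close> its second.\<close>

definition fields :: "(bool \<times> pt \<Rightarrow> real) set" where
  "fields = {U. (\<lambda>x. U (True, x)) \<in> P3 \<and> (\<lambda>x. U (False, x)) \<in> P3}"

lemma subspace_fields: "fs.subspace fields"
proof -
  have "0 \<in> fields" using fs.subspace_0[OF subspace_P3] by (simp add: fields_def zero_fun_def)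
  moreover have "U + W \<in> fields" if "U \<in> fields" "W \<in> fields" for U W
    using that fs.subspace_add[OF subspace_P3] by (simp add: fields_def plus_fun_def)
  moreover have "(\<lambda>x. c * U x) \<in> fields" if "U \<in> fields" for U c
    using that fs.subspace_scale[OF subspace_P3] by (simp add: fields_def)
  ultimately show ?thesis unfolding fs.subspace_def by blast
qed

definition eval_fields :: "(bool \<times> pt \<Rightarrow> real) \<Rightarrow> bool \<times> node \<Rightarrow> real" where
  "eval_fields U = (\<lambda>(s, i). eval_nodes (\<lambda>x. U (s, x)) i)"

lemma eval_fields_linear:
  "eval_fields (U + W) = eval_fields U + eval_fields W"
  "eval_fields (\<lambda>x. c * U x) = (\<lambda>i. c * eval_fields U i)"
  by (auto simp: eval_fields_def eval_nodes_def fun_eq_iff)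

lemma inj_eval_fields: "inj_on eval_fields fields"
proof (rule inj_onI)
  fix U W assume U: "U \<in> fields" "W \<in> fields" "eval_fields U = eval_fields W"
  have "(\<lambda>x. U (s, x)) = (\<lambda>x. W (s, x))" for s
  proof (rule inj_onD[OF inj_eval_nodes])
    show "eval_nodes (\<lambda>x. U (s, x)) = eval_nodes (\<lambda>x. W (s, x))"
    proof
      fix i show "eval_nodes (\<lambda>x. U (s, x)) i = eval_nodes (\<lambda>x. W (s, x)) i"
        using fun_cong[OF U(3), of "(s, i)"] by (simp add: eval_fields_def)
    qed
    show "(\<lambda>x. U (s, x)) \<in> P3" "(\<lambda>x. W (s, x)) \<in> P3"
      using U(1,2) by (cases s; simp add: fields_def)+
  qed
  then show "U = W" by (simp add: fun_eq_iff)
qed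

lemma image_eval_fields: "eval_fields ` fields = supported (UNIV \<times> nodes)"
proof
  show "eval_fields ` fields \<subseteq> supported (UNIV \<times> nodes)"
    by (auto simp: eval_fields_def eval_nodes_def supported_def)
  show "supported (UNIV \<times> nodes) \<subseteq> eval_fields ` fields"
  proof
    fix v :: "bool \<times> node \<Rightarrow> real" assume v: "v \<in> supported (UNIV \<times> nodes)"
    have "(\<lambda>i. v (s, i)) \<in> supported nodes" for s
      using supportedD[OF v] by (simp add: supported_def)
    then have "\<forall>s. \<exists>f. f \<in> P3 \<and> eval_nodes f = (\<lambda>i. v (s, i))"
      using eval_nodes_surj by blast
    from choice[OF this] obtain f where f: "\<And>s. f s \<in> P3" "\<And>s. eval_nodes (f s) = (\<lambda>i. v (s, i))"
      by blast
    show "v \<in> eval_fields ` fields"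
    proof (rule image_eqI)
      show "(\<lambda>(s, x). f s x) \<in> fields" using f(1) by (simp add: fields_def)
      show "v = eval_fields (\<lambda>(s, x). f s x)" using f(2) by (auto simp: eval_fields_def fun_eq_iff)
    qed
  qed
qed

lemma dim_fields: "fs.dim fields = 2 * (card (interior_vertices Th) + 2 * card (interior_edges Th) + card Th)"
proof -
  have "fs.dim (eval_fields ` fields) = fs.dim fields"
    by (rule fsp.dim_image_inj_on[OF subspace_fields _ _ inj_eval_fields]) (simp_all add: eval_fields_linear)
  moreover have "fs.dim (supported (UNIV \<times> nodes :: (bool \<times> node) set)) = 2 * card nodes"
    using dim_supported[of "UNIV \<times> nodes :: (bool \<times> node) set"] finite_nodes by (simp add: card_cartesian_product)
  ultimately show ?thesis by (simp add: image_eval_fields card_nodes)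
qed

end

section \<open>The kernel of the divergence\<close>

abbreviation (input) pwscale :: "real \<Rightarrow> (pt set \<Rightarrow> pt \<Rightarrow> real) \<Rightarrow> pt set \<Rightarrow> pt \<Rightarrow> real" where
  "pwscale \<equiv> \<lambda>c q T x. c * q T x"

interpretation pw: vector_space pwscale
  by unfold_locales (simp_all add: fun_eq_iff distrib_left distrib_right)

interpretation fspw: vector_space_pair "fscale :: real \<Rightarrow> ('a \<Rightarrow> real) \<Rightarrow> 'a \<Rightarrow> real" pwscale
  by unfold_locales

lemma dx_dy_cong_open:
  assumes S: "open S" "x \<in> S" and eq: "\<And>y. y \<in> S \<Longrightarrow> f y = g y" and g: "g differentiable (at x)"
  shows "dx f x = dx g x" "dy f x = dy g x"
proof -
  have "(f has_derivative (\<lambda>h. dx g x * fst h + dy g x * snd h)) (at x)"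
    by (rule has_derivative_transform_within_open[OF has_derivative_dx_dy[OF g] S]) (simp add: eq)
  from dx_eqI[OF this] dy_eqI[OF this] show "dx f x = dx g x" "dy f x = dy g x" by simp_all
qed

lemma dx_dy_linear:
  assumes f: "f differentiable (at x)" and g: "g differentiable (at x)"
  shows "dx (\<lambda>z. f z + g z) x = dx f x + dx g x" "dy (\<lambda>z. f z + g z) x = dy f x + dy g x"
    "dx (\<lambda>z. c * f z) x = c * dx f x" "dy (\<lambda>z. c * f z) x = c * dy f x"
proof -
  note D = has_derivative_add[OF has_derivative_dx_dy[OF f] has_derivative_dx_dy[OF g]]
  show "dx (\<lambda>z. f z + g z) x = dx f x + dx g x" using dx_eqI[OF D] by simp
  show "dy (\<lambda>z. f z + g z) x = dy f x + dy g x" using dy_eqI[OF D] by simp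
  note M = has_derivative_mult_right[OF has_derivative_dx_dy[OF f], of c]
  show "dx (\<lambda>z. c * f z) x = c * dx f x" using dx_eqI[OF M] by simp
  show "dy (\<lambda>z. c * f z) x = c * dy f x" using dy_eqI[OF M] by simp
qed

text \<open>Used to differentiate a glued function at vertices and edges, where the derivative is
  known only within each closed piece.\<close>

lemma has_derivative_finite_cover:
  assumes "finite I" "bounded_linear D"
    and "\<And>i. i \<in> I \<Longrightarrow> (f has_derivative D) (at x within K i)"
  shows "(f has_derivative D) (at x within (\<Union>i\<in>I. K i))"
  using assms(1,3)
proof (induction I)
  case empty
  show ?case using assms(2) unfolding has_derivative_within by simp
next
  case (insert i I)
  have "(\<Union>i\<in>insert i I. K i) = K i \<union> (\<Union>i\<in>I. K i)" by simp
  moreover have "(f has_derivative D) (at x within K i \<union> (\<Union>i\<in>I. K i))"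
  proof -
    have 1: "(f has_derivative D) (at x within K i)" and 2: "(f has_derivative D) (at x within (\<Union>i\<in>I. K i))"
      using insert by auto
    show ?thesis
      unfolding has_derivative_within unfolding at_within_union
      by (rule conjI[OF assms(2) filterlim_sup[OF conjunct2[OF 1[unfolded has_derivative_within]]
              conjunct2[OF 2[unfolded has_derivative_within]]]])
  qed
  ultimately show ?case by simp
qed

lemma poly2_const_on_segment:
  assumes p: "poly2 k p" and z: "\<And>x. x \<in> closed_segment a b \<Longrightarrow> dx p x = 0 \<and> dy p x = 0"
    and x: "x \<in> closed_segment a b"
  shows "p x = p a"
proof -
  have "\<exists>c. \<forall>x\<in>closed_segment a b. p x = c"
  proof (rule has_derivative_zero_constant[OF convex_closed_segment])
    fix x assume x: "x \<in> closed_segment a b"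
    have "(p has_derivative (\<lambda>h. dx p x * fst h + dy p x * snd h)) (at x within closed_segment a b)"
      using poly2_has_derivative[OF p] by (rule has_derivative_at_withinI)
    then show "(p has_derivative (\<lambda>h. 0)) (at x within closed_segment a b)" using z[OF x] by simp
  qed
  then show ?thesis using x by (metis ends_in_segment(1))
qed

context triangulation
begin

text \<open>A polynomial is determined by its values on a triangle, so the choice is unique whenever
  a piece exists.\<close>

definition piece :: "nat \<Rightarrow> pt set \<Rightarrow> (pt \<Rightarrow> real) \<Rightarrow> pt \<Rightarrow> real" where
  "piece k T f = (SOME p. poly2 k p \<and> (\<forall>x\<in>convex hull T. f x = p x))"

lemma piece_eqI:
  assumes T: "T \<in> Th" and p: "poly2 k p" "\<And>x. x \<in> convex hull T \<Longrightarrow> f x = p x"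
  shows "piece k T f = p"
proof -
  have a: "poly2 k (piece k T f) \<and> (\<forall>x\<in>convex hull T. f x = piece k T f x)"
    unfolding piece_def by (rule someI[of _ p]) (use p in blast)
  show ?thesis
    by (rule poly2_eq_on_hull[OF tri[OF T] conjunct1[OF a] p(1)]) (use a p(2) in metis)
qed

definition divergence :: "(bool \<times> pt \<Rightarrow> real) \<Rightarrow> pt set \<Rightarrow> pt \<Rightarrow> real" where
  "divergence U T = (if T \<in> Th
     then \<lambda>x. dx (piece 3 T (\<lambda>x. U (True, x))) x + dy (piece 3 T (\<lambda>x. U (False, x))) x
     else (\<lambda>x. 0))"

lemma fields_pieces:
  assumes U: "U \<in> fields" and T: "T \<in> Th"
  obtains p1 p2 where "poly2 3 p1" "poly2 3 p2" "\<forall>x\<in>convex hull T. U (True, x) = p1 x"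
    "\<forall>x\<in>convex hull T. U (False, x) = p2 x" "divergence U T = (\<lambda>x. dx p1 x + dy p2 x)"
proof -
  have "(\<lambda>x. U (True, x)) \<in> P3" "(\<lambda>x. U (False, x)) \<in> P3" using U by (simp_all add: fields_def)
  from P3D(3)[OF this(1) T] P3D(3)[OF this(2) T]
  obtain p1 p2 where p: "poly2 3 p1" "poly2 3 p2" "\<forall>x\<in>convex hull T. U (True, x) = p1 x"
    "\<forall>x\<in>convex hull T. U (False, x) = p2 x"
    by blast
  moreover have "divergence U T = (\<lambda>x. dx p1 x + dy p2 x)"
    using T piece_eqI[OF T p(1), of "\<lambda>x. U (True, x)"] piece_eqI[OF T p(2), of "\<lambda>x. U (False, x)"] p(3,4)
    by (simp add: divergence_def)
  ultimately show ?thesis using that by blast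
qed

lemma fields_zero: "U \<in> fields \<Longrightarrow> x \<notin> \<Omega> \<Longrightarrow> U (s, x) = 0"
  using P3D(2)[of "\<lambda>x. U (True, x)" x] P3D(2)[of "\<lambda>x. U (False, x)" x]
  by (cases s) (simp_all add: fields_def)

lemma divergence_linear:
  assumes U: "U \<in> fields" and W: "W \<in> fields"
  shows "divergence (U + W) = divergence U + divergence W"
    "divergence (\<lambda>x. c * U x) = (\<lambda>T x. c * divergence U T x)"
proof -
  have "divergence (U + W) T = divergence U T + divergence W T \<and>
      divergence (\<lambda>x. c * U x) T = (\<lambda>x. c * divergence U T x)" if T: "T \<in> Th" for T
  proof -
    obtain p1 p2 where p: "poly2 3 p1" "poly2 3 p2" "\<forall>x\<in>convex hull T. U (True, x) = p1 x"
      "\<forall>x\<in>convex hull T. U (False, x) = p2 x" "divergence U T = (\<lambda>x. dx p1 x + dy p2 x)"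
      by (rule fields_pieces[OF U T])
    obtain q1 q2 where q: "poly2 3 q1" "poly2 3 q2" "\<forall>x\<in>convex hull T. W (True, x) = q1 x"
      "\<forall>x\<in>convex hull T. W (False, x) = q2 x" "divergence W T = (\<lambda>x. dx q1 x + dy q2 x)"
      by (rule fields_pieces[OF W T])
    have "piece 3 T (\<lambda>x. (U + W) (True, x)) = (\<lambda>x. p1 x + q1 x)"
      "piece 3 T (\<lambda>x. (U + W) (False, x)) = (\<lambda>x. p2 x + q2 x)"
      "piece 3 T (\<lambda>x. c * U (True, x)) = (\<lambda>x. c * p1 x)"
      "piece 3 T (\<lambda>x. c * U (False, x)) = (\<lambda>x. c * p2 x)"
      by (rule piece_eqI[OF T]; simp add: poly2_add poly2_cmult p q)+
    then have "divergence (U + W) T = (\<lambda>x. dx p1 x + dx q1 x + (dy p2 x + dy q2 x))"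
      "divergence (\<lambda>x. c * U x) T = (\<lambda>x. c * dx p1 x + c * dy p2 x)"
      using T by (simp_all add: divergence_def dx_add[OF p(1) q(1)] dy_add[OF p(2) q(2)]
          dx_cmult[OF p(1)] dy_cmult[OF p(2)])
    then show ?thesis unfolding p(5) q(5) by (simp add: fun_eq_iff distrib_left)
  qed
  then show "divergence (U + W) = divergence U + divergence W"
    "divergence (\<lambda>x. c * U x) = (\<lambda>T x. c * divergence U T x)"
    by (auto simp: fun_eq_iff divergence_def)
qed

lemma image_divergence: "divergence ` fields = div_Vh3 Th"
proof
  show "divergence ` fields \<subseteq> div_Vh3 Th"
  proof
    fix q assume "q \<in> divergence ` fields"
    then obtain U where U: "U \<in> fields" and q: "q = divergence U" by blast
    define u where "u = (\<lambda>x. (U (True, x), U (False, x)))"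
    have c: "continuous_on UNIV (\<lambda>x. U (True, x))" "continuous_on UNIV (\<lambda>x. U (False, x))"
      using U P3D(1) by (auto simp: fields_def)
    have pc: "\<exists>p1 p2. poly2 3 p1 \<and> poly2 3 p2 \<and> (\<forall>x\<in>convex hull T. u x = (p1 x, p2 x)) \<and> q T = (\<lambda>x. dx p1 x + dy p2 x)"
      if T: "T \<in> Th" for T
    proof -
      obtain p1 p2 where p: "poly2 3 p1" "poly2 3 p2" "\<forall>x\<in>convex hull T. U (True, x) = p1 x"
        "\<forall>x\<in>convex hull T. U (False, x) = p2 x" "divergence U T = (\<lambda>x. dx p1 x + dy p2 x)"
        by (rule fields_pieces[OF U T])
      show ?thesis unfolding q u_def p(5)
        by (rule exI[of _ p1], rule exI[of _ p2]) (simp add: p(1-4))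
    qed
    have "u \<in> Vh3 Th"
      unfolding Vh3_def
    proof (intro CollectI conjI ballI allI impI)
      show "continuous_on UNIV u" unfolding u_def by (intro continuous_on_Pair c)
      show "u x = 0" if "x \<notin> \<Omega>" for x using fields_zero[OF U that] by (simp add: u_def zero_prod_def)
    qed (use pc in blast)
    then show "q \<in> div_Vh3 Th"
      unfolding div_Vh3_def using pc by (auto simp: q divergence_def)
  qed
  show "div_Vh3 Th \<subseteq> divergence ` fields"
  proof
    fix q assume q: "q \<in> div_Vh3 Th"
    then obtain u where u: "u \<in> Vh3 Th" and pc: "\<And>T. T \<in> Th \<Longrightarrow> \<exists>p1 p2. poly2 3 p1 \<and> poly2 3 p2 \<and>
        (\<forall>x\<in>convex hull T. u x = (p1 x, p2 x)) \<and> q T = (\<lambda>x. dx p1 x + dy p2 x)"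
      and off: "\<And>T. T \<notin> Th \<Longrightarrow> q T = (\<lambda>x. 0)"
      unfolding div_Vh3_def by blast
    define U where "U = (\<lambda>(s, x). if s then fst (u x) else snd (u x))"
    have cu: "continuous_on UNIV u" and zu: "\<And>x. x \<notin> \<Omega> \<Longrightarrow> u x = 0"
      using u by (auto simp: Vh3_def)
    have "(\<lambda>x. fst (u x)) \<in> P3" "(\<lambda>x. snd (u x)) \<in> P3"
      unfolding P3_def
    proof (safe)
      show "continuous_on UNIV (\<lambda>x. fst (u x))" "continuous_on UNIV (\<lambda>x. snd (u x))"
        by (rule continuous_on_fst[OF cu], rule continuous_on_snd[OF cu])
      show "fst (u x) = 0" "snd (u x) = 0" if "x \<notin> \<Omega>" for x using zu[OF that] by auto
      fix T assume T: "T \<in> Th"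
      obtain p1 p2 where p: "poly2 3 p1" "poly2 3 p2" "\<forall>x\<in>convex hull T. u x = (p1 x, p2 x)"
        using pc[OF T] by blast
      show "\<exists>p. poly2 3 p \<and> (\<forall>x\<in>convex hull T. fst (u x) = p x)"
        by (rule exI[of _ p1]) (use p in auto)
      show "\<exists>p. poly2 3 p \<and> (\<forall>x\<in>convex hull T. snd (u x) = p x)"
        by (rule exI[of _ p2]) (use p in auto)
    qed
    then have "U \<in> fields" by (simp add: U_def fields_def)
    moreover have "divergence U T = q T" for T
    proof (cases "T \<in> Th")
      case True
      obtain p1 p2 where p: "poly2 3 p1" "poly2 3 p2" "\<forall>x\<in>convex hull T. u x = (p1 x, p2 x)"
        "q T = (\<lambda>x. dx p1 x + dy p2 x)"
        using pc[OF True] by blast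
      have "piece 3 T (\<lambda>x. U (True, x)) = p1" "piece 3 T (\<lambda>x. U (False, x)) = p2"
        by (rule piece_eqI[OF True]; simp add: U_def p)+
      then show ?thesis using True p(4) by (simp add: divergence_def)
    qed (simp add: divergence_def off)
    ultimately show "q \<in> divergence ` fields" by (metis ext image_eqI)
  qed
qed

text \<open>The rotated gradient in the encoding of fields over \<open>bool \<times> pt\<close>;
  \<open>f\<close> is a stream function.\<close>

definition curl :: "(pt \<Rightarrow> real) \<Rightarrow> bool \<times> pt \<Rightarrow> real" where
  "curl f = (\<lambda>(s, x). if s then dy f x else - dx f x)"

lemma Sh4D:
  assumes "f \<in> Sh4 Th"
  shows "f differentiable (at x)" "continuous_on UNIV (dx f)" "continuous_on UNIV (dy f)"
    "x \<notin> \<Omega> \<Longrightarrow> f x = 0" "x \<in> frontier \<Omega> \<Longrightarrow> dx f x = 0" "x \<in> frontier \<Omega> \<Longrightarrow> dy f x = 0"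
    "T \<in> Th \<Longrightarrow> \<exists>p. poly2 4 p \<and> (\<forall>x\<in>convex hull T. f x = p x)"
  using assms unfolding Sh4_def by blast+

lemma subspace_Sh4: "fs.subspace (Sh4 Th)"
  unfolding fs.subspace_def
proof (intro conjI ballI allI)
  show "0 \<in> Sh4 Th" unfolding Sh4_def by (auto simp: zero_fun_def intro: exI[of _ "\<lambda>_. 0"])
next
  fix f g assume f: "f \<in> Sh4 Th" and g: "g \<in> Sh4 Th"
  have D: "dx (f + g) = (\<lambda>x. dx f x + dx g x)" "dy (f + g) = (\<lambda>x. dy f x + dy g x)"
    unfolding plus_fun_def using dx_dy_linear(1,2)[OF Sh4D(1)[OF f] Sh4D(1)[OF g]] by auto
  show "f + g \<in> Sh4 Th"
    unfolding Sh4_def mem_Collect_eq D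
  proof (intro conjI ballI allI impI)
    show "(f + g) differentiable (at x)" for x
      unfolding plus_fun_def by (intro differentiable_add Sh4D(1) f g)
    show "continuous_on UNIV (\<lambda>x. dx f x + dx g x)" "continuous_on UNIV (\<lambda>x. dy f x + dy g x)"
      by (intro continuous_on_add Sh4D f g)+
    show "(f + g) x = 0" if "x \<notin> \<Omega>" for x using Sh4D(4)[OF f that] Sh4D(4)[OF g that] by simp
    show "dx f x + dx g x = 0" "dy f x + dy g x = 0" if "x \<in> frontier \<Omega>" for x
      using Sh4D(5,6)[OF f that] Sh4D(5,6)[OF g that] by simp_all
    fix T assume T: "T \<in> Th"
    obtain p q where "poly2 4 p" "\<forall>x\<in>convex hull T. f x = p x" "poly2 4 q" "\<forall>x\<in>convex hull T. g x = q x"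
      using Sh4D(7)[OF f T] Sh4D(7)[OF g T] by blast
    then show "\<exists>p. poly2 4 p \<and> (\<forall>x\<in>convex hull T. (f + g) x = p x)"
      by (intro exI[of _ "\<lambda>z. p z + q z"]) (simp add: poly2_add)
  qed
next
  fix c f assume f: "f \<in> Sh4 Th"
  have D: "dx (\<lambda>x. c * f x) = (\<lambda>x. c * dx f x)" "dy (\<lambda>x. c * f x) = (\<lambda>x. c * dy f x)"
    using dx_dy_linear(3,4)[OF Sh4D(1)[OF f] Sh4D(1)[OF f]] by auto
  show "(\<lambda>x. c * f x) \<in> Sh4 Th"
    unfolding Sh4_def mem_Collect_eq D
  proof (intro conjI ballI allI impI)
    show "(\<lambda>x. c * f x) differentiable (at x)" for x
      by (intro differentiable_mult differentiable_const Sh4D(1) f)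
    show "continuous_on UNIV (\<lambda>x. c * dx f x)" "continuous_on UNIV (\<lambda>x. c * dy f x)"
      by (intro continuous_on_mult_left Sh4D f)+
    show "c * f x = 0" if "x \<notin> \<Omega>" for x using Sh4D(4)[OF f that] by simp
    show "c * dx f x = 0" "c * dy f x = 0" if "x \<in> frontier \<Omega>" for x
      using Sh4D(5,6)[OF f that] by simp_all
    fix T assume T: "T \<in> Th"
    obtain p where "poly2 4 p" "\<forall>x\<in>convex hull T. f x = p x"
      using Sh4D(7)[OF f T] by blast
    then show "\<exists>p. poly2 4 p \<and> (\<forall>x\<in>convex hull T. c * f x = p x)"
      by (intro exI[of _ "\<lambda>z. c * p z"]) (simp add: poly2_cmult)
  qed
qed

lemma curl_linear:
  assumes "f \<in> Sh4 Th" "g \<in> Sh4 Th"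
  shows "curl (f + g) = curl f + curl g" "curl (\<lambda>x. c * f x) = (\<lambda>x. c * curl f x)"
  using dx_dy_linear[OF Sh4D(1)[OF assms(1)] Sh4D(1)[OF assms(2)]]
  by (auto simp: curl_def fun_eq_iff plus_fun_def)

lemma inj_curl: "inj_on curl (Sh4 Th)"
proof (rule inj_onI)
  fix f g assume f: "f \<in> Sh4 Th" and g: "g \<in> Sh4 Th" and eq: "curl f = curl g"
  have D: "dx f x = dx g x" "dy f x = dy g x" for x
    using fun_cong[OF eq, of "(True, x)"] fun_cong[OF eq, of "(False, x)"] by (simp_all add: curl_def)
  have "\<exists>c. \<forall>x\<in>UNIV. f x - g x = c"
  proof (rule has_derivative_zero_constant[OF convex_UNIV])
    fix x
    show "((\<lambda>x. f x - g x) has_derivative (\<lambda>h. 0)) (at x within UNIV)"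
      using has_derivative_diff[OF has_derivative_dx_dy[OF Sh4D(1)[OF f]] has_derivative_dx_dy[OF Sh4D(1)[OF g]], of x]
      by (simp add: D)
  qed
  then obtain c where c: "\<And>x. f x - g x = c" by blast
  obtain p where "p \<notin> \<Omega>" using Compl_dom_nonempty by auto
  then have "c = 0" using c[of p] Sh4D(4)[OF f] Sh4D(4)[OF g] by simp
  then show "f = g" using c by (simp add: fun_eq_iff)
qed

text \<open>The gradients agree on the open triangle and both are continuous, so they agree on its
  closure. This makes the derivatives of a \<open>Sh4\<close> function piecewise cubic up to the
  edges.\<close>

lemma Sh4_piece_derivatives:
  assumes f: "f \<in> Sh4 Th" and T: "T \<in> Th" and p: "poly2 4 p" "\<And>x. x \<in> convex hull T \<Longrightarrow> f x = p x"
    and x: "x \<in> convex hull T"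
  shows "dx f x = dx p x" "dy f x = dy p x"
proof -
  let ?I = "interior (convex hull T)"
  have i: "dx f y = dx p y" "dy f y = dy p y" if "y \<in> ?I" for y
    using dx_dy_cong_open[OF open_interior that, of f p] p interior_subset[of "convex hull T"]
      poly2_differentiable[OF p(1)] by blast+
  have "closed {y. dx f y = dx p y}" "closed {y. dy f y = dy p y}"
    by (intro closed_Collect_eq Sh4D f poly2_continuous_on[OF poly2_dx[OF p(1)]] poly2_continuous_on[OF poly2_dy[OF p(1)]])+
  moreover have "?I \<subseteq> {y. dx f y = dx p y}" "?I \<subseteq> {y. dy f y = dy p y}" using i by blast+
  ultimately have "closure ?I \<subseteq> {y. dx f y = dx p y}" "closure ?I \<subseteq> {y. dy f y = dy p y}"
    by (simp_all add: closure_minimal)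
  then show "dx f x = dx p x" "dy f x = dy p x"
    using x closure_interior_convex_hull[OF tri[OF T]] by blast+
qed

lemma Sh4_derivatives_outside:
  assumes f: "f \<in> Sh4 Th" and x: "x \<notin> \<Omega>"
  shows "dx f x = 0" "dy f x = 0"
proof -
  have "dx f x = 0 \<and> dy f x = 0"
  proof (cases "x \<in> frontier \<Omega>")
    case True
    then show ?thesis using Sh4D(5,6)[OF f] by blast
  next
    case False
    then have "x \<in> - closure \<Omega>" using x by (simp add: frontier_dom)
    moreover have "open (- closure \<Omega>)" by auto
    moreover have "f y = 0" if "y \<in> - closure \<Omega>" for y using that closure_subset Sh4D(4)[OF f] by blast
    ultimately show ?thesis using dx_dy_cong_open[of "- closure \<Omega>" x f "\<lambda>_. 0"] by simp
  qed
  then show "dx f x = 0" "dy f x = 0" by auto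
qed

lemma curl_in_kernel:
  assumes f: "f \<in> Sh4 Th"
  shows "curl f \<in> fields" "divergence (curl f) = 0"
proof -
  have pc: "\<exists>p. poly2 4 p \<and> (\<forall>x\<in>convex hull T. dy f x = dy p x \<and> dx f x = dx p x)" if T: "T \<in> Th" for T
    using Sh4D(7)[OF f T] Sh4_piece_derivatives[OF f T] by metis
  have d: "poly2 3 (dy p)" "poly2 3 (\<lambda>x. - dx p x)" if "poly2 4 p" for p
    using poly2_dy[OF that] poly2_uminus[OF poly2_dx[OF that]] by simp_all
  have "dy f \<in> P3"
    unfolding P3_def using Sh4D(3)[OF f] Sh4_derivatives_outside(2)[OF f] pc d(1) by blast
  moreover have "(\<lambda>x. - dx f x) \<in> P3"
    unfolding P3_def
  proof (intro CollectI conjI ballI allI impI)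
    show "continuous_on UNIV (\<lambda>x. - dx f x)" by (intro continuous_on_minus Sh4D f)
    show "- dx f x = 0" if "x \<notin> \<Omega>" for x using Sh4_derivatives_outside(1)[OF f that] by simp
    fix T assume "T \<in> Th"
    from pc[OF this] obtain p where p: "poly2 4 p" "\<forall>x\<in>convex hull T. dy f x = dy p x \<and> dx f x = dx p x" by blast
    then show "\<exists>p. poly2 3 p \<and> (\<forall>x\<in>convex hull T. - dx f x = p x)"
      by (intro exI[of _ "\<lambda>x. - dx p x"]) (simp add: d(2))
  qed
  ultimately show "curl f \<in> fields" by (simp add: fields_def curl_def)
  show "divergence (curl f) = 0"
  proof (rule ext)+
    fix T x show "divergence (curl f) T x = 0 T x"
    proof (cases "T \<in> Th")
      case True
      from pc[OF this] obtain p where p: "poly2 4 p" "\<forall>x\<in>convex hull T. dy f x = dy p x \<and> dx f x = dx p x" by blast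
      have "piece 3 T (\<lambda>x. curl f (True, x)) = dy p" "piece 3 T (\<lambda>x. curl f (False, x)) = (\<lambda>x. - dx p x)"
        by (rule piece_eqI[OF True]; simp add: curl_def d[OF p(1)] p(2))+
      then show ?thesis using True
        by (simp add: divergence_def dy_uminus[OF poly2_dx[OF p(1)]] dx_dy_commute[OF p(1)])
    qed (simp add: divergence_def)
  qed
qed

text \<open>The local quartic potentials of a divergence-free field differ by constants across interior
  edges and are constant on boundary edges, so their differences along edges form a closed edge
  function; a vertex potential of it makes the local potentials match.\<close>

lemma kernel_has_potential:
  assumes conn: "connected (- \<Omega>)" and U: "U \<in> fields" and div: "divergence U = 0"
  shows "\<exists>f\<in>Sh4 Th. curl f = U"
proof -
  have "\<exists>F. poly2 4 F \<and> (\<forall>x\<in>convex hull T. dy F x = U (True, x) \<and> dx F x = - U (False, x))" if T: "T \<in> Th" for T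
  proof -
    obtain p1 p2 where p: "poly2 3 p1" "poly2 3 p2" "\<forall>x\<in>convex hull T. U (True, x) = p1 x"
      "\<forall>x\<in>convex hull T. U (False, x) = p2 x" "divergence U T = (\<lambda>x. dx p1 x + dy p2 x)"
      by (rule fields_pieces[OF U T])
    have "dx p1 x + dy p2 x = 0" for x using fun_cong[OF p(5), of x] div by simp
    then obtain F where "poly2 (Suc 3) F" "dy F = p1" "dx F = (\<lambda>z. - p2 z)"
      by (rule divergence_free_potential[OF p(1,2)])
    moreover have "Suc 3 = 4" by simp
    ultimately show ?thesis using p by (intro exI[of _ F]) auto
  qed
  then obtain F where F: "\<And>T. T \<in> Th \<Longrightarrow> poly2 4 (F T)"
    "\<And>T x. T \<in> Th \<Longrightarrow> x \<in> convex hull T \<Longrightarrow> dy (F T) x = U (True, x)"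
    "\<And>T x. T \<in> Th \<Longrightarrow> x \<in> convex hull T \<Longrightarrow> dx (F T) x = - U (False, x)"
    by metis
  have edge: "F T x - F T' x = F T a - F T' a"
    if T: "T \<in> Th" "T' \<in> Th" "{a, b} \<subseteq> T" "{a, b} \<subseteq> T'" and x: "x \<in> closed_segment a b" for T T' a b x
  proof (rule poly2_const_on_segment[OF poly2_diff[OF F(1)[OF T(1)] F(1)[OF T(2)]] _ x])
    fix y assume "y \<in> closed_segment a b"
    then have "y \<in> convex hull T" "y \<in> convex hull T'" using closed_segment_in_hull T by blast+
    then show "dx (\<lambda>z. F T z - F T' z) y = 0 \<and> dy (\<lambda>z. F T z - F T' z) y = 0"
      unfolding dx_diff[OF F(1)[OF T(1)] F(1)[OF T(2)]] dy_diff[OF F(1)[OF T(1)] F(1)[OF T(2)]]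
      using F(2,3) T by simp
  qed
  have bedge: "F T x = F T a"
    if T: "T \<in> Th" "{a, b} \<subseteq> T" "a \<noteq> b" "{a, b} \<notin> interior_edges Th" and x: "x \<in> closed_segment a b" for T a b x
  proof (rule poly2_const_on_segment[OF F(1)[OF T(1)] _ x])
    fix y assume y: "y \<in> closed_segment a b"
    then have "y \<in> convex hull T" using closed_segment_in_hull T by blast
    moreover have "y \<notin> \<Omega>" using boundary_edge_closed_segment[OF edgesI[OF T(1-3)] T(4)] y by blast
    ultimately show "dx (F T) y = 0 \<and> dy (F T) y = 0"
      using F(2,3)[OF T(1)] fields_zero[OF U] by simp
  qed
  \<comment> \<open>One triangle is chosen for each edge. The increment along the edge is the same
    for either triangle, since their potentials differ by a constant on it.\<close>
  define S where "S = (\<lambda>e. SOME T. T \<in> Th \<and> e \<subseteq> T)"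
  have S: "S e \<in> Th" "e \<subseteq> S e" if "T \<in> Th" "e \<subseteq> T" for T e
    using someI[of "\<lambda>T. T \<in> Th \<and> e \<subseteq> T" T] that unfolding S_def by blast+
  define w where "w = (\<lambda>a b. if {a, b} \<in> edges Th then F (S {a, b}) b - F (S {a, b}) a else 0)"
  have w: "w a b = F T b - F T a" if T: "T \<in> Th" "a \<in> T" "b \<in> T" for T a b
  proof (cases "a = b")
    case True
    then show ?thesis by (simp add: w_def)
  next
    case False
    have ab: "{a, b} \<subseteq> T" using T by simp
    have "F T b - F (S {a, b}) b = F T a - F (S {a, b}) a"
      by (rule edge[OF T(1) S(1)[OF T(1) ab] ab S(2)[OF T(1) ab]]) simp
    then show ?thesis using edgesI[OF T(1) ab False] by (simp add: w_def)
  qed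
  obtain \<psi> where \<psi>: "\<And>v. v \<notin> \<Omega> \<Longrightarrow> \<psi> v = (0::real)"
    "\<And>T a b. T \<in> Th \<Longrightarrow> a \<in> T \<Longrightarrow> b \<in> T \<Longrightarrow> \<psi> b - \<psi> a = w a b"
  proof (rule closed_imp_exact[OF conn, of w])
    show "w b a = - w a b" for a b by (simp add: w_def insert_commute)
    show "w a b + w b c + w c a = 0" if T: "{a, b, c} \<in> Th" for a b c
      by (simp add: w[OF T])
    show "w a b = 0" if e: "{a, b} \<in> edges Th" "{a, b} \<notin> interior_edges Th" for a b
    proof -
      obtain T where T: "T \<in> Th" "{a, b} \<subseteq> T" using e(1) unfolding edges_def by blast
      show ?thesis
      proof (cases "a = b")
        case False
        have "F T b = F T a" by (rule bedge[OF T False e(2)]) simp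
        then show ?thesis using w[OF T(1)] T(2) by simp
      qed (simp add: w_def)
    qed
  qed blast
  define r where "r = (\<lambda>T. SOME a :: pt. a \<in> T)"
  have r: "r T \<in> T" if "T \<in> Th" for T
    unfolding r_def using card_T[OF that] by (metis card.empty ex_in_conv someI_ex zero_neq_numeral)
  \<comment> \<open>The constant is fixed at the base vertex \<open>r T\<close>. As
    \<open>\<psi>\<close> has the increments of \<open>F T\<close> on \<open>T\<close>, the shifted
    piece equals \<open>\<psi>\<close> at every vertex of \<open>T\<close>.\<close>
  define G where "G = (\<lambda>T x. F T x - (F T (r T) - \<psi> (r T)))"
  have G: "poly2 4 (G T)" "dx (G T) = dx (F T)" "dy (G T) = dy (F T)" if T: "T \<in> Th" for T
    unfolding G_def
    by (intro poly2_diff F T poly2_const)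
      (simp_all add: dx_diff[OF F(1)[OF T] poly2_const[of 0]] dy_diff[OF F(1)[OF T] poly2_const[of 0]])
  have Gv: "G T v = \<psi> v" if T: "T \<in> Th" "v \<in> T" for T v
    using \<psi>(2)[OF T(1) r[OF T(1)] T(2)] w[OF T(1) r[OF T(1)] T(2)] by (simp add: G_def)
  obtain f where f: "continuous_on UNIV f" "\<And>T x. T \<in> Th \<Longrightarrow> x \<in> convex hull T \<Longrightarrow> f x = G T x"
    "\<And>x. x \<notin> \<Omega> \<Longrightarrow> f x = 0"
  proof (rule glue[of G 0])
    show "continuous_on (convex hull T) (G T)" if "T \<in> Th" for T
      by (rule poly2_continuous_on[OF G(1)[OF that]])
    show "G T v = G T' v" if "T \<in> Th" "T' \<in> Th" "v \<in> T" "v \<in> T'" for T T' v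
      using that by (simp add: Gv)
    show "G T v = 0" if "T \<in> Th" "v \<in> T" "v \<notin> \<Omega>" for T v
      using that by (simp add: Gv \<psi>(1))
    fix T T' a b x
    assume T: "T \<in> Th" "a \<noteq> b" "{a, b} \<subseteq> T" and "x \<in> open_segment a b"
    then have x: "x \<in> closed_segment a b" using segment_open_subset_closed by blast
    show "G T x = G T' x" if T': "T' \<in> Th" "{a, b} \<subseteq> T'"
    proof -
      have "G T x - G T' x = G T a - G T' a"
        using edge[OF T(1) T'(1) T(3) T'(2) x] by (simp add: G_def)
      then show ?thesis using Gv[of T a] Gv[of T' a] T T' by simp
    qed
    show "G T x = 0" if ne: "{a, b} \<notin> interior_edges Th"
    proof -
      have "G T x = G T a" using bedge[OF T(1,3,2) ne x] by (simp add: G_def)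
      moreover have "a \<notin> \<Omega>"
        using boundary_edge_closed_segment[OF edgesI[OF T(1,3,2)] ne] ends_in_segment(1)[of a b] by blast
      ultimately show ?thesis using Gv[of T a] T \<psi>(1) by simp
    qed
  qed blast
  have D: "(f has_derivative (\<lambda>h. - U (False, x) * fst h + U (True, x) * snd h)) (at x)" for x
  proof -
    let ?D = "\<lambda>h. - U (False, x) * fst h + U (True, x) * snd h"
    define K where "K = (\<lambda>i. case i of None \<Rightarrow> - \<Omega> | Some T \<Rightarrow> convex hull T)"
    let ?I = "insert None (Some ` Th)"
    have bl: "bounded_linear ?D"
      by (intro bounded_linear_add bounded_linear_const_mult bounded_linear_fst bounded_linear_snd)
    have "(f has_derivative ?D) (at x within (\<Union>i\<in>?I. K i))"
    proof (rule has_derivative_finite_cover[OF _ bl])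
      show "finite ?I" using finite_Th by simp
      fix i assume i: "i \<in> ?I"
      show "(f has_derivative ?D) (at x within K i)"
      proof (cases "x \<in> K i")
        case True
        show ?thesis
        proof (cases i)
          case None
          then have x: "x \<in> - \<Omega>" using True by (simp add: K_def)
          have "((\<lambda>_. 0) has_derivative ?D) (at x within - \<Omega>)"
            using fields_zero[OF U, of x] x by simp
          then have "(f has_derivative ?D) (at x within - \<Omega>)"
            by (rule has_derivative_transform[OF x, rotated]) (use f(3) in auto)
          then show ?thesis by (simp add: K_def None)
        next
          case (Some T)
          then have T: "T \<in> Th" "x \<in> convex hull T" using i True by (auto simp: K_def)
          have "(G T has_derivative ?D) (at x within convex hull T)"
            using has_derivative_at_withinI[OF poly2_has_derivative[OF G(1)[OF T(1)], of x]]
            by (simp add: G(2,3)[OF T(1)] F(2,3)[OF T])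
          then have "(f has_derivative ?D) (at x within convex hull T)"
            by (rule has_derivative_transform[OF T(2), rotated]) (use f(2)[OF T(1)] in auto)
          then show ?thesis by (simp add: K_def Some)
        qed
      next
        case False
        \<comment> \<open>A closed piece that misses \<open>x\<close> has no points near
          \<open>x\<close>, so the filter is trivial and only linearity of the derivative is
          left.\<close>
        have "closed (K i)" using i closed_hull open_dom by (auto simp: K_def)
        then have "at x within K i = bot"
          using False by (metis trivial_limit_within closed_limpt)
        then show ?thesis using bl unfolding has_derivative_within by simp
      qed
    qed
    moreover have "(\<Union>i\<in>?I. K i) = UNIV" using dom_subset by (auto simp: K_def)
    ultimately show ?thesis by simp
  qed
  have fd: "dx f = (\<lambda>x. - U (False, x))" "dy f = (\<lambda>x. U (True, x))"
    using dx_eqI[OF D] dy_eqI[OF D] by (auto simp: fun_eq_iff)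
  have cU: "continuous_on UNIV (\<lambda>x. U (True, x))" "continuous_on UNIV (\<lambda>x. U (False, x))"
    using U P3D(1) by (auto simp: fields_def)
  have "f \<in> Sh4 Th"
    unfolding Sh4_def mem_Collect_eq fd
  proof (intro conjI ballI allI impI)
    show "f differentiable (at x)" for x using D by (rule differentiableI)
    show "continuous_on UNIV (\<lambda>x. - U (False, x))" "continuous_on UNIV (\<lambda>x. U (True, x))"
      by (intro continuous_on_minus cU)+
    show "f x = 0" if "x \<notin> \<Omega>" for x by (rule f(3)[OF that])
    show "- U (False, x) = 0" "U (True, x) = 0" if "x \<in> frontier \<Omega>" for x
      using that fields_zero[OF U, of x] by (simp_all add: frontier_dom)
    show "\<exists>p. poly2 4 p \<and> (\<forall>x\<in>convex hull T. f x = p x)" if "T \<in> Th" for T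
      using G(1)[OF that] f(2)[OF that] by blast
  qed
  moreover have "curl f = U" by (auto simp: curl_def fd fun_eq_iff)
  ultimately show ?thesis by blast
qed

lemma kernel_divergence:
  assumes "connected (- \<Omega>)"
  shows "{U\<in>fields. divergence U = 0} = curl ` Sh4 Th"
  using curl_in_kernel kernel_has_potential[OF assms] by blast

theorem dim_div_plus_dim_Sh4:
  assumes conn: "connected (- \<Omega>)"
  shows "dimPW (div_Vh3 Th) + dimF (Sh4 Th) = 2 * (card (interior_vertices Th) + 2 * card (interior_edges Th) + card Th)"
proof -
  obtain A where A: "finite A" "fields \<subseteq> fs.span A"
  proof -
    obtain B where B: "B \<subseteq> fields" "fs.independent B" "fields \<subseteq> fs.span B" "card B = fs.dim fields"
      using fs.basis_exists .
    \<comment> \<open>Infinite sets have cardinality 0, so a positive dimension forces the basis to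
      be finite.\<close>
    have "card B \<noteq> 0" 
    proof -
      have "card Th \<noteq> 0" using finite_Th Th_nonempty by simp
      then show ?thesis using B(4) dim_fields by simp
    qed
    then have "finite B" by (meson card.infinite)
    then show ?thesis using that B(3) by blast
  qed
  have "fs.dim fields = fs.dim {U\<in>fields. divergence U = 0} + pw.dim (divergence ` fields)"
    by (rule fspw.rank_nullity_on[OF subspace_fields A]) (simp_all add: divergence_linear)
  moreover have "fs.dim (curl ` Sh4 Th) = fs.dim (Sh4 Th)"
    by (rule fsp.dim_image_inj_on[OF subspace_Sh4 _ _ inj_curl]) (simp_all add: curl_linear)
  ultimately show ?thesis
    unfolding dimPW_def dimF_def using kernel_divergence[OF conn] image_divergence dim_fields by simp
qed

end

section \<open>Singular vertices\<close>

lemma cr_parallel_trans: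
  assumes "cr s u = 0" "cr u w = 0" "u \<noteq> 0"
  shows "cr s w = 0"
proof -
  have "fst u * cr s w = 0" "snd u * cr s w = 0"
    using assms(1,2) unfolding cr_def by (auto simp: algebra_simps) algebra+
  moreover have "fst u \<noteq> 0 \<or> snd u \<noteq> 0" using assms(3) by (simp add: prod_eq_iff)
  ultimately show ?thesis by auto
qed

lemma cr_commute: "cr v u = - cr u v"
  by (simp add: cr_def)

lemma cr_inner_identity: "(cr u v)\<^sup>2 + (u \<bullet> v)\<^sup>2 = (norm u * norm v)\<^sup>2"
proof -
  have "(norm u * norm v)\<^sup>2 = (u \<bullet> u) * (v \<bullet> v)"
    by (simp add: power_mult_distrib power2_norm_eq_inner)
  then show ?thesis
    by (simp add: cr_def inner_prod_def power2_eq_square algebra_simps)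
qed

lemma cos_vangle:
  assumes "u \<noteq> 0" "v \<noteq> 0"
  shows "cos (vangle u v) = (u \<bullet> v) / (norm u * norm v)"
proof -
  have "\<bar>(u \<bullet> v) / (norm u * norm v)\<bar> \<le> 1"
    using Cauchy_Schwarz_ineq2[of u v] assms by (simp add: abs_mult)
  then show ?thesis unfolding vangle_def by (intro cos_arccos) linarith+
qed

lemma sin_vangle:
  assumes "u \<noteq> 0" "v \<noteq> 0"
  shows "sin (vangle u v) = \<bar>cr u v\<bar> / (norm u * norm v)"
proof -
  let ?c = "(u \<bullet> v) / (norm u * norm v)"
  have n: "norm u * norm v > 0" using assms by simp
  have "\<bar>?c\<bar> \<le> 1"
    using Cauchy_Schwarz_ineq2[of u v] assms by (simp add: abs_mult)
  then have "sin (vangle u v) = sqrt (1 - ?c\<^sup>2)"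
    unfolding vangle_def by (intro sin_arccos) linarith+
  also have "1 - ?c\<^sup>2 = (\<bar>cr u v\<bar> / (norm u * norm v))\<^sup>2"
  proof -
    have "1 - ?c\<^sup>2 = ((norm u * norm v)\<^sup>2 - (u \<bullet> v)\<^sup>2) / (norm u * norm v)\<^sup>2"
    proof -
      have "1 - (i / N)\<^sup>2 = (N\<^sup>2 - i\<^sup>2) / N\<^sup>2" if "N > 0" for i N :: real
        using that by (simp add: power_divide diff_divide_distrib)
      from this[OF n] show ?thesis .
    qed
    also have "\<dots> = (cr u v)\<^sup>2 / (norm u * norm v)\<^sup>2"
      using cr_inner_identity[of u v] by (metis add_diff_cancel_right')
    finally show ?thesis by (simp add: power_divide)
  qed
  also have "sqrt \<dots> = \<bar>cr u v\<bar> / (norm u * norm v)"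
    using n by (simp add: real_sqrt_abs)
  finally show ?thesis .
qed

lemma sin_vangle_add_eq_0:
  assumes nz: "u \<noteq> 0" "v \<noteq> 0" "w \<noteq> 0" and side: "cr u v * cr v w > 0"
    and sin: "sin (vangle u v + vangle v w) = 0"
  shows "cr u w = 0"
proof -
  have n: "norm u > 0" "norm v > 0" "norm w > 0" using nz by auto
  have "0 = (\<bar>cr u v\<bar> * (v \<bullet> w) + (u \<bullet> v) * \<bar>cr v w\<bar>) / (norm u * norm v * (norm v * norm w))"
    using sin nz by (simp add: sin_add sin_vangle cos_vangle add_divide_distrib)
  then have 0: "\<bar>cr u v\<bar> * (v \<bullet> w) + (u \<bullet> v) * \<bar>cr v w\<bar> = 0"
    using n by (metis divide_eq_0_iff less_numeral_extra(3) mult_eq_0_iff)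
  have "cr u v * (v \<bullet> w) + (u \<bullet> v) * cr v w = 0"
  proof (cases "cr u v > 0")
    case True
    then have "cr v w > 0" using side by (simp add: zero_less_mult_iff)
    then show ?thesis using 0 True by simp
  next
    case False
    then have "cr u v < 0" "cr v w < 0" using side by (auto simp: zero_less_mult_iff)
    then show ?thesis using 0 by simp
  qed
  moreover have "cr u v * (v \<bullet> w) + (u \<bullet> v) * cr v w = (v \<bullet> v) * cr u w"
    by (simp add: cr_def inner_prod_def algebra_simps)
  ultimately show ?thesis using nz by simp
qed

lemma vangle_commute: "vangle u v = vangle v u"
  by (simp add: vangle_def inner_commute mult.commute)

lemma angle_at_eq:
  assumes "z \<noteq> a" "z \<noteq> b" "a \<noteq> b"
  shows "angle_at {z, a, b} z = vangle (a - z) (b - z)"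
  unfolding angle_at_def
proof (rule the_equality)
  show "\<exists>a' b'. {z, a, b} = {z, a', b'} \<and> a' \<noteq> b' \<and> z \<noteq> a' \<and> z \<noteq> b' \<and> vangle (a - z) (b - z) = vangle (a' - z) (b' - z)"
    by (rule exI[of _ a], rule exI[of _ b]) (simp add: assms)
next
  fix t assume "\<exists>a' b'. {z, a, b} = {z, a', b'} \<and> a' \<noteq> b' \<and> z \<noteq> a' \<and> z \<noteq> b' \<and> t = vangle (a' - z) (b' - z)"
  then obtain a' b' where ab: "{z, a, b} = {z, a', b'}" "a' \<noteq> b'" "z \<noteq> a'" "z \<noteq> b'" "t = vangle (a' - z) (b' - z)" by blast
  have "a' \<in> {z, a, b}" "b' \<in> {z, a, b}" using ab(1) by blast+
  then have "a' = a \<and> b' = b \<or> a' = b \<and> b' = a" using ab(2-4) by auto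
  then show "t = vangle (a - z) (b - z)" using ab(5) vangle_commute by metis
qed

text \<open>The derivative along an edge depends only on the values on that edge: the difference
  restricted to the line is a univariate polynomial with infinitely many roots.\<close>

lemma poly2_directional_derivative_cong:
  assumes p: "poly2 k p" and q: "poly2 k q" and eq: "\<And>y. y \<in> closed_segment z x \<Longrightarrow> p y = q y"
  shows "dx p z * fst (x - z) + dy p z * snd (x - z) = dx q z * fst (x - z) + dy q z * snd (x - z)"
proof -
  define r where "r = (\<lambda>y. p y - q y)"
  have r: "poly2 k r" unfolding r_def by (rule poly2_diff[OF p q])
  obtain Q where Q: "\<And>t. r (z + t *\<^sub>R (x - z)) = poly Q t" using poly2_on_line[OF r] by blast
  have "poly Q t = 0" if "t \<in> {0..1}" for t
  proof -
    have "z + t *\<^sub>R (x - z) \<in> closed_segment z x"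
      unfolding in_segment using that by (intro exI[of _ t]) (auto simp: algebra_simps)
    then show ?thesis using eq by (simp add: Q[symmetric] r_def)
  qed
  then have "{0..1} \<subseteq> {t. poly Q t = 0}" by blast
  moreover have "infinite {0..1::real}" by (rule infinite_Icc) simp
  ultimately have "Q = 0" using poly_roots_finite[of Q] finite_subset by metis
  then have const: "(\<lambda>t. r (z + t *\<^sub>R (x - z))) = (\<lambda>t. 0)" using Q by simp
  have "((\<lambda>t. z + t *\<^sub>R (x - z)) has_derivative (\<lambda>h. h *\<^sub>R (x - z))) (at 0)"
    by (auto intro!: derivative_eq_intros)
  from has_derivative_compose[OF this poly2_has_derivative[OF r]]
  have "((\<lambda>t. r (z + t *\<^sub>R (x - z))) has_derivative (\<lambda>h. dx r z * fst (h *\<^sub>R (x - z)) + dy r z * snd (h *\<^sub>R (x - z)))) (at 0)"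
    by simp
  then have "(\<lambda>h. dx r z * fst (h *\<^sub>R (x - z)) + dy r z * snd (h *\<^sub>R (x - z))) = (\<lambda>h. 0 :: real)"
    unfolding const by (rule Deriv.has_derivative_zero_unique)
  from fun_cong[OF this, of 1] have "dx r z * fst (x - z) + dy r z * snd (x - z) = 0" by simp
  then show ?thesis
    unfolding r_def dx_diff[OF p q] dy_diff[OF p q] by (simp add: algebra_simps)
qed

section \<open>Geometry of a singular vertex\<close>

context triangulation
begin

definition star :: "pt \<Rightarrow> pt set set" where
  "star z = {T \<in> Th. z \<in> T}"

lemma finite_star: "finite (star z)"
  using finite_Th by (simp add: star_def)

text \<open>The outer vertices \<open>a\<close> and \<open>c\<close> lie on opposite sides of the
  common edge, so the turns from \<open>a\<close> to \<open>b\<close> and from \<open>b\<close> to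
  \<open>c\<close> about \<open>z\<close> have the same sense. This is the sign condition of
  \<open>sin_vangle_add_eq_0\<close>.\<close>

lemma adjacentE:
  assumes T: "T \<in> star z" "T' \<in> star z" and 2: "card (T \<inter> T') = 2"
  obtains a b c where "T = {z, a, b}" "T' = {z, b, c}" "a \<noteq> c" "z \<noteq> a" "z \<noteq> b" "z \<noteq> c" "a \<noteq> b" "b \<noteq> c"
    "cr (a - z) (b - z) * cr (b - z) (c - z) > 0"
proof -
  have Th: "T \<in> Th" "T' \<in> Th" "z \<in> T" "z \<in> T'" using T by (auto simp: star_def)
  have ne: "T \<noteq> T'" using 2 card_T[OF Th(1)] by auto
  have "card (T \<inter> T' - {z}) = 1" using 2 Th by simp
  then obtain b where "T \<inter> T' - {z} = {b}" by (auto simp: card_1_singleton_iff)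
  then have b: "b \<noteq> z" "{z, b} \<subseteq> T" "{z, b} \<subseteq> T'" using Th by auto
  obtain a where a: "T = {z, b, a}" "a \<noteq> z" "a \<noteq> b" by (rule third_vertex[OF Th(1) b(2) b(1)[symmetric]])
  obtain c where c: "T' = {z, b, c}" "c \<noteq> z" "c \<noteq> b" by (rule third_vertex[OF Th(2) b(3) b(1)[symmetric]])
  have ac: "a \<noteq> c" using ne a c by auto
  have "cr (b - z) (a - z) * cr (b - z) (c - z) < 0"
    using opposite_sides[of z b a c] Th a(1) c(1) ac by simp
  then have "cr (a - z) (b - z) * cr (b - z) (c - z) > 0"
    by (simp add: cr_commute[of "a - z"])
  then show ?thesis using that[of a b c] a b c ac by (auto simp: insert_commute)
qed

text \<open>The vectors \<open>s\<close> and \<open>t\<close> span the two lines through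
  \<open>z\<close> that carry all edges at \<open>z\<close>. Each triangle has one edge on each
  line, so its corner at \<open>z\<close> fills one of four quadrants.\<close>

definition frame :: "pt \<Rightarrow> pt \<Rightarrow> pt \<Rightarrow> bool" where
  "frame z s t \<longleftrightarrow> cr s t \<noteq> 0 \<and>
     (\<forall>T\<in>star z. \<exists>a b. T = {z, a, b} \<and> cr s (a - z) = 0 \<and> cr t (b - z) = 0)"

text \<open>At a singular vertex all edges lie on two lines: two consecutive angles with sine of the sum
  zero are supplementary, so the outer edges of two adjacent triangles are collinear.\<close>

lemma singular_vertex_frame:
  assumes z: "singular_vertex Th z"
  obtains s t where "frame z s t"
proof -
  obtain Ts where Ts: "vertex_enum Th z Ts"
    and *: "let N = length Ts; th = (\<lambda>j. angle_at (Ts ! j) z) in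
         if z \<in> dom_of Th
         then (\<forall>j<N. sin (th j + th ((j + 1) mod N)) = 0)
         else (\<forall>j. j + 1 < N \<longrightarrow> sin (th j + th (j + 1)) = 0)"
    using z unfolding singular_vertex_def by blast
  have sin: "sin (angle_at (Ts ! j) z + angle_at (Ts ! (j + 1)) z) = 0" if j: "j + 1 < length Ts" for j
  proof (cases "z \<in> \<Omega>")
    case True
    have m: "(j + 1) mod length Ts = j + 1" and jl: "j < length Ts" using j by simp_all
    have "sin (angle_at (Ts ! j) z + angle_at (Ts ! ((j + 1) mod length Ts)) z) = 0"
      using *[unfolded Let_def if_P[OF True]] jl by blast
    then show ?thesis unfolding m .
  next
    case False
    then show ?thesis using *[unfolded Let_def if_not_P[OF False]] j by blast
  qed
  have set: "set Ts = star z" and ne: "Ts \<noteq> []"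
    and adj: "\<And>j. j + 1 < length Ts \<Longrightarrow> card (Ts ! j \<inter> Ts ! (j + 1)) = 2"
    using Ts by (auto simp: vertex_enum_def star_def)
  have in_star: "Ts ! j \<in> star z" if "j < length Ts" for j using that set nth_mem by blast
  have T0: "Ts ! 0 \<in> star z" using in_star ne by simp
  then obtain a0 b0 where 0: "Ts ! 0 = {z, a0, b0}" "cr (a0 - z) (b0 - z) \<noteq> 0"
    using is_triangleE[OF tri, of "Ts ! 0" z] unfolding star_def by blast
  define s t where "s = a0 - z" and "t = b0 - z"
  have "\<exists>a b. Ts ! j = {z, a, b} \<and> cr s (a - z) = 0 \<and> cr t (b - z) = 0" if "j < length Ts" for j
    using that
  proof (induction j)
    case 0
    then show ?case using \<open>Ts ! 0 = {z, a0, b0}\<close>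
      by (intro exI[of _ a0] exI[of _ b0]) (simp add: s_def t_def cr_def)
  next
    case (Suc j)
    then obtain p q where pq: "Ts ! j = {z, p, q}" "cr s (p - z) = 0" "cr t (q - z) = 0" by auto
    obtain a b c where abc: "Ts ! j = {z, a, b}" "Ts ! (j + 1) = {z, b, c}" "a \<noteq> c" "z \<noteq> a" "z \<noteq> b" "z \<noteq> c" "a \<noteq> b" "b \<noteq> c"
      "cr (a - z) (b - z) * cr (b - z) (c - z) > 0"
      by (rule adjacentE[of "Ts ! j" z "Ts ! (j + 1)"]) (use Suc.prems in_star adj in auto)
    have "cr (a - z) (c - z) = 0"
    proof (rule sin_vangle_add_eq_0[OF _ _ _ abc(9)])
      have "sin (angle_at (Ts ! j) z + angle_at (Ts ! (j + 1)) z) = 0" using sin Suc.prems by simp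
      then show "sin (vangle (a - z) (b - z) + vangle (b - z) (c - z)) = 0"
        unfolding abc(1,2) using abc(4-8) by (simp add: angle_at_eq)
    qed (use abc in auto)
    \<comment> \<open>The new outer edge is parallel to the old one, so \<open>c\<close> takes over
      the line of \<open>a\<close> while \<open>b\<close> keeps its own.\<close>
    then have par: "cr r (c - z) = 0" if "cr r (a - z) = 0" for r
      using cr_parallel_trans[OF that] abc(4) by simp
    have "a \<in> {z, p, q}" "b \<in> {z, p, q}" using abc(1) pq(1) by auto
    then have "a = p \<and> b = q \<or> a = q \<and> b = p" using abc(4-7) by auto
    then show ?case
    proof
      assume "a = p \<and> b = q"
      then show ?thesis using par pq abc(2) by (intro exI[of _ c] exI[of _ b]) auto
    next
      assume "a = q \<and> b = p"
      then show ?thesis using par pq abc(2) by (intro exI[of _ b] exI[of _ c]) auto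
    qed
  qed
  then have "frame z s t"
    unfolding frame_def using set 0(2) by (metis in_set_conv_nth s_def t_def)
  then show ?thesis using that by blast
qed

text \<open>With \<open>coord2\<close>, the coordinates of \<open>v\<close> in the basis
  \<open>s\<close>, \<open>t\<close> by Cramer's rule.\<close>

definition coord1 :: "pt \<Rightarrow> pt \<Rightarrow> pt \<Rightarrow> real" where
  "coord1 s t v = cr v t / cr s t"

definition coord2 :: "pt \<Rightarrow> pt \<Rightarrow> pt \<Rightarrow> real" where
  "coord2 s t v = cr s v / cr s t"

text \<open>Each vertex of \<open>T\<close> other than \<open>z\<close> has exactly one nonzero
  coordinate, which the sum extracts. The sign is 1 on one pair of opposite quadrants and -1 on the
  other.\<close>

definition quadrant_sign :: "pt \<Rightarrow> pt \<Rightarrow> pt \<Rightarrow> pt set \<Rightarrow> real" where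
  "quadrant_sign z s t T = sgn (\<Prod>x\<in>T - {z}. coord1 s t (x - z) + coord2 s t (x - z))"

lemma frameE:
  assumes "frame z s t" "T \<in> star z"
  obtains a b where "T = {z, a, b}" "a \<noteq> z" "b \<noteq> z" "a \<noteq> b" "cr s (a - z) = 0" "cr t (b - z) = 0"
    "a - z = coord1 s t (a - z) *\<^sub>R s" "b - z = coord2 s t (b - z) *\<^sub>R t"
    "coord1 s t (a - z) \<noteq> 0" "coord2 s t (b - z) \<noteq> 0" "coord2 s t (a - z) = 0" "coord1 s t (b - z) = 0"
    "quadrant_sign z s t T = sgn (coord1 s t (a - z) * coord2 s t (b - z))"
proof -
  have st: "cr s t \<noteq> 0" using assms by (simp add: frame_def)
  obtain a b where ab: "T = {z, a, b}" "cr s (a - z) = 0" "cr t (b - z) = 0" using assms by (auto simp: frame_def)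
  have d: "z \<noteq> a" "z \<noteq> b" "a \<noteq> b" using is_triangle_cr[of z a b] tri[of T] assms(2) ab by (auto simp: star_def)
  have e: "v = coord1 s t v *\<^sub>R s + coord2 s t v *\<^sub>R t" for v
  proof -
    have "cr s t * fst v = cr v t * fst s + cr s v * fst t" "cr s t * snd v = cr v t * snd s + cr s v * snd t"
      by (simp_all add: cr_def algebra_simps)
    then show ?thesis using st
      by (simp add: coord1_def coord2_def prod_eq_iff add_divide_distrib[symmetric] eq_divide_eq mult.commute)
  qed
  have 0: "coord2 s t (a - z) = 0" "coord1 s t (b - z) = 0"
    using ab(2,3) by (simp_all add: coord1_def coord2_def cr_commute[of "b - z"])
  have 1: "a - z = coord1 s t (a - z) *\<^sub>R s" "b - z = coord2 s t (b - z) *\<^sub>R t"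
    using e[of "a - z"] e[of "b - z"] 0 by simp_all
  have 2: "coord1 s t (a - z) \<noteq> 0" "coord2 s t (b - z) \<noteq> 0"
    using 1 d by (metis eq_iff_diff_eq_0 scale_zero_left)+
  have "T - {z} = {a, b}" using ab(1) d by auto
  then have "quadrant_sign z s t T = sgn (coord1 s t (a - z) * coord2 s t (b - z))"
    using d(3) 0 by (simp add: quadrant_sign_def)
  then show ?thesis using that[of a b] ab d 0 1 2 by blast
qed

lemma quadrant_sign_cases:
  assumes "frame z s t" "T \<in> star z"
  shows "quadrant_sign z s t T = 1 \<or> quadrant_sign z s t T = - 1"
proof -
  obtain a b where "coord1 s t (a - z) \<noteq> 0" "coord2 s t (b - z) \<noteq> 0"
    "quadrant_sign z s t T = sgn (coord1 s t (a - z) * coord2 s t (b - z))"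
    by (rule frameE[OF assms])
  then show ?thesis by (simp add: sgn_if)
qed

text \<open>The common edge fixes one coordinate; the other two edges lie on opposite rays of the
  second line, so exactly one coordinate changes its sign.\<close>

lemma quadrant_sign_adjacent:
  assumes fr: "frame z s t" and T: "T \<in> star z" "T' \<in> star z" and 2: "card (T \<inter> T') = 2"
  shows "quadrant_sign z s t T' = - quadrant_sign z s t T"
proof -
  let ?A = "coord1 s t" and ?B = "coord2 s t"
  obtain a b where ab: "T = {z, a, b}" "a \<noteq> z" "b \<noteq> z" "a \<noteq> b"
    "a - z = ?A (a - z) *\<^sub>R s" "b - z = ?B (b - z) *\<^sub>R t" "?A (a - z) \<noteq> 0" "?B (b - z) \<noteq> 0"
    "?B (a - z) = 0" "?A (b - z) = 0"
    "quadrant_sign z s t T = sgn (?A (a - z) * ?B (b - z))"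
    by (rule frameE[OF fr T(1)])
  obtain c d where cd: "T' = {z, c, d}" "c \<noteq> z" "d \<noteq> z" "c \<noteq> d"
    "c - z = ?A (c - z) *\<^sub>R s" "d - z = ?B (d - z) *\<^sub>R t" "?A (c - z) \<noteq> 0" "?B (d - z) \<noteq> 0"
    "?B (c - z) = 0" "?A (d - z) = 0"
    "quadrant_sign z s t T' = sgn (?A (c - z) * ?B (d - z))"
    by (rule frameE[OF fr T(2)])
  have cr2: "cr (k *\<^sub>R u) (l *\<^sub>R v) = k * l * cr u v" for k l u v by (simp add: cr_def algebra_simps)
  obtain p q r where pqr: "T = {z, p, q}" "T' = {z, q, r}" "p \<noteq> r" "z \<noteq> p" "z \<noteq> q" "z \<noteq> r" "p \<noteq> q" "q \<noteq> r"
    "cr (p - z) (q - z) * cr (q - z) (r - z) > 0"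
    by (rule adjacentE[OF T 2])
  have "p \<in> {z, a, b}" "q \<in> {z, a, b}" "q \<in> {z, c, d}" "r \<in> {z, c, d}" using pqr(1,2) ab(1) cd(1) by auto
  then have pq: "p = a \<and> q = b \<or> p = b \<and> q = a" and qr: "q = c \<and> r = d \<or> q = d \<and> r = c"
    using pqr(4-8) by auto
  have bc: "b \<noteq> c" "a \<noteq> d" using ab cd by auto
  define A B C D where "A = ?A (a - z)" and "B = ?B (b - z)" and "C = ?A (c - z)" and "D = ?B (d - z)"
  from pq qr bc consider "p = a" "q = b" "b = d" "r = c" | "p = b" "q = a" "a = c" "r = d" by blast
  then have "A * B * (C * D) < 0"
  proof cases
    case 1
    have "cr (A *\<^sub>R s) (B *\<^sub>R t) * cr (B *\<^sub>R t) (C *\<^sub>R s) > 0"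
      using pqr(9) ab(5,6) cd(5) 1 unfolding A_def B_def C_def by metis
    then have "- (A * B * (C * B)) * (cr s t)\<^sup>2 > 0"
      by (simp add: cr2 cr_commute[of t s] power2_eq_square algebra_simps)
    then have "A * B * (C * B) < 0" by (simp add: mult_less_0_iff zero_less_mult_iff)
    moreover have "B = D" using 1 by (simp add: B_def D_def)
    ultimately show ?thesis by simp
  next
    case 2
    have "cr (B *\<^sub>R t) (A *\<^sub>R s) * cr (A *\<^sub>R s) (D *\<^sub>R t) > 0"
      using pqr(9) ab(5,6) cd(6) 2 unfolding A_def B_def D_def by metis
    then have "- (A * B * (A * D)) * (cr s t)\<^sup>2 > 0"
      by (simp add: cr2 cr_commute[of t s] power2_eq_square algebra_simps)
    then have "A * B * (A * D) < 0" by (simp add: mult_less_0_iff zero_less_mult_iff)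
    moreover have "A = C" using 2 by (simp add: A_def C_def)
    ultimately show ?thesis by simp
  qed
  moreover have "sgn y = - sgn x" if "x * y < 0" for x y :: real
    using that by (auto simp: sgn_if mult_less_0_iff)
  ultimately show ?thesis
    unfolding ab(11) cd(11) A_def[symmetric] B_def[symmetric] C_def[symmetric] D_def[symmetric]
    by blast
qed

text \<open>Along an enumeration the quadrant signs alternate, so the two sums agree up to the sign
  of the first triangle. The vertex condition thereby becomes independent of the
  enumeration.\<close>

lemma alternating_sum_iff:
  assumes fr: "frame z s t" and Ts: "vertex_enum Th z Ts"
  shows "(\<Sum>j<length Ts. (-1) ^ j * q (Ts ! j) z) = 0 \<longleftrightarrow> (\<Sum>T\<in>star z. quadrant_sign z s t T * q T z) = 0"
proof -
  let ?\<sigma> = "quadrant_sign z s t"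
  have set: "set Ts = star z" and ne: "Ts \<noteq> []" and dist: "distinct Ts"
    and adj: "\<And>j. j + 1 < length Ts \<Longrightarrow> card (Ts ! j \<inter> Ts ! (j + 1)) = 2"
    using Ts by (auto simp: vertex_enum_def star_def)
  have in_star: "Ts ! j \<in> star z" if "j < length Ts" for j using that set nth_mem by blast
  have sg: "?\<sigma> (Ts ! j) = (-1) ^ j * ?\<sigma> (Ts ! 0)" if "j < length Ts" for j
    using that
  proof (induction j)
    case (Suc j)
    have "?\<sigma> (Ts ! Suc j) = - ?\<sigma> (Ts ! j)"
      using quadrant_sign_adjacent[OF fr, of "Ts ! j" "Ts ! Suc j"] in_star adj Suc.prems by simp
    then show ?case using Suc by simp
  qed simp
  have "(\<Sum>T\<in>star z. ?\<sigma> T * q T z) = (\<Sum>j<length Ts. ?\<sigma> (Ts ! j) * q (Ts ! j) z)"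
    using sum.reindex_bij_betw[OF bij_betw_nth[OF dist refl set[symmetric]], of "\<lambda>T. ?\<sigma> T * q T z"] by simp
  also have "\<dots> = ?\<sigma> (Ts ! 0) * (\<Sum>j<length Ts. (-1) ^ j * q (Ts ! j) z)"
    unfolding sum_distrib_left by (intro sum.cong refl) (simp add: sg)
  finally have e: "(\<Sum>T\<in>star z. ?\<sigma> T * q T z) = ?\<sigma> (Ts ! 0) * (\<Sum>j<length Ts. (-1) ^ j * q (Ts ! j) z)" .
  moreover have "?\<sigma> (Ts ! 0) \<noteq> 0" using quadrant_sign_cases[OF fr in_star[of 0]] ne by auto
  ultimately show ?thesis by simp
qed

text \<open>The divergence on a triangle at the vertex splits into one contribution for each of its two
  edges there.  The contribution of an edge is the same for both adjacent triangles, whose signs are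
  opposite, and it vanishes on boundary edges.\<close>

lemma divergence_alternating_sum:
  assumes fr: "frame z s t" and U: "U \<in> fields"
  shows "(\<Sum>T\<in>star z. quadrant_sign z s t T * divergence U T z) = 0"
proof -
  let ?\<sigma> = "quadrant_sign z s t" and ?A = "coord1 s t" and ?B = "coord2 s t"
  have st: "cr s t \<noteq> 0" using fr by (simp add: frame_def)
  \<comment> \<open>The derivative at \<open>z\<close>, along the edge to \<open>x\<close>, of one
    component of the field on \<open>T\<close>. It depends only on the values on that edge, hence
    not on the side from which it is taken.\<close>
  define g where "g = (\<lambda>T b x. dx (piece 3 T (\<lambda>y. U (b, y))) z * fst (x - z) + dy (piece 3 T (\<lambda>y. U (b, y))) z * snd (x - z))"
  have pc: "poly2 3 (piece 3 T (\<lambda>y. U (b, y))) \<and> (\<forall>y\<in>convex hull T. U (b, y) = piece 3 T (\<lambda>y. U (b, y)) y)"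
    if "T \<in> Th" for T b
  proof -
    have "(\<lambda>y. U (b, y)) \<in> P3" using U by (cases b) (simp_all add: fields_def)
    from someI_ex[OF P3D(3)[OF this that]] show ?thesis unfolding piece_def .
  qed
  have g_eq: "g T b x = g T' b x" if T: "T \<in> star z" "x \<in> T" "T' \<in> star z" "x \<in> T'" for T T' b x
  proof -
    have Th: "T \<in> Th" "T' \<in> Th" "{z, x} \<subseteq> T" "{z, x} \<subseteq> T'" using T by (auto simp: star_def)
    show ?thesis
      unfolding g_def
    proof (rule poly2_directional_derivative_cong)
      show "piece 3 T (\<lambda>y. U (b, y)) y = piece 3 T' (\<lambda>y. U (b, y)) y" if "y \<in> closed_segment z x" for y
        using pc[OF Th(1)] pc[OF Th(2)] closed_segment_in_hull[OF Th(3)] closed_segment_in_hull[OF Th(4)] that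
        by (metis subsetD)
    qed (use pc Th in blast)+
  qed
  have g_0: "g T b x = 0" if T: "T \<in> star z" "x \<in> T" "x \<noteq> z" and ne: "{z, x} \<notin> interior_edges Th" for T b x
  proof -
    have Th: "T \<in> Th" "{z, x} \<subseteq> T" using T by (auto simp: star_def)
    have "g T b x = dx (\<lambda>_. 0) z * fst (x - z) + dy (\<lambda>_. 0) z * snd (x - z)"
      unfolding g_def
    proof (rule poly2_directional_derivative_cong)
      show "piece 3 T (\<lambda>y. U (b, y)) y = 0" if y: "y \<in> closed_segment z x" for y
      proof -
        have "y \<notin> \<Omega>" using boundary_edge_closed_segment[OF edgesI[OF Th T(3)[symmetric]] ne] y by blast
        then show ?thesis
          using pc[OF Th(1)] closed_segment_in_hull[OF Th(2)] y fields_zero[OF U] by (metis subsetD)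
      qed
    qed (use pc Th in auto)
    then show ?thesis by simp
  qed
  \<comment> \<open>In the basis \<open>s\<close>, \<open>t\<close> the divergence is a sum of
    \<open>cr\<close> of the s-derivative with \<open>t\<close> and of \<open>cr\<close> of
    \<open>s\<close> with the t-derivative, divided by \<open>cr s t\<close>. An edge along
    \<open>s\<close> carries the first summand, an edge along \<open>t\<close> the second; the
    coordinate of \<open>x - z\<close> rescales the derivative along the edge.\<close>
  define K where "K = (\<lambda>x. \<lambda>u. if ?B (x - z) = 0 then cr u t / (?A (x - z) * cr s t) else cr s u / (?B (x - z) * cr s t))"
  define S where "S = (\<lambda>x. SOME T. T \<in> star z \<and> x \<in> T)"
  have S: "S x \<in> star z" "x \<in> S x" if "T \<in> star z" "x \<in> T" for T x
    using someI[of "\<lambda>T. T \<in> star z \<and> x \<in> T" T] that unfolding S_def by blast+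
  define \<gamma> where "\<gamma> = (\<lambda>x. K x (g (S x) True x, g (S x) False x))"
  have div: "divergence U T z = (\<Sum>x\<in>T - {z}. \<gamma> x)" if T: "T \<in> star z" for T
  proof -
    obtain a b where ab: "T = {z, a, b}" "a \<noteq> z" "b \<noteq> z" "a \<noteq> b"
      "a - z = ?A (a - z) *\<^sub>R s" "b - z = ?B (b - z) *\<^sub>R t" "?A (a - z) \<noteq> 0" "?B (b - z) \<noteq> 0"
      "?B (a - z) = 0" "?A (b - z) = 0"
      by (rule frameE[OF fr T])
    define A B where "A = ?A (a - z)" and "B = ?B (b - z)"
    define p1 p2 where "p1 = piece 3 T (\<lambda>y. U (True, y))" and "p2 = piece 3 T (\<lambda>y. U (False, y))"
    have m: "a \<in> T" "b \<in> T" using ab(1) by auto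
    have \<gamma>x: "\<gamma> x = K x (g T True x, g T False x)" if "x \<in> T" for x
      unfolding \<gamma>_def using g_eq[OF S[OF T that] T that] by simp
    have fa: "fst (a - z) = A * fst s" "snd (a - z) = A * snd s" "fst (b - z) = B * fst t" "snd (b - z) = B * snd t"
      using arg_cong[OF ab(5), of fst] arg_cong[OF ab(5), of snd] arg_cong[OF ab(6), of fst] arg_cong[OF ab(6), of snd]
      unfolding A_def B_def by simp_all
    have ga: "g T True a = A * (dx p1 z * fst s + dy p1 z * snd s)" "g T False a = A * (dx p2 z * fst s + dy p2 z * snd s)"
      "g T True b = B * (dx p1 z * fst t + dy p1 z * snd t)" "g T False b = B * (dx p2 z * fst t + dy p2 z * snd t)"
      unfolding g_def fa p1_def p2_def by (simp_all add: algebra_simps)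
    have nz: "A \<noteq> 0" "B \<noteq> 0" using ab by (simp_all add: A_def B_def)
    have "\<gamma> a = cr (dx p1 z * fst s + dy p1 z * snd s, dx p2 z * fst s + dy p2 z * snd s) t / cr s t"
    proof -
      have "\<gamma> a = cr (g T True a, g T False a) t / (A * cr s t)"
        unfolding \<gamma>x[OF m(1)] K_def using ab(9) by (simp add: A_def)
      also have "cr (g T True a, g T False a) t = A * cr (dx p1 z * fst s + dy p1 z * snd s, dx p2 z * fst s + dy p2 z * snd s) t"
        unfolding ga by (simp add: cr_def algebra_simps)
      finally show ?thesis using nz by simp
    qed
    moreover have "\<gamma> b = cr s (dx p1 z * fst t + dy p1 z * snd t, dx p2 z * fst t + dy p2 z * snd t) / cr s t"
    proof -
      have "\<gamma> b = cr s (g T True b, g T False b) / (B * cr s t)"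
        unfolding \<gamma>x[OF m(2)] K_def using nz by (simp add: B_def)
      also have "cr s (g T True b, g T False b) = B * cr s (dx p1 z * fst t + dy p1 z * snd t, dx p2 z * fst t + dy p2 z * snd t)"
        unfolding ga by (simp add: cr_def algebra_simps)
      finally show ?thesis using nz by simp
    qed
    moreover have "cr (dx p1 z * fst s + dy p1 z * snd s, dx p2 z * fst s + dy p2 z * snd s) t
        + cr s (dx p1 z * fst t + dy p1 z * snd t, dx p2 z * fst t + dy p2 z * snd t) = (dx p1 z + dy p2 z) * cr s t"
      by (simp add: cr_def algebra_simps)
    ultimately have "\<gamma> a + \<gamma> b = dx p1 z + dy p2 z"
      using st by (simp add: add_divide_distrib[symmetric])
    moreover have "T - {z} = {a, b}" using ab by auto
    moreover have "T \<in> Th" using T by (simp add: star_def)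
    ultimately show ?thesis using ab(4) by (simp add: divergence_def p1_def p2_def)
  qed
  define X where "X = vertices Th - {z}"
  have "(\<Sum>T\<in>star z. ?\<sigma> T * divergence U T z) = (\<Sum>T\<in>star z. \<Sum>x\<in>{x\<in>X. x \<in> T}. ?\<sigma> T * \<gamma> x)"
  proof (rule sum.cong[OF refl])
    fix T assume T: "T \<in> star z"
    have "{x\<in>X. x \<in> T} = T - {z}" using T by (auto simp: X_def vertices_def star_def)
    then show "?\<sigma> T * divergence U T z = (\<Sum>x\<in>{x\<in>X. x \<in> T}. ?\<sigma> T * \<gamma> x)"
      by (simp add: div[OF T] sum_distrib_left)
  qed
  also have "\<dots> = (\<Sum>x\<in>X. \<Sum>T\<in>{T\<in>star z. x \<in> T}. ?\<sigma> T * \<gamma> x)"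
    by (rule sum.swap_restrict) (use finite_star finite_vertices in \<open>auto simp: X_def\<close>)
  also have "\<dots> = 0"
  proof (rule sum.neutral, rule ballI)
    fix x assume x: "x \<in> X"
    show "(\<Sum>T\<in>{T\<in>star z. x \<in> T}. ?\<sigma> T * \<gamma> x) = 0"
    proof (cases "{T\<in>star z. x \<in> T} = {}")
      case False
      then obtain T where T: "T \<in> star z" "x \<in> T" by blast
      have Th: "T \<in> Th" "{z, x} \<subseteq> T" "z \<noteq> x" using T x by (auto simp: star_def X_def)
      show ?thesis
      proof (cases "{z, x} \<in> interior_edges Th")
        case True
        then obtain T' where T': "T' \<in> Th" "T' \<noteq> T" "{z, x} \<subseteq> T'" using interior_edge_iff[OF Th] by blast
        have T's: "T' \<in> star z" using T' by (simp add: star_def)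
        have "{T\<in>star z. x \<in> T} = {T, T'}"
          using triangles_at_edge[OF Th(1) T'(1,2) Th(3,2) T'(3)] by (simp add: star_def conj_assoc)
        moreover have "?\<sigma> T' = - ?\<sigma> T"
        proof (rule quadrant_sign_adjacent[OF fr T(1) T's])
          have "T \<inter> T' = {z, x}"
          proof
            obtain y where y: "T = {z, x, y}" by (rule third_vertex[OF Th])
            have "y \<notin> T'" 
            proof
              assume "y \<in> T'"
              then have "T \<subseteq> T'" using y T'(3) by auto
              then show False using card_subset_eq[OF finite_T[OF T'(1)], of T] card_T Th(1) T' by simp
            qed
            then show "T \<inter> T' \<subseteq> {z, x}" using y by auto
            show "{z, x} \<subseteq> T \<inter> T'" using Th T' by auto
          qed
          then show "card (T \<inter> T') = 2" using Th(3) by simp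
        qed
        ultimately show ?thesis using T'(2) by simp
      next
        case False
        have "g (S x) b x = 0" for b
          by (rule g_0[OF S[OF T] Th(3)[symmetric] False])
        then have "\<gamma> x = 0" by (simp add: \<gamma>_def K_def cr_def)
        then show ?thesis by simp
      qed
    next
      case True
      then show ?thesis by (simp only: sum.empty)
    qed
  qed
  finally show ?thesis .
qed

end

section \<open>The divergence has mean zero\<close>

lemma difference_quotient_tendsto:
  fixes f :: "'a::real_normed_vector \<Rightarrow> real"
  assumes "(f has_derivative F) (at x)"
  shows "(\<lambda>n. (f (x + inverse (real (Suc n)) *\<^sub>R d) - f x) / inverse (real (Suc n))) \<longlonglongrightarrow> F d"
proof -
  have "((\<lambda>t. x + t *\<^sub>R d) has_derivative (\<lambda>h. h *\<^sub>R d)) (at 0)"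
    by (auto intro!: derivative_eq_intros)
  from has_derivative_compose[OF this, of f F] assms
  have "((\<lambda>t. f (x + t *\<^sub>R d)) has_derivative (\<lambda>h. F (h *\<^sub>R d))) (at 0)" by simp
  moreover have "F (h *\<^sub>R d) = F d * h" for h
    using linear_cmul[OF has_derivative_linear[OF assms], of h d] by simp
  ultimately have "((\<lambda>t. f (x + t *\<^sub>R d)) has_real_derivative F d) (at 0)"
    by (simp add: has_field_derivative_def)
  from DERIV_D[OF this] have "((\<lambda>h. (f (x + h *\<^sub>R d) - f x) / h) \<longlongrightarrow> F d) (at 0)" by simp
  moreover have "filterlim (\<lambda>n. inverse (real (Suc n))) (at 0) sequentially"
    unfolding filterlim_at using LIMSEQ_inverse_real_of_nat by auto
  ultimately show ?thesis by (rule filterlim_compose)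
qed

lemma has_integral_translation:
  fixes f :: "pt \<Rightarrow> real"
  assumes f: "(f has_integral I) (cbox a b)" and z: "\<And>x. x \<notin> cbox a b \<Longrightarrow> f x = 0"
  shows "((\<lambda>x. f (x + c)) has_integral I) UNIV"
proof (rule has_integral_on_superset[OF has_integral_shift_cbox[OF f, of c]])
  fix x assume "x \<notin> cbox (a - c) (b - c)"
  then have "x + c \<notin> cbox a b" by (auto simp: mem_box algebra_simps)
  then show "f (x + c) = 0" by (rule z)
qed simp

section \<open>Integrability, disjoint interiors and Lipschitz bounds\<close>

context triangulation
begin

lemma poly2_integrable_on_hull:
  assumes T: "T \<in> Th" and p: "poly2 k p"
  shows "p integrable_on convex hull T"
proof -
  obtain a where a: "convex hull T \<subseteq> cbox (- a) a"
    by (rule bounded_subset_cbox_symmetric[OF compact_imp_bounded[OF compact_hull[OF T]]])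
  have "set_integrable lebesgue (cbox (- a) a) p"
    by (rule absolutely_integrable_continuous[OF poly2_continuous_on[OF p]])
  then have "set_integrable lebesgue (convex hull T) p"
    by (rule set_integrable_subset[OF _ fmeasurableD[OF lmeasurable_compact[OF compact_hull[OF T]]] a])
  then show ?thesis by (rule set_lebesgue_integral_eq_integral(1))
qed

text \<open>At an interior point with coordinate zero, a small step away from \<open>v\<close> would
  stay in the triangle with a negative coordinate.\<close>

lemma interior_hull_bary_pos:
  assumes T: "T \<in> Th" and x: "x \<in> interior (convex hull T)" and v: "v \<in> T"
  shows "bary T v x > 0"
proof (rule ccontr)
  assume "\<not> bary T v x > 0"
  moreover have "bary T v x \<ge> 0"
    using x interior_subset convex_hull_bary[OF tri[OF T]] v by blast
  ultimately have 0: "bary T v x = 0" by simp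
  define y where "y = (\<lambda>n. x + (- inverse (real (Suc n))) *\<^sub>R (v - x))"
  have "(\<lambda>n. - inverse (real (Suc n))) \<longlonglongrightarrow> - 0"
    by (intro tendsto_minus LIMSEQ_inverse_real_of_nat)
  then have "y \<longlonglongrightarrow> x + 0 *\<^sub>R (v - x)"
    unfolding y_def by (intro tendsto_intros) simp
  then have "eventually (\<lambda>n. y n \<in> interior (convex hull T)) sequentially"
    using topological_tendstoD[OF _ open_interior] x by simp
  then obtain n where "y n \<in> interior (convex hull T)" by (auto simp: eventually_sequentially)
  then have "bary T v (y n) \<ge> 0"
    using interior_subset convex_hull_bary[OF tri[OF T]] v by blast
  moreover have "bary T v (y n) = - inverse (real (Suc n))"
    unfolding y_def bary_line[OF tri[OF T] v] by (simp add: 0 bary_vertex[OF tri[OF T] v v])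
  moreover have "inverse (real (Suc n)) > 0" by simp
  ultimately show False by linarith
qed

lemma interior_hull_unique:
  assumes T: "T \<in> Th" "T' \<in> Th" and x: "x \<in> interior (convex hull T)" "x \<in> convex hull T'"
  shows "T = T'"
proof (rule ccontr)
  assume ne: "T \<noteq> T'"
  have "\<not> T \<subseteq> T'" using card_subset_eq[of T' T] finite_T card_T T ne by auto
  then obtain v where v: "v \<in> T" "v \<notin> T'" by blast
  have "x \<in> convex hull T" using x(1) interior_subset by blast
  then have "bary T v x = 0" using hull_Int_bary[OF T ne _ x(2) v] by blast
  then show False using interior_hull_bary_pos[OF T(1) x(1) v(1)] by simp
qed

lemma poly2_lipschitz_on_hull:
  assumes T: "T \<in> Th" and p: "poly2 k p"
  shows "\<exists>C\<ge>0. \<forall>x\<in>convex hull T. \<forall>y\<in>convex hull T. \<bar>p x - p y\<bar> \<le> C * norm (x - y)"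
proof -
  define g where "g = (\<lambda>x. \<bar>dx p x\<bar> + \<bar>dy p x\<bar>)"
  have "continuous_on (convex hull T) g"
    unfolding g_def
    by (intro continuous_on_add continuous_on_rabs poly2_continuous_on[OF poly2_dx[OF p]] poly2_continuous_on[OF poly2_dy[OF p]])
  then have "bounded (g ` (convex hull T))"
    using compact_continuous_image compact_hull[OF T] compact_imp_bounded by blast
  then obtain C where C: "\<And>x. x \<in> convex hull T \<Longrightarrow> \<bar>g x\<bar> \<le> C"
    by (auto simp: bounded_iff)
  have "\<bar>C\<bar>-lipschitz_on (convex hull T) p"
  proof (rule bounded_derivative_imp_lipschitz)
    fix x assume x: "x \<in> convex hull T"
    show "(p has_derivative (\<lambda>h. dx p x * fst h + dy p x * snd h)) (at x within convex hull T)"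
      using poly2_has_derivative[OF p] by (rule has_derivative_at_withinI)
    show "onorm (\<lambda>h. dx p x * fst h + dy p x * snd h) \<le> \<bar>C\<bar>"
    proof (rule onorm_bound)
      fix h :: pt
      have n: "\<bar>fst h\<bar> \<le> norm h" "\<bar>snd h\<bar> \<le> norm h"
        using norm_fst_le[of "fst h" "snd h"] norm_snd_le[of "snd h" "fst h"] by simp_all
      have "\<bar>dx p x * fst h + dy p x * snd h\<bar> \<le> \<bar>dx p x\<bar> * \<bar>fst h\<bar> + \<bar>dy p x\<bar> * \<bar>snd h\<bar>"
        using abs_triangle_ineq[of "dx p x * fst h" "dy p x * snd h"] by (simp add: abs_mult)
      also have "\<dots> \<le> \<bar>dx p x\<bar> * norm h + \<bar>dy p x\<bar> * norm h"
        by (intro add_mono mult_left_mono n) auto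
      also have "\<dots> = g x * norm h" by (simp add: g_def distrib_right)
      also have "\<dots> \<le> \<bar>C\<bar> * norm h" using C[OF x] by (intro mult_right_mono) auto
      finally show "norm (dx p x * fst h + dy p x * snd h) \<le> \<bar>C\<bar> * norm h" by simp
    qed simp
  qed simp_all
  then show ?thesis
    by (intro exI[of _ "\<bar>C\<bar>"]) (auto dest: lipschitz_onD simp: dist_norm)
qed

text \<open>A segment is cut by the triangles and the complement of \<open>\<Omega>\<close> into
  finitely many closed sets, on each of which \<open>f\<close> is Lipschitz. The sum
  \<open>L\<close> of the constants of all triangles bounds each of them.\<close>

lemma P3_lipschitz:
  assumes f: "f \<in> P3"
  shows "\<exists>L\<ge>0. \<forall>x d. \<bar>f (x + d) - f x\<bar> \<le> L * norm d"
proof -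
  have "\<exists>C\<ge>0. \<forall>x\<in>convex hull T. \<forall>y\<in>convex hull T. \<bar>f x - f y\<bar> \<le> C * norm (x - y)" if T: "T \<in> Th" for T
  proof -
    obtain p where p: "poly2 3 p" "\<forall>x\<in>convex hull T. f x = p x" using P3D(3)[OF f T] by blast
    then show ?thesis using poly2_lipschitz_on_hull[OF T p(1)] by simp
  qed
  then obtain C where C: "\<And>T. T \<in> Th \<Longrightarrow> C T \<ge> 0"
    "\<And>T x y. T \<in> Th \<Longrightarrow> x \<in> convex hull T \<Longrightarrow> y \<in> convex hull T \<Longrightarrow> \<bar>f x - f y\<bar> \<le> C T * norm (x - y)"
    by metis
  define L where "L = (\<Sum>T\<in>Th. C T)"
  have L: "L \<ge> 0" unfolding L_def by (intro sum_nonneg C(1))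
  have CL: "C T \<le> L" if "T \<in> Th" for T
    unfolding L_def using that finite_Th C(1) by (intro member_le_sum) auto
  have "\<bar>f (x + d) - f x\<bar> \<le> L * norm d" for x d
  proof -
    define \<phi> where "\<phi> = (\<lambda>t::real. f (x + t *\<^sub>R d))"
    define K where "K = (\<lambda>i. case i of None \<Rightarrow> - \<Omega> | Some T \<Rightarrow> convex hull T)"
    let ?I = "insert None (Some ` Th)"
    have cK: "closed (K i)" if "i \<in> ?I" for i
      using that closed_hull open_dom by (auto simp: K_def)
    have "(L * norm d)-lipschitz_on {0..1} \<phi>"
    proof (rule lipschitz_on_closed_Union)
      fix i assume i: "i \<in> ?I"
      have "isCont (\<lambda>t::real. x + t *\<^sub>R d) u" for u by (intro continuous_intros)
      from continuous_closed_vimage[OF cK[OF i] this] show "closed {t. x + t *\<^sub>R d \<in> K i}"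
        by (simp add: vimage_def)
      show "(L * norm d)-lipschitz_on {t. x + t *\<^sub>R d \<in> K i} \<phi>"
      proof (rule lipschitz_onI)
        fix u v assume uv: "u \<in> {t. x + t *\<^sub>R d \<in> K i}" "v \<in> {t. x + t *\<^sub>R d \<in> K i}"
        show "dist (\<phi> u) (\<phi> v) \<le> L * norm d * dist u v"
        proof (cases i)
          case None
          then have "\<phi> u = 0" "\<phi> v = 0" using uv P3D(2)[OF f] by (auto simp: K_def \<phi>_def)
          then show ?thesis using L by simp
        next
          case (Some T)
          then have T: "T \<in> Th" using i by auto
          have "x + u *\<^sub>R d \<in> convex hull T" "x + v *\<^sub>R d \<in> convex hull T" using uv by (auto simp: K_def Some)
          from C(2)[OF T this] have "\<bar>\<phi> u - \<phi> v\<bar> \<le> C T * norm ((x + u *\<^sub>R d) - (x + v *\<^sub>R d))"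
            by (simp only: \<phi>_def)
          also have "(x + u *\<^sub>R d) - (x + v *\<^sub>R d) = (u - v) *\<^sub>R d" by (simp add: scaleR_left_diff_distrib)
          also have "C T * norm ((u - v) *\<^sub>R d) \<le> L * norm ((u - v) *\<^sub>R d)"
            by (rule mult_right_mono[OF CL[OF T]]) simp
          finally show ?thesis by (simp add: dist_real_def mult_ac)
        qed
      qed (use L in simp)
    next
      show "{0..1} \<subseteq> (\<Union>i\<in>?I. {t. x + t *\<^sub>R d \<in> K i})" using dom_subset by (auto simp: K_def)
    qed (use finite_Th L in auto)
    then have "dist (\<phi> 1) (\<phi> 0) \<le> L * norm d * dist 1 (0::real)" by (rule lipschitz_onD) auto
    then show ?thesis by (simp add: \<phi>_def dist_real_def)
  qed
  then show ?thesis using L by blast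
qed

text \<open>The integral of a difference quotient vanishes by translation invariance; the quotients are
  uniformly bounded and converge off the edges.\<close>

lemma sum_integral_directional_derivative:
  assumes f: "f \<in> P3"
    and p: "\<And>T. T \<in> Th \<Longrightarrow> poly2 3 (p T)" "\<And>T x. T \<in> Th \<Longrightarrow> x \<in> convex hull T \<Longrightarrow> f x = p T x"
  shows "(\<Sum>T\<in>Th. integral (convex hull T) (\<lambda>x. dx (p T) x * fst d + dy (p T) x * snd d)) = 0"
proof -
  define q where "q = (\<lambda>T x. dx (p T) x * fst d + dy (p T) x * snd d)"
  \<comment> \<open>Distinct triangles have disjoint interiors, so at most one summand is nonzero;
    off the edges \<open>g\<close> is the directional derivative of \<open>f\<close>.\<close>
  define g where "g = (\<lambda>x. \<Sum>T\<in>Th. if x \<in> interior (convex hull T) then q T x else 0)"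
  define N where "N = (\<Union>T\<in>Th. frontier (convex hull T))"
  define e where "e = (\<lambda>n. inverse (real (Suc n)))"
  define D where "D = (\<lambda>n x. (f (x + e n *\<^sub>R d) - f x) / e n)"
  have e: "0 < e n" "e n \<le> 1" for n by (simp_all add: e_def field_simps)
  have N: "negligible N"
    unfolding N_def using finite_Th by (intro negligible_Union) (auto intro: negligible_convex_frontier)
  obtain L where L: "L \<ge> 0" "\<And>x d. \<bar>f (x + d) - f x\<bar> \<le> L * norm d" using P3_lipschitz[OF f] by blast
  obtain a where a: "hullunion \<subseteq> cbox (- a) a"
    by (rule bounded_subset_cbox_symmetric[OF compact_imp_bounded[OF compact_hullunion]])
  have f0: "f x = 0" if "x \<notin> cbox (- a) a" for x
    using that a dom_subset P3D(2)[OF f] by blast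
  have "f integrable_on cbox (- a) a"
    by (rule integrable_continuous[OF continuous_on_subset[OF P3D(1)[OF f]]]) simp
  then obtain I where I: "(f has_integral I) (cbox (- a) a)" by (auto simp: integrable_on_def)
  have tr: "((\<lambda>x. f (x + c)) has_integral I) UNIV" for c
    using has_integral_translation[OF I f0] .
  have DI: "(D n has_integral 0) UNIV" for n
  proof -
    have "((\<lambda>x. (f (x + e n *\<^sub>R d) - f (x + 0)) / e n) has_integral (I - I) / e n) UNIV"
      by (intro has_integral_divide has_integral_diff tr)
    then show ?thesis by (simp add: D_def)
  qed
  obtain R where R: "\<And>x. x \<in> hullunion \<Longrightarrow> norm x \<le> R"
    using compact_imp_bounded[OF compact_hullunion] unfolding bounded_iff by blast
  \<comment> \<open>A quotient is nonzero only if \<open>x\<close>, or its translate by at most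
    \<open>norm d\<close>, lies in the union; one box therefore carries all quotients.\<close>
  obtain b where b: "cball 0 (R + norm d) \<subseteq> cbox (- b) (b :: pt)"
    by (rule bounded_subset_cbox_symmetric[OF bounded_cball])
  define h where "h = (\<lambda>x. if x \<in> cbox (- b) b then L * norm d else 0)"
  have h: "h integrable_on UNIV"
    unfolding h_def integrable_restrict_UNIV by (rule integrable_const)
  \<comment> \<open>Convergence holds off the null set \<open>N\<close> only, so the quotients are
    set to zero on it.\<close>
  define s where "s = (\<lambda>n x. if x \<in> N then 0 else D n x)"
  have sI: "(s n has_integral 0) UNIV" for n
    by (rule has_integral_spike[OF N _ DI[of n]]) (simp add: s_def)
  have bound: "norm (s n x) \<le> h x" for n x
  proof (cases "x \<in> N \<or> D n x = 0")
    case True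
    then show ?thesis using L(1) by (auto simp: s_def h_def)
  next
    case False
    have "\<bar>D n x\<bar> \<le> L * norm d"
    proof -
      have "\<bar>D n x\<bar> = \<bar>f (x + e n *\<^sub>R d) - f x\<bar> / e n" using e[of n] by (simp add: D_def)
      also have "\<dots> \<le> (L * norm (e n *\<^sub>R d)) / e n"
        by (rule divide_right_mono[OF L(2)]) (use e[of n] in simp)
      also have "\<dots> = L * norm d" using e[of n] by simp
      finally show ?thesis .
    qed
    moreover have "x \<in> cbox (- b) b"
    proof -
      have "f (x + e n *\<^sub>R d) \<noteq> 0 \<or> f x \<noteq> 0" using False by (auto simp: D_def)
      then have "x + e n *\<^sub>R d \<in> hullunion \<or> x \<in> hullunion" using P3D(2)[OF f] dom_subset by blast
      then have "norm (x + e n *\<^sub>R d) \<le> R \<or> norm x \<le> R" using R by blast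
      moreover have "norm (e n *\<^sub>R d) \<le> norm d" using e[of n] by (simp add: mult_left_le_one_le)
      moreover have "norm x \<le> norm (x + e n *\<^sub>R d) + norm (e n *\<^sub>R d)"
        using norm_triangle_ineq4[of "x + e n *\<^sub>R d" "e n *\<^sub>R d"] by simp
      ultimately have "norm x \<le> R + norm d" using norm_ge_zero[of d] by linarith
      then show ?thesis using b by auto
    qed
    ultimately show ?thesis using False by (simp add: s_def h_def)
  qed
  have lim: "(\<lambda>n. s n x) \<longlonglongrightarrow> (if x \<in> N then 0 else g x)" for x
  proof (cases "x \<in> N")
    case True
    then show ?thesis by (simp add: s_def)
  next
    case xN: False
    have "\<exists>F. (f has_derivative F) (at x) \<and> F d = g x"
    proof (cases "x \<in> hullunion")
      case True
      then obtain T where T: "T \<in> Th" "x \<in> convex hull T" by blast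
      have "x \<notin> frontier (convex hull T)" using xN T(1) by (auto simp: N_def)
      then have x: "x \<in> interior (convex hull T)"
        using T(2) closure_subset by (auto simp: frontier_def)
      have "(f has_derivative (\<lambda>h. dx (p T) x * fst h + dy (p T) x * snd h)) (at x)"
        by (rule has_derivative_transform_within_open[OF poly2_has_derivative[OF p(1)[OF T(1)]] open_interior x])
          (use p(2)[OF T(1)] interior_subset in \<open>metis subsetD\<close>)
      moreover have "g x = q T x"
      proof -
        have "g x = (\<Sum>T'\<in>Th. if T' = T then q T x else 0)"
          unfolding g_def
        proof (rule sum.cong[OF refl])
          fix T' assume T': "T' \<in> Th"
          have "x \<in> interior (convex hull T') \<longleftrightarrow> T' = T"
            using interior_hull_unique[OF T' T(1) _ T(2)] x by blast
          then show "(if x \<in> interior (convex hull T') then q T' x else 0) = (if T' = T then q T x else 0)" by simp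
        qed
        then show ?thesis using T(1) finite_Th by simp
      qed
      ultimately show ?thesis unfolding q_def by (intro exI conjI) auto
    next
      case False
      have "(f has_derivative (\<lambda>h. 0)) (at x)"
      proof (rule has_derivative_transform_within_open[of "\<lambda>_. 0" _ _ _ "- hullunion"])
        show "open (- hullunion)" using closed_hullunion by blast
        show "0 = f y" if "y \<in> - hullunion" for y using that P3D(2)[OF f] dom_subset by (metis ComplD subsetD)
      qed (use False in auto)
      moreover have "g x = 0"
        unfolding g_def
      proof (rule sum.neutral, rule ballI)
        fix T assume "T \<in> Th"
        then have "x \<notin> interior (convex hull T)" using False interior_subset[of "convex hull T"] by blast
        then show "(if x \<in> interior (convex hull T) then q T x else 0) = 0" by simp
      qed
      ultimately show ?thesis by (intro exI[of _ "\<lambda>_. 0"]) simp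
    qed
    then obtain F where "(f has_derivative F) (at x)" "F d = g x" by blast
    from difference_quotient_tendsto[OF this(1), of d] this(2)
    have "(\<lambda>n. D n x) \<longlonglongrightarrow> g x" by (simp only: D_def e_def)
    then show ?thesis using xN by (simp add: s_def)
  qed
  have "(\<lambda>n. integral UNIV (s n)) \<longlonglongrightarrow> integral UNIV (\<lambda>x. if x \<in> N then 0 else g x)"
    by (rule dominated_convergence(2)[OF _ h]) (use sI bound lim in \<open>auto simp: integrable_on_def\<close>)
  moreover have "integral UNIV (s n) = 0" for n using sI by (rule integral_unique)
  ultimately have "integral UNIV (\<lambda>x. if x \<in> N then 0 else g x) = 0"
    by (simp add: LIMSEQ_const_iff)
  then have "integral UNIV g = 0"
    using integral_spike[OF N, of UNIV g "\<lambda>x. if x \<in> N then 0 else g x"] by simp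
  have qp: "poly2 3 (q T)" if "T \<in> Th" for T
  proof -
    have "poly2 2 (\<lambda>x. fst d * dx (p T) x + snd d * dy (p T) x)"
      using poly2_dx[OF p(1)[OF that]] poly2_dy[OF p(1)[OF that]] by (intro poly2_add poly2_cmult) auto
    then have "poly2 2 (q T)" unfolding q_def by (simp only: mult.commute)
    then show ?thesis by (rule poly2_mono) simp
  qed
  have neg: "negligible (convex hull T - interior (convex hull T))" if "T \<in> Th" for T
    using negligible_convex_frontier[OF convex_convex_hull, of T] closure_subset
    by (elim negligible_subset) (auto simp: frontier_def)
  have qi: "q T integrable_on interior (convex hull T)" if "T \<in> Th" for T
  proof -
    have "(\<lambda>x. if x \<in> convex hull T then q T x else 0) integrable_on UNIV"
      using poly2_integrable_on_hull[OF that qp[OF that]] by (simp add: integrable_restrict_UNIV)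
    then have "(\<lambda>x. if x \<in> interior (convex hull T) then q T x else 0) integrable_on UNIV"
      by (rule integrable_spike[OF _ neg[OF that]]) (use interior_subset in auto)
    then show ?thesis by (simp add: integrable_restrict_UNIV)
  qed
  have "integral UNIV g = (\<Sum>T\<in>Th. integral UNIV (\<lambda>x. if x \<in> interior (convex hull T) then q T x else 0))"
    unfolding g_def by (rule integral_sum[OF finite_Th]) (simp add: integrable_restrict_UNIV qi)
  also have "\<dots> = (\<Sum>T\<in>Th. integral (convex hull T) (q T))"
  proof (rule sum.cong[OF refl])
    fix T assume T: "T \<in> Th"
    have "integral (interior (convex hull T)) (q T) = integral (convex hull T) (q T)"
      by (rule integral_subset_negligible[OF interior_subset neg[OF T]])
    then show "integral UNIV (\<lambda>x. if x \<in> interior (convex hull T) then q T x else 0) = integral (convex hull T) (q T)"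
      by (simp add: integral_restrict_UNIV)
  qed
  finally show ?thesis using \<open>integral UNIV g = 0\<close> by (simp add: q_def)
qed

lemma sum_integral_divergence:
  assumes U: "U \<in> fields"
  shows "(\<Sum>T\<in>Th. integral (convex hull T) (divergence U T)) = 0"
proof -
  have P: "(\<lambda>x. U (True, x)) \<in> P3" "(\<lambda>x. U (False, x)) \<in> P3" using U by (simp_all add: fields_def)
  have pc: "poly2 3 (piece 3 T f) \<and> (\<forall>y\<in>convex hull T. f y = piece 3 T f y)" if "f \<in> P3" "T \<in> Th" for f T
    using someI_ex[OF P3D(3)[OF that]] unfolding piece_def .
  define p1 p2 where "p1 = (\<lambda>T. piece 3 T (\<lambda>x. U (True, x)))" and "p2 = (\<lambda>T. piece 3 T (\<lambda>x. U (False, x)))"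
  have p: "poly2 3 (p1 T)" "poly2 3 (p2 T)" "divergence U T = (\<lambda>x. dx (p1 T) x + dy (p2 T) x)" if "T \<in> Th" for T
    using pc[OF P(1) that] pc[OF P(2) that] that by (simp_all add: p1_def p2_def divergence_def)
  have eq: "U (True, x) = p1 T x" "U (False, x) = p2 T x" if "T \<in> Th" "x \<in> convex hull T" for T x
    using pc[OF P(1) that(1)] pc[OF P(2) that(1)] that(2) unfolding p1_def p2_def by blast+
  have "(\<Sum>T\<in>Th. integral (convex hull T) (divergence U T))
    = (\<Sum>T\<in>Th. integral (convex hull T) (dx (p1 T)) + integral (convex hull T) (dy (p2 T)))"
  proof (rule sum.cong[OF refl])
    fix T assume T: "T \<in> Th"
    show "integral (convex hull T) (divergence U T) = integral (convex hull T) (dx (p1 T)) + integral (convex hull T) (dy (p2 T))"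
      unfolding p(3)[OF T]
      by (intro integral_add poly2_integrable_on_hull[OF T poly2_dx[OF p(1)[OF T]]]
          poly2_integrable_on_hull[OF T poly2_dy[OF p(2)[OF T]]])
  qed
  also have "\<dots> = 0"
    using sum_integral_directional_derivative[OF P(1) p(1) eq(1), where d = "(1, 0)"]
      sum_integral_directional_derivative[OF P(2) p(2) eq(2), where d = "(0, 1)"]
    by (simp add: sum.distrib)
  finally show ?thesis .
qed

end

section \<open>The dimension of the pressure space\<close>

interpretation pwfs: vector_space_pair pwscale "fscale :: real \<Rightarrow> ('a \<Rightarrow> real) \<Rightarrow> 'a \<Rightarrow> real"
  by unfold_locales

lemma poly2_2_eq:
  "(\<Sum>(i, j)\<in>{(0,0),(0,1),(0,2),(1,0),(1,1),(2,0)}. c i j * monom2 i j (x, y))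
    = c 0 0 + c 0 1 * y + c 0 2 * y ^ 2 + c 1 0 * x + c 1 1 * x * y + c (2::nat) (0::nat) * x ^ 2"
  for c :: "nat \<Rightarrow> nat \<Rightarrow> real"
  by simp

lemma poly2_2_coefficients_zero:
  fixes c0 :: real
  assumes "\<And>x y. c0 + c1 * y + c2 * y ^ 2 + c3 * x + c4 * x * y + c5 * x ^ 2 = 0"
  shows "c0 = 0 \<and> c1 = 0 \<and> c2 = 0 \<and> c3 = 0 \<and> c4 = 0 \<and> c5 = 0"
  using assms[of 0 0] assms[where x = 0 and y = 1] assms[where x = 0 and y = "-1"] assms[where x = 1 and y = 0]
    assms[where x = "-1" and y = 0] assms[where x = 1 and y = 1]
  by simp

context triangulation
begin

definition pw_quadratics :: "(pt set \<Rightarrow> pt \<Rightarrow> real) set" where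
  "pw_quadratics = {q. (\<forall>T. T \<notin> Th \<longrightarrow> q T = (\<lambda>x. 0)) \<and> (\<forall>T\<in>Th. poly2 2 (q T))}"

abbreviation (input) "quad_indices \<equiv> {(0,0),(0,1),(0,2),(1,0),(1,1),(2,0)} :: (nat \<times> nat) set"

definition quad_of :: "(pt set \<times> nat \<times> nat \<Rightarrow> real) \<Rightarrow> pt set \<Rightarrow> pt \<Rightarrow> real" where
  "quad_of c T x = (if T \<in> Th then \<Sum>(i, j)\<in>quad_indices. c (T, i, j) * monom2 i j x else 0)"

lemma subspace_pw_quadratics: "pw.subspace pw_quadratics"
  unfolding pw.subspace_def
proof (intro conjI ballI allI)
  show "0 \<in> pw_quadratics" by (simp add: pw_quadratics_def zero_fun_def)
next
  fix p q assume "p \<in> pw_quadratics" "q \<in> pw_quadratics"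
  then show "p + q \<in> pw_quadratics"
    by (simp add: pw_quadratics_def plus_fun_def poly2_add)
next
  fix c q assume "q \<in> pw_quadratics"
  then show "(\<lambda>T x. c * q T x) \<in> pw_quadratics"
    by (simp add: pw_quadratics_def poly2_cmult)
qed

lemma quad_of_apply:
  "T \<in> Th \<Longrightarrow> quad_of c T (x, y) = c (T, 0, 0) + c (T, 0, 1) * y + c (T, 0, 2) * y ^ 2 + c (T, 1, 0) * x
    + c (T, 1, 1) * x * y + c (T, 2, 0) * x ^ 2"
  using poly2_2_eq[of "\<lambda>i j. c (T, i, j)" x y] by (simp add: quad_of_def)

lemma inj_quad_of: "inj_on quad_of (supported (Th \<times> quad_indices))"
proof (rule inj_onI)
  fix c d assume c: "c \<in> supported (Th \<times> quad_indices)" "d \<in> supported (Th \<times> quad_indices)" and eq: "quad_of c = quad_of d"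
  show "c = d"
  proof
    fix k :: "pt set \<times> nat \<times> nat"
    obtain T i j where k: "k = (T, i, j)" by (cases k)
    show "c k = d k"
    proof (cases "k \<in> Th \<times> quad_indices")
      case True
      then have T: "T \<in> Th" using k by simp
      define e where "e = (\<lambda>i j. c (T, i, j) - d (T, i, j))"
      have "e 0 0 + e 0 1 * y + e 0 2 * y ^ 2 + e 1 0 * x + e 1 1 * x * y + e 2 0 * x ^ 2 = 0" for x y
      proof -
        have "quad_of c T (x, y) = quad_of d T (x, y)" using eq by simp
        then show ?thesis unfolding quad_of_apply[OF T] e_def by (simp add: algebra_simps)
      qed
      from poly2_2_coefficients_zero[OF this] have "e 0 0 = 0" "e 0 1 = 0" "e 0 2 = 0" "e 1 0 = 0" "e 1 1 = 0" "e 2 0 = 0"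
        by simp_all
      then show ?thesis using True k unfolding e_def by auto
    qed (use supportedD[OF c(1)] supportedD[OF c(2)] in metis)
  qed
qed

lemma image_quad_of: "quad_of ` supported (Th \<times> quad_indices) = pw_quadratics"
proof
  show "quad_of ` supported (Th \<times> quad_indices) \<subseteq> pw_quadratics"
  proof safe
    fix c :: "pt set \<times> nat \<times> nat \<Rightarrow> real"
    have "poly2 2 (quad_of c T)" if T: "T \<in> Th" for T
    proof -
      have "quad_of c T = (\<lambda>x. \<Sum>k\<in>quad_indices. c (T, fst k, snd k) * monom2 (fst k) (snd k) x)"
        using T by (intro ext) (simp add: quad_of_def)
      moreover have "poly2 2 (\<lambda>x. \<Sum>k\<in>quad_indices. c (T, fst k, snd k) * monom2 (fst k) (snd k) x)"
      proof (rule poly2_sum)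
        fix k assume "k \<in> quad_indices"
        then have "fst k + snd k \<le> 2" by auto
        then show "poly2 2 (\<lambda>x. c (T, fst k, snd k) * monom2 (fst k) (snd k) x)"
          by (rule poly2_cmult[OF poly2_monom2])
      qed
      ultimately show ?thesis by (simp only:)
    qed
    moreover have "quad_of c T = (\<lambda>x. 0)" if "T \<notin> Th" for T
      using that by (intro ext) (simp add: quad_of_def)
    ultimately show "quad_of c \<in> pw_quadratics" unfolding pw_quadratics_def by blast
  qed
  show "pw_quadratics \<subseteq> quad_of ` supported (Th \<times> quad_indices)"
  proof
    fix q assume q: "q \<in> pw_quadratics"
    then have "\<forall>T\<in>Th. \<exists>c. \<forall>x y. q T (x, y) = (\<Sum>i\<le>2. \<Sum>j\<le>2 - i. c i j * x ^ i * y ^ j)"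
      by (simp add: pw_quadratics_def poly2_def)
    from bchoice[OF this] obtain c where
      c: "\<And>T x y. T \<in> Th \<Longrightarrow> q T (x, y) = (\<Sum>i\<le>2. \<Sum>j\<le>2 - i. c T i j * x ^ i * y ^ j)" by blast
    define d where "d = (\<lambda>(T, i, j). if (T, i, j) \<in> Th \<times> quad_indices then c T i j else 0)"
    have "d \<in> supported (Th \<times> quad_indices)"
      unfolding supported_def d_def by (simp only: mem_Collect_eq case_prod_unfold prod.collapse) simp
    moreover have "quad_of d T = q T" for T
    proof (cases "T \<in> Th")
      case True
      have d: "d (T, 0, 0) = c T 0 0" "d (T, 0, 1) = c T 0 1" "d (T, 0, 2) = c T 0 2"
        "d (T, 1, 0) = c T 1 0" "d (T, 1, 1) = c T 1 1" "d (T, 2, 0) = c T 2 0"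
        using True by (simp_all add: d_def)
      have "quad_of d T (x, y) = q T (x, y)" for x y
        unfolding quad_of_apply[OF True] d c[OF True] by (simp add: eval_nat_numeral)
      then show ?thesis by (simp add: fun_eq_iff)
    next
      case False
      then show ?thesis using q by (simp add: quad_of_def pw_quadratics_def fun_eq_iff)
    qed
    ultimately show "q \<in> quad_of ` supported (Th \<times> quad_indices)" by (metis ext image_eqI)
  qed
qed

lemma dim_pw_quadratics: "pw.dim pw_quadratics = 6 * card Th"
proof -
  have "pw.dim (quad_of ` supported (Th \<times> quad_indices)) = fs.dim (supported (Th \<times> quad_indices))"
  proof (rule fspw.dim_image_inj_on[OF subspace_supported _ _ inj_quad_of])
    fix c d :: "pt set \<times> nat \<times> nat \<Rightarrow> real" and r :: real
    show "quad_of (c + d) = quad_of c + quad_of d"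
    proof (rule ext)+
      fix T x show "quad_of (c + d) T x = (quad_of c + quad_of d) T x"
        by (cases x; cases "T \<in> Th") (simp_all add: quad_of_apply distrib_right, simp_all add: quad_of_def)
    qed
    show "quad_of (\<lambda>k. r * c k) = (\<lambda>T x. r * quad_of c T x)"
    proof (rule ext)+
      fix T x show "quad_of (\<lambda>k. r * c k) T x = r * quad_of c T x"
        by (cases x; cases "T \<in> Th") (simp_all add: quad_of_apply distrib_left, simp_all add: quad_of_def)
    qed
  qed
  moreover have "fs.dim (supported (Th \<times> quad_indices)) = 6 * card Th"
    using dim_supported[of "Th \<times> quad_indices"] finite_Th by (simp add: card_cartesian_product)
  ultimately show ?thesis by (simp only: image_quad_of)
qed

section \<open>Mean value and singular vertices as independent constraints\<close>

abbreviation "singular_vertices \<equiv> {z. singular_vertex Th z}"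

lemma finite_singular_vertices: "finite singular_vertices"
  by (rule finite_subset[OF _ finite_vertices]) (auto simp: singular_vertex_def)

text \<open>Replacing \<open>s\<close> by its negative reverses all signs at \<open>z\<close>, but
  the condition only asks for a zero sum, so any fixed frame will do.\<close>

definition vertex_sign :: "pt \<Rightarrow> pt set \<Rightarrow> real" where
  "vertex_sign z = (SOME \<sigma>. \<exists>s t. frame z s t \<and> \<sigma> = quadrant_sign z s t)"

lemma vertex_sign:
  assumes "singular_vertex Th z"
  obtains s t where "frame z s t" "vertex_sign z = quadrant_sign z s t"
proof -
  obtain s t where "frame z s t" by (rule singular_vertex_frame[OF assms])
  then have "\<exists>\<sigma> s t. frame z s t \<and> \<sigma> = quadrant_sign z s t" by blast
  from someI_ex[OF this] show ?thesis using that unfolding vertex_sign_def by blast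
qed

text \<open>All conditions on a pressure as one linear map, with the mean at \<open>None\<close>.
  Independence of the conditions becomes surjectivity of this map onto a coordinate space, as the
  rank formula needs.\<close>

definition constraints :: "(pt set \<Rightarrow> pt \<Rightarrow> real) \<Rightarrow> pt option \<Rightarrow> real" where
  "constraints q k = (case k of None \<Rightarrow> \<Sum>T\<in>Th. integral (convex hull T) (q T)
     | Some z \<Rightarrow> if singular_vertex Th z then \<Sum>T\<in>star z. vertex_sign z T * q T z else 0)"

lemma Qh2_eq: "Qh2 Th = {q \<in> pw_quadratics. constraints q = 0}"
proof -
  have "(\<forall>z. singular_vertex Th z \<longrightarrow> (\<forall>Ts. vertex_enum Th z Ts \<longrightarrow> (\<Sum>j<length Ts. (-1) ^ j * q (Ts ! j) z) = 0))
    \<longleftrightarrow> (\<forall>z. singular_vertex Th z \<longrightarrow> (\<Sum>T\<in>star z. vertex_sign z T * q T z) = 0)" for q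
  proof (intro all_cong1 imp_cong refl)
    fix z assume z: "singular_vertex Th z"
    obtain s t where st: "frame z s t" "vertex_sign z = quadrant_sign z s t" by (rule vertex_sign[OF z])
    obtain Ts where "vertex_enum Th z Ts" using z unfolding singular_vertex_def by blast
    then show "(\<forall>Ts. vertex_enum Th z Ts \<longrightarrow> (\<Sum>j<length Ts. (-1) ^ j * q (Ts ! j) z) = 0)
      \<longleftrightarrow> (\<Sum>T\<in>star z. vertex_sign z T * q T z) = 0"
      unfolding st(2) using alternating_sum_iff[OF st(1)] by blast
  qed
  moreover have "constraints q = 0 \<longleftrightarrow> (\<Sum>T\<in>Th. integral (convex hull T) (q T)) = 0 \<and>
      (\<forall>z. singular_vertex Th z \<longrightarrow> (\<Sum>T\<in>star z. vertex_sign z T * q T z) = 0)" for q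
  proof
    assume 0: "constraints q = 0"
    show "(\<Sum>T\<in>Th. integral (convex hull T) (q T)) = 0 \<and>
      (\<forall>z. singular_vertex Th z \<longrightarrow> (\<Sum>T\<in>star z. vertex_sign z T * q T z) = 0)"
    proof (intro conjI allI impI)
      show "(\<Sum>T\<in>Th. integral (convex hull T) (q T)) = 0"
        using fun_cong[OF 0, of None] by (simp add: constraints_def)
      show "(\<Sum>T\<in>star z. vertex_sign z T * q T z) = 0" if "singular_vertex Th z" for z
        using fun_cong[OF 0, of "Some z"] that by (simp add: constraints_def)
    qed
  next
    assume "(\<Sum>T\<in>Th. integral (convex hull T) (q T)) = 0 \<and>
      (\<forall>z. singular_vertex Th z \<longrightarrow> (\<Sum>T\<in>star z. vertex_sign z T * q T z) = 0)"
    then show "constraints q = 0" by (intro ext) (simp add: constraints_def split: option.split)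
  qed
  ultimately show ?thesis unfolding Qh2_def pw_quadratics_def by blast
qed

lemma pw_quadratics_integrable: "q \<in> pw_quadratics \<Longrightarrow> T \<in> Th \<Longrightarrow> q T integrable_on convex hull T"
  using poly2_integrable_on_hull unfolding pw_quadratics_def by blast

lemma constraints_linear:
  assumes p: "p \<in> pw_quadratics" and q: "q \<in> pw_quadratics"
  shows "constraints (p + q) = constraints p + constraints q"
    "constraints (\<lambda>T x. c * q T x) = (\<lambda>k. c * constraints q k)"
proof -
  have i: "integral (convex hull T) (p T + q T) = integral (convex hull T) (p T) + integral (convex hull T) (q T)"
    if "T \<in> Th" for T
    using integral_add[OF pw_quadratics_integrable[OF p that] pw_quadratics_integrable[OF q that]]
    by (simp add: plus_fun_def)
  show "constraints (p + q) = constraints p + constraints q"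
    by (rule ext) (simp add: constraints_def i sum.distrib distrib_left split: option.split)
  show "constraints (\<lambda>T x. c * q T x) = (\<lambda>k. c * constraints q k)"
    by (rule ext) (simp add: constraints_def sum_distrib_left mult.left_commute split: option.split)
qed

text \<open>A product of two barycentric coordinates vanishes at all vertices of its triangle and is
  positive inside. Scaled to integral 1, it changes the mean and no vertex condition.\<close>

lemma exists_bubble: "\<exists>q\<in>pw_quadratics. constraints q = indicator {None}"
proof -
  obtain T0 where T0: "T0 \<in> Th" using Th_nonempty by blast
  obtain a b c where abc: "T0 = {a, b, c}" "a \<noteq> b"
    by (rule is_triangle_vertices[OF tri[OF T0]])
  have ab: "a \<in> T0" "b \<in> T0" using abc by auto
  define f where "f = (\<lambda>x. bary T0 a x * bary T0 b x)"
  have f: "poly2 2 f"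
    using poly2_mult[OF poly2_bary[OF tri[OF T0] ab(1)] poly2_bary[OF tri[OF T0] ab(2)]] unfolding f_def
    by (simp add: numeral_2_eq_2)
  have f0: "f v = 0" if "v \<in> T0" for v
    using abc(2) by (auto simp: f_def bary_vertex[OF tri[OF T0]] that ab)
  have nn: "0 \<le> f x" if "x \<in> convex hull T0" for x
    using that ab unfolding f_def convex_hull_bary[OF tri[OF T0]] by simp
  define m where "m = integral (convex hull T0) f"
  have "m > 0"
  proof -
    obtain y where y: "y \<in> interior (convex hull T0)" using interior_convex_hull_nonempty[OF tri[OF T0]] by blast
    obtain u v where uv: "cbox u v \<subseteq> interior (convex hull T0)" "y \<in> box u v"
      by (rule open_contains_cbox[OF open_interior y])
    have sub: "cbox u v \<subseteq> convex hull T0" using uv(1) interior_subset by blast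
    have i: "f integrable_on cbox u v" by (rule integrable_continuous[OF poly2_continuous_on[OF f]])
    have "integral (cbox u v) f \<noteq> 0"
    proof
      assume 0: "integral (cbox u v) f = 0"
      then have hi: "(f has_integral 0) (cbox u v)" using i by (metis integrable_integral)
      have "f y = 0"
      proof (rule has_integral_0_cbox_imp_0[OF poly2_continuous_on[OF f] _ hi])
        show "0 \<le> f x" if "x \<in> box u v" for x using nn sub box_subset_cbox that by blast
        show "box u v \<noteq> {}" using uv(2) by blast
        show "y \<in> cbox u v" using uv(2) box_subset_cbox by blast
      qed
      moreover have "f y > 0"
        unfolding f_def using interior_hull_bary_pos[OF T0 y] ab by simp
      ultimately show False by simp
    qed
    moreover have "0 \<le> integral (cbox u v) f" using i nn sub by (intro integral_nonneg) auto
    moreover have "integral (cbox u v) f \<le> m"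
      unfolding m_def using nn by (intro integral_subset_le[OF sub i poly2_integrable_on_hull[OF T0 f]]) blast
    ultimately show ?thesis by linarith
  qed
  define q where "q = (\<lambda>T x. if T = T0 then f x / m else 0)"
  have "q \<in> pw_quadratics"
  proof -
    have "poly2 2 (q T)" if "T \<in> Th" for T
    proof (cases "T = T0")
      case True
      then have "q T = (\<lambda>x. inverse m * f x)" by (simp add: q_def fun_eq_iff divide_inverse mult.commute)
      then show ?thesis using poly2_cmult[OF f] by simp
    qed (simp add: q_def)
    then show ?thesis using T0 by (auto simp: pw_quadratics_def q_def)
  qed
  moreover have "constraints q k = indicator {None} k" for k
  proof (cases k)
    case None
    have "(\<Sum>T\<in>Th. integral (convex hull T) (q T)) = (\<Sum>T\<in>Th. if T = T0 then 1 else 0)"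
      using \<open>m > 0\<close> by (intro sum.cong refl) (simp add: q_def m_def)
    then show ?thesis using None T0 finite_Th by (simp add: constraints_def)
  next
    case (Some z)
    have "vertex_sign z T * q T z = 0" if "T \<in> star z" for T
      using that f0[of z] by (auto simp: q_def star_def)
    then have "(\<Sum>T\<in>star z. vertex_sign z T * q T z) = 0" by (intro sum.neutral) blast
    then show ?thesis using Some by (simp add: constraints_def)
  qed
  ultimately show ?thesis by blast
qed

text \<open>Each singular vertex is assigned one triangle \<open>\<tau> z\<close> and the
  barycentric coordinate of \<open>z\<close> on it. This vanishes at the other two vertices, so one
  triangle can serve several singular vertices independently.\<close>

lemma exists_vertex_values:
  "\<exists>q\<in>pw_quadratics. \<forall>z. singular_vertex Th z \<longrightarrow> constraints q (Some z) = v z"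
proof -
  define \<tau> where "\<tau> = (\<lambda>z. SOME T. T \<in> star z)"
  have \<tau>: "\<tau> z \<in> star z" if "singular_vertex Th z" for z
  proof -
    have "\<exists>T. T \<in> star z" using that by (auto simp: singular_vertex_def vertices_def star_def)
    then show ?thesis unfolding \<tau>_def by (rule someI_ex)
  qed
  \<comment> \<open>The factor \<open>vertex_sign z T\<close> meets itself in the constraint at
    \<open>z\<close>, and its square is 1.\<close>
  define q where "q = (\<lambda>T x. \<Sum>z\<in>{z\<in>singular_vertices. \<tau> z = T}. v z * vertex_sign z T * bary T z x)"
  have fin: "finite {z\<in>singular_vertices. \<tau> z = T}" for T using finite_singular_vertices by simp
  have "q \<in> pw_quadratics"
    unfolding pw_quadratics_def
  proof (intro CollectI conjI allI impI ballI)
    fix T assume "T \<notin> Th"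
    then have "{z\<in>singular_vertices. \<tau> z = T} = {}" using \<tau> by (auto simp: star_def)
    then show "q T = (\<lambda>x. 0)" unfolding q_def by (simp only: sum.empty)
  next
    fix T assume T: "T \<in> Th"
    show "poly2 2 (q T)"
      unfolding q_def
    proof (rule poly2_sum)
      fix z assume "z \<in> {z\<in>singular_vertices. \<tau> z = T}"
      then have "z \<in> T" using \<tau>[of z] by (auto simp: star_def)
      then have "poly2 2 (bary T z)" using poly2_mono[OF poly2_bary[OF tri[OF T]]] by simp
      then show "poly2 2 (\<lambda>x. v z * vertex_sign z T * bary T z x)" by (rule poly2_cmult)
    qed
  qed
  moreover have "constraints q (Some y) = v y" if y: "singular_vertex Th y" for y
  proof -
    obtain s t where st: "frame y s t" "vertex_sign y = quadrant_sign y s t" by (rule vertex_sign[OF y])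
    have sq: "vertex_sign y (\<tau> y) * vertex_sign y (\<tau> y) = 1"
      unfolding st(2) using quadrant_sign_cases[OF st(1) \<tau>[OF y]] by auto
    have qy: "q T y = (if T = \<tau> y then v y * vertex_sign y T else 0)" if T: "T \<in> star y" for T
    proof -
      have "q T y = (\<Sum>z\<in>{z\<in>singular_vertices. \<tau> z = T}. if z = y then v y * vertex_sign y T else 0)"
        unfolding q_def
      proof (rule sum.cong[OF refl])
        fix z assume "z \<in> {z\<in>singular_vertices. \<tau> z = T}"
        then have "z \<in> T" using \<tau>[of z] by (auto simp: star_def)
        moreover have "T \<in> Th" "y \<in> T" using T by (auto simp: star_def)
        ultimately show "v z * vertex_sign z T * bary T z y = (if z = y then v y * vertex_sign y T else 0)"
          by (simp add: bary_vertex[OF tri])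
      qed
      also have "\<dots> = (if y \<in> {z\<in>singular_vertices. \<tau> z = T} then v y * vertex_sign y T else 0)"
        by (rule sum.delta[OF fin])
      finally show ?thesis using y by auto
    qed
    have "(\<Sum>T\<in>star y. vertex_sign y T * q T y) = (\<Sum>T\<in>star y. if T = \<tau> y then v y * (vertex_sign y (\<tau> y) * vertex_sign y (\<tau> y)) else 0)"
      by (rule sum.cong[OF refl]) (simp add: qy)
    also have "\<dots> = v y" using sq \<tau>[OF y] finite_star by simp
    finally show ?thesis using y by (simp add: constraints_def)
  qed
  ultimately show ?thesis by blast
qed

lemma image_constraints: "constraints ` pw_quadratics = supported (insert None (Some ` singular_vertices))"
proof
  show "constraints ` pw_quadratics \<subseteq> supported (insert None (Some ` singular_vertices))"
  proof safe
    fix q show "constraints q \<in> supported (insert None (Some ` singular_vertices))"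
      unfolding supported_def mem_Collect_eq
    proof (intro allI impI)
      fix k assume k: "k \<notin> insert None (Some ` singular_vertices)"
      then obtain z where "k = Some z" "\<not> singular_vertex Th z" by (cases k) auto
      then show "constraints q k = 0" by (simp add: constraints_def)
    qed
  qed
  show "supported (insert None (Some ` singular_vertices)) \<subseteq> constraints ` pw_quadratics"
  proof
    fix v :: "pt option \<Rightarrow> real" assume v: "v \<in> supported (insert None (Some ` singular_vertices))"
    obtain p where p: "p \<in> pw_quadratics" "\<And>z. singular_vertex Th z \<Longrightarrow> constraints p (Some z) = v (Some z)"
      using exists_vertex_values[of "\<lambda>z. v (Some z)"] by blast
    obtain b where b: "b \<in> pw_quadratics" "constraints b = indicator {None}" using exists_bubble by blast
    \<comment> \<open>The multiple of the bubble that corrects the mean; the values at the singular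
      vertices are left as they are.\<close>
    define c where "c = v None - constraints p None"
    define q where "q = p + (\<lambda>T x. c * b T x)"
    have cb: "(\<lambda>T x. c * b T x) \<in> pw_quadratics" by (rule pw.subspace_scale[OF subspace_pw_quadratics b(1)])
    have "q \<in> pw_quadratics" unfolding q_def by (rule pw.subspace_add[OF subspace_pw_quadratics p(1) cb])
    moreover have "constraints q k = v k" for k
    proof -
      have e: "constraints q k = constraints p k + c * indicator {None} k"
        unfolding q_def constraints_linear(1)[OF p(1) cb] using constraints_linear(2)[OF p(1) b(1), of c] b(2) by simp
      show ?thesis
      proof (cases k)
        case None then show ?thesis using e by (simp add: c_def)
      next
        case (Some z)
        show ?thesis
        proof (cases "singular_vertex Th z")
          case True then show ?thesis using e p(2) Some by simp
        next
          case False
          then have "v k = 0" using Some by (intro supportedD[OF v]) auto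
          then show ?thesis using e False Some by (simp add: constraints_def)
        qed
      qed
    qed
    ultimately show "v \<in> constraints ` pw_quadratics" by (metis ext image_eqI)
  qed
qed

lemma pw_quadratics_finite_dim: "\<exists>A. finite A \<and> pw_quadratics \<subseteq> pw.span A"
proof -
  obtain B where B: "B \<subseteq> pw_quadratics" "pw.independent B" "pw_quadratics \<subseteq> pw.span B" "card B = pw.dim pw_quadratics"
    using pw.basis_exists .
  have "card Th \<noteq> 0" using finite_Th Th_nonempty by simp
  then have "finite B" using B(4) dim_pw_quadratics by (metis card.infinite mult_is_0 zero_neq_numeral)
  then show ?thesis using B(3) by blast
qed

theorem dim_Qh2: "dimPW (Qh2 Th) + 1 + num_singular Th = 6 * card Th"
proof -
  obtain A where A: "finite A" "pw_quadratics \<subseteq> pw.span A" using pw_quadratics_finite_dim by blast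
  have "pw.dim pw_quadratics = pw.dim {q\<in>pw_quadratics. constraints q = 0} + fs.dim (constraints ` pw_quadratics)"
    by (rule pwfs.rank_nullity_on[OF subspace_pw_quadratics A]) (simp_all add: constraints_linear)
  moreover have "fs.dim (constraints ` pw_quadratics) = 1 + num_singular Th"
  proof -
    have "card (insert None (Some ` singular_vertices)) = 1 + card singular_vertices"
      using finite_singular_vertices by (simp add: card_image)
    then show ?thesis
      unfolding image_constraints num_singular_def
      using dim_supported[of "insert None (Some ` singular_vertices)"] finite_singular_vertices by simp
  qed
  ultimately show ?thesis unfolding dimPW_def Qh2_eq dim_pw_quadratics by simp
qed

lemma div_Vh3_subset_Qh2: "div_Vh3 Th \<subseteq> Qh2 Th"
proof
  fix q assume "q \<in> div_Vh3 Th"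
  then obtain U where U: "U \<in> fields" "q = divergence U" using image_divergence by blast
  have "poly2 2 (divergence U T)" if T: "T \<in> Th" for T
  proof -
    obtain p1 p2 where p: "poly2 3 p1" "poly2 3 p2" "\<forall>x\<in>convex hull T. U (True, x) = p1 x"
      "\<forall>x\<in>convex hull T. U (False, x) = p2 x" "divergence U T = (\<lambda>x. dx p1 x + dy p2 x)"
      by (rule fields_pieces[OF U(1) T])
    show ?thesis unfolding p(5) using poly2_dx[OF p(1)] poly2_dy[OF p(2)] by (intro poly2_add) simp_all
  qed
  then have "q \<in> pw_quadratics" by (simp add: pw_quadratics_def U(2)) (simp add: divergence_def)
  moreover have "constraints q k = 0" for k
  proof (cases k)
    case None
    then show ?thesis using sum_integral_divergence[OF U(1)] by (simp add: constraints_def U(2))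
  next
    case (Some z)
    show ?thesis
    proof (cases "singular_vertex Th z")
      case True
      obtain s t where st: "frame z s t" "vertex_sign z = quadrant_sign z s t" by (rule vertex_sign[OF True])
      then show ?thesis using divergence_alternating_sum[OF st(1) U(1)] Some by (simp add: constraints_def U(2))
    qed (simp add: constraints_def Some)
  qed
  ultimately show "q \<in> Qh2 Th" unfolding Qh2_eq by auto
qed

text \<open>A basis of the divergences extends to a finite basis of the pressures, and equal
  cardinality leaves no room for further elements.\<close>

lemma div_Vh3_eq_Qh2_iff: "div_Vh3 Th = Qh2 Th \<longleftrightarrow> dimPW (div_Vh3 Th) = dimPW (Qh2 Th)"
proof
  assume eq: "dimPW (div_Vh3 Th) = dimPW (Qh2 Th)"
  obtain A where A: "finite A" "pw_quadratics \<subseteq> pw.span A" using pw_quadratics_finite_dim by blast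
  have sub: "pw.subspace (div_Vh3 Th)"
  proof -
    have "U + W \<in> fields" "(\<lambda>x. c * U x) \<in> fields" if "U \<in> fields" "W \<in> fields" for U W c
      using that fs.subspace_add[OF subspace_fields] fs.subspace_scale[OF subspace_fields] by blast+
    moreover have "0 \<in> fields" by (rule fs.subspace_0[OF subspace_fields])
    moreover have "divergence 0 = 0"
      using divergence_linear(2)[OF fs.subspace_0[OF subspace_fields] fs.subspace_0[OF subspace_fields], of 0]
      by (simp add: zero_fun_def)
    ultimately show ?thesis
      unfolding pw.subspace_def image_divergence[symmetric]
      by (auto simp: divergence_linear(1)[symmetric] divergence_linear(2)[symmetric])
  qed
  obtain B where B: "B \<subseteq> div_Vh3 Th" "pw.independent B" "div_Vh3 Th \<subseteq> pw.span B" "card B = pw.dim (div_Vh3 Th)"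
    using pw.basis_exists .
  obtain C where C: "B \<subseteq> C" "C \<subseteq> Qh2 Th" "pw.independent C" "Qh2 Th \<subseteq> pw.span C"
    using pw.maximal_independent_subset_extend[of B "Qh2 Th"] B div_Vh3_subset_Qh2 by blast
  have "C \<subseteq> pw.span A" using C(2) A(2) unfolding Qh2_eq by blast
  then have "finite C" using pw.independent_span_bound[OF A(1) C(3)] by blast
  moreover have "card C = card B"
    using eq B(4) pw.basis_card_eq_dim[OF C(2,4,3)] by (simp add: dimPW_def)
  ultimately have "B = C" using C(1) by (metis card_subset_eq)
  then have "Qh2 Th \<subseteq> div_Vh3 Th"
    using C(4) pw.span_minimal[OF B(1) sub] by blast
  then show "div_Vh3 Th = Qh2 Th" using div_Vh3_subset_Qh2 by blast
qed simp

end

theorem mainTheorem14: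
  fixes Th :: "pt set set"
  assumes "conforming Th"
    and "simply_connected (dom_of Th)"
    and "int (card (interior_edges Th)) + 3 * int (card (interior_vertices Th)) + int (num_singular Th)
           \<ge> int (card (edges Th)) - int (card (interior_edges Th))"
  shows "(div_Vh3 Th = Qh2 Th \<longleftrightarrow>
            int (dimF (Sh4 Th)) = 2 * int (card (interior_edges Th)) - int (card (edges Th))
               + 3 * int (card (interior_vertices Th)) + int (num_singular Th))
       \<and> (\<forall>K :: int. int (dimPW (div_Vh3 Th)) = int (dimPW (Qh2 Th)) - K \<longleftrightarrow>
            int (dimF (Sh4 Th)) = 2 * int (card (interior_edges Th)) - int (card (edges Th))
               + 3 * int (card (interior_vertices Th)) + int (num_singular Th) + K)"
proof -
  interpret triangulation Th by unfold_locales (rule assms(1))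
  have conn: "connected \<Omega>" by (rule simply_connected_imp_connected[OF assms(2)])
  have compl: "connected (- \<Omega>)"
    by (rule simply_connected_imp_connected_Compl[OF open_dom bounded_dom assms(2)])
  have "int (card (interior_vertices Th)) + int (card Th) = int (card (interior_edges Th)) + 1"
    using euler_relation[OF conn compl] by presburger
  moreover have "int (card (edges Th)) + int (card (interior_edges Th)) = 3 * int (card Th)"
    using card_edges_triangles by presburger
  moreover have "int (dimPW (div_Vh3 Th)) + int (dimF (Sh4 Th)) =
      2 * (int (card (interior_vertices Th)) + 2 * int (card (interior_edges Th)) + int (card Th))"
    using dim_div_plus_dim_Sh4[OF compl] by presburger
  moreover have "int (dimPW (Qh2 Th)) + 1 + int (num_singular Th) = 6 * int (card Th)"
    using dim_Qh2 by presburger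
  \<comment> \<open>With \<open>\<sigma>\<close> for the number of singular vertices, the left side
    says that the quartic space has dimension 2 V0 + 4 E0 - 4 T + 1 + \<sigma> + K. By E = 3 T - E0
    the right side asks for 3 E0 - 3 T + 3 V0 + \<sigma> + K. The difference E0 + 1 - V0 - T is zero
    by the Euler relation.\<close>
  ultimately have K: "int (dimPW (div_Vh3 Th)) = int (dimPW (Qh2 Th)) - K \<longleftrightarrow>
            int (dimF (Sh4 Th)) = 2 * int (card (interior_edges Th)) - int (card (edges Th))
               + 3 * int (card (interior_vertices Th)) + int (num_singular Th) + K" for K
    by auto
  have "div_Vh3 Th = Qh2 Th \<longleftrightarrow> int (dimPW (div_Vh3 Th)) = int (dimPW (Qh2 Th)) - 0"
    unfolding div_Vh3_eq_Qh2_iff by simp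
  also note K[of 0]
  finally show ?thesis using K by (simp only: add_0_right simp_thms)
qed

end
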